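(* For every constant $k$, the problem of listing the maximal edge-induced $k$-degenerate subgraphs of a graph $G$ is proximity searchable, and these subgraphs can be enumerated (each exactly once) with delay $O(\binom{n}{k-1}m^3)$.
   Context: $G$ is a simple undirected graph with $n$ vertices and $m$ edges (isolated vertices disregarded). A graph is $k$-degenerate if every subgraph has a vertex of degree at most $k$. A maximal edge-induced $k$-degenerate subgraph is an inclusion-maximal $F\subseteq E(G)$ such that the graph with edge set $F$ and vertex set the endpoints of $F$ is $k$-degenerate. A listing problem with universe $\mathcal{U}$ (here $E(G)$) and set $\mathcal{S}$ of solutions to list is proximity searchable if there exist $\tilde{\cap}:\mathcal{S}\times\mathcal{S}\to 2^{\mathcal{U}}$ and $\mathrm{neighbors}:\mathcal{S}\to 2^{\mathcal{S}}$ such that one solution can be found in time polynomial in $|\mathcal{U}|$, $\mathrm{neighbors}$ is computable in time polynomial in $|\mathcal{U}|$, and for any two distinct $S,S^*\in\mathcal{S}$ some $S'\in\mathrm{neighbors}(S)$ satisfies $|S'\,\tilde{\cap}\,S^*|>|S\,\tilde{\cap}\,S^*|$. Delay is the maximum time before the first output, between consecutive outputs, and after the last output. *)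

theory Defs
  imports Complex_Main "HOL-Computational_Algebra.Polynomial"
begin

section \<open>Model of computation\<close>

text \<open>
  A uniform-cost random access machine, presented as a structured language: finitely many scalar
  variables and unbounded zero-initialised arrays per program, all holding natural numbers.
  Addition and truncated subtraction are the only arithmetic operations. Multiplication is left out
  because at unit cost it would produce numbers of exponential bit length in polynomial time; without
  it, polynomial time is the same as on Turing machines.
\<close>

type_synonym vname = string

record state =
  var :: "vname \<Rightarrow> nat"
  arr :: "vname \<Rightarrow> nat \<Rightarrow> nat"

datatype aexp = N nat | V vname | Arr vname aexp | Plus aexp aexp | Minus aexp aexp

datatype bexp = Eq aexp aexp | Less aexp aexp | BNot bexp | BAnd bexp bexp

datatype com =
    SKIP
  | Assign vname aexp
  | Store vname aexp aexp
  | Seq com com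
  | Cond bexp com com
  | While bexp com
  | Emit aexp
  | Finish

fun aval :: "aexp \<Rightarrow> state \<Rightarrow> nat" where
  "aval (N n) s = n"
| "aval (V x) s = var s x"
| "aval (Arr x a) s = arr s x (aval a s)"
| "aval (Plus a b) s = aval a s + aval b s"
| "aval (Minus a b) s = aval a s - aval b s"

fun bval :: "bexp \<Rightarrow> state \<Rightarrow> bool" where
  "bval (Eq a b) s \<longleftrightarrow> aval a s = aval b s"
| "bval (Less a b) s \<longleftrightarrow> aval a s < aval b s"
| "bval (BNot b) s \<longleftrightarrow> \<not> bval b s"
| "bval (BAnd b c) s \<longleftrightarrow> bval b s \<and> bval c s"

fun acost :: "aexp \<Rightarrow> nat" where
  "acost (N n) = 1"
| "acost (V x) = 1"
| "acost (Arr x a) = acost a + 1"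
| "acost (Plus a b) = acost a + acost b + 1"
| "acost (Minus a b) = acost a + acost b + 1"

fun bcost :: "bexp \<Rightarrow> nat" where
  "bcost (Eq a b) = acost a + acost b + 1"
| "bcost (Less a b) = acost a + acost b + 1"
| "bcost (BNot b) = bcost b + 1"
| "bcost (BAnd b c) = bcost b + bcost c + 1"

text \<open>
  A run produces a trace with one event per unit of time, so its running time is the length of the
  trace. \<open>Out x\<close> appends \<open>x\<close> to the object being written, and \<open>End\<close> outputs that object and starts
  a new one. Writing an object thus costs at least its length.
\<close>

datatype event = Tick | Out nat | End

abbreviation ticks :: "nat \<Rightarrow> event list" where
  "ticks n \<equiv> replicate n Tick"

inductive exec :: "com \<Rightarrow> state \<Rightarrow> event list \<Rightarrow> state \<Rightarrow> bool" where
  Skip: "exec SKIP s [Tick] s"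
| Assign: "exec (Assign x a) s (ticks (acost a + 1)) (s\<lparr>var := (var s)(x := aval a s)\<rparr>)"
| Store: "exec (Store x i a) s (ticks (acost i + acost a + 1))
    (s\<lparr>arr := (arr s)(x := (arr s x)(aval i s := aval a s))\<rparr>)"
| Seq: "exec c s t s' \<Longrightarrow> exec d s' u s'' \<Longrightarrow> exec (Seq c d) s (t @ u) s''"
| CondTrue: "bval b s \<Longrightarrow> exec c s t s' \<Longrightarrow> exec (Cond b c d) s (ticks (bcost b) @ t) s'"
| CondFalse: "\<not> bval b s \<Longrightarrow> exec d s t s' \<Longrightarrow> exec (Cond b c d) s (ticks (bcost b) @ t) s'"
| WhileFalse: "\<not> bval b s \<Longrightarrow> exec (While b c) s (ticks (bcost b)) s"
| WhileTrue: "bval b s \<Longrightarrow> exec c s t s' \<Longrightarrow> exec (While b c) s' u s'' \<Longrightarrow>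
    exec (While b c) s (ticks (bcost b) @ t @ u) s''"
| Emit: "exec (Emit a) s (ticks (acost a) @ [Out (aval a s)]) s"
| Finish: "exec Finish s [End] s"

inductive_cases exec_elims:
  "exec SKIP s t s'" "exec (Assign x a) s t s'" "exec (Store x i a) s t s'"
  "exec (Seq c d) s t s'" "exec (Cond b c d) s t s'" "exec (While b c) s t s'"
  "exec (Emit a) s t s'" "exec Finish s t s'"

lemma exec_deterministic:
  "exec c s t s' \<Longrightarrow> exec c s u s'' \<Longrightarrow> u = t \<and> s'' = s'"
proof (induction arbitrary: u s'' rule: exec.induct)
  case (Seq c s t s' d u s'')
  from Seq.prems show ?case
    by (rule exec_elims) (use Seq.IH in blast)
next
  case (CondTrue b s c t s' d)
  from CondTrue.prems show ?case
    by (rule exec_elims) (use CondTrue.hyps(1) CondTrue.IH in blast)+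
next
  case (CondFalse b s d t s' c)
  from CondFalse.prems show ?case
    by (rule exec_elims) (use CondFalse.hyps(1) CondFalse.IH in blast)+
next
  case (WhileFalse b s c)
  from WhileFalse.prems show ?case
    by (rule exec_elims) (use WhileFalse.hyps in blast)+
next
  case (WhileTrue b s c t s' u s'')
  from WhileTrue.prems show ?case
    by (rule exec_elims) (use WhileTrue.hyps(1) WhileTrue.IH in blast)+
qed (erule exec_elims; simp)+

text \<open>
  The pieces of a trace up to and including each \<open>End\<close>, followed by the (possibly empty) piece after
  the last one.
\<close>

fun segments :: "event list \<Rightarrow> event list list" where
  "segments [] = [[]]"
| "segments (e # t) =
    (if e = End then [e] # segments t else (e # hd (segments t)) # tl (segments t))"

fun emitted :: "event list \<Rightarrow> nat list" where
  "emitted [] = []"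
| "emitted (Out x # t) = x # emitted t"
| "emitted (_ # t) = emitted t"

definition outputs :: "event list \<Rightarrow> nat list list" where
  "outputs t = map emitted (butlast (segments t))"

definition delay :: "event list \<Rightarrow> nat" where
  "delay t = Max (length ` set (segments t))"

text \<open>A list is passed in an array, with its length in cell 0 and its members in cells 1, 2, \<dots>\<close>

definition array_of :: "nat list \<Rightarrow> nat \<Rightarrow> nat" where
  "array_of xs j = (case j of 0 \<Rightarrow> length xs | Suc i \<Rightarrow> if i < length xs then xs ! i else 0)"

definition initial :: "nat list \<Rightarrow> nat list \<Rightarrow> state" where
  "initial xs ys =
    \<lparr>var = (\<lambda>_. 0), arr = (\<lambda>_ _. 0)(''I'' := array_of xs, ''S'' := array_of ys)\<rparr>"


section \<open>Listing problems\<close>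

text \<open>
  The universe is given as a list without repetitions: programs refer to its elements by their
  positions in this list. \<open>encode\<close> is the form in which an instance is given to a program.
\<close>

record ('i, 'u) listing_problem =
  instances :: "'i set"
  universe :: "'i \<Rightarrow> 'u list"
  solutions :: "'i \<Rightarrow> 'u set set"
  encode :: "'i \<Rightarrow> nat list"

definition represents :: "'u list \<Rightarrow> nat list \<Rightarrow> 'u set \<Rightarrow> bool" where
  "represents us xs S \<longleftrightarrow> distinct xs \<and> set xs \<subseteq> {..<length us} \<and> S = (!) us ` set xs"

definition finds_solution_in_poly_time :: "('i, 'u) listing_problem \<Rightarrow> bool" where
  "finds_solution_in_poly_time P \<longleftrightarrow>
    (\<exists>(c :: com) (p :: nat poly). \<forall>i \<in> instances P. \<exists>t s' xs S.
      exec c (initial (encode P i) []) t s' \<and>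
      length t \<le> poly p (length (universe P i)) \<and>
      outputs t = [xs] \<and> represents (universe P i) xs S \<and> S \<in> solutions P i)"

definition computable_in_poly_time ::
    "('i, 'u) listing_problem \<Rightarrow> ('i \<Rightarrow> 'u set \<Rightarrow> 'u set set) \<Rightarrow> bool" where
  "computable_in_poly_time P f \<longleftrightarrow>
    (\<exists>(c :: com) (p :: nat poly). \<forall>i \<in> instances P. \<forall>S \<in> solutions P i. \<forall>xs.
      represents (universe P i) xs S \<longrightarrow>
      (\<exists>t s' Ss.
        exec c (initial (encode P i) xs) t s' \<and>
        length t \<le> poly p (length (universe P i)) \<and>
        list_all2 (represents (universe P i)) (outputs t) Ss \<and> set Ss = f i S))"

definition proximity_searchable :: "('i, 'u) listing_problem \<Rightarrow> bool" where
  "proximity_searchable P \<longleftrightarrow>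
    (\<exists>(prox :: 'i \<Rightarrow> 'u set \<Rightarrow> 'u set \<Rightarrow> 'u set) (neighbors :: 'i \<Rightarrow> 'u set \<Rightarrow> 'u set set).
      (\<forall>i \<in> instances P. \<forall>S \<in> solutions P i. \<forall>T \<in> solutions P i.
        prox i S T \<subseteq> set (universe P i)) \<and>
      (\<forall>i \<in> instances P. \<forall>S \<in> solutions P i. neighbors i S \<subseteq> solutions P i) \<and>
      finds_solution_in_poly_time P \<and>
      computable_in_poly_time P neighbors \<and>
      (\<forall>i \<in> instances P. \<forall>S \<in> solutions P i. \<forall>T \<in> solutions P i. S \<noteq> T \<longrightarrow>
        (\<exists>S' \<in> neighbors i S. card (prox i S' T) > card (prox i S T))))"

text \<open>
  Listing all solutions, each exactly once, with delay \<open>O(f)\<close>. The maximum with 1 only matters where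
  \<open>f\<close> vanishes: no program runs in time 0.
\<close>

definition enumerable_with_delay :: "('i, 'u) listing_problem \<Rightarrow> ('i \<Rightarrow> nat) \<Rightarrow> bool" where
  "enumerable_with_delay P f \<longleftrightarrow>
    (\<exists>(c :: com) (C :: nat). \<forall>i \<in> instances P. \<exists>t s' Ss.
      exec c (initial (encode P i) []) t s' \<and>
      list_all2 (represents (universe P i)) (outputs t) Ss \<and>
      distinct Ss \<and> set Ss = solutions P i \<and>
      delay t \<le> C * max 1 (f i))"


section \<open>Degenerate subgraphs\<close>

text \<open>A set of edges stands for the graph whose vertices are the endpoints of these edges.\<close>

type_synonym 'v edges = "'v set set"

definition vertex_degree :: "'v edges \<Rightarrow> 'v \<Rightarrow> nat" where
  "vertex_degree D v = card {e \<in> D. v \<in> e}"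

text \<open>
  The subgraphs \<open>(W, D)\<close> considered need not be induced and may have isolated vertices; only the
  subgraph without vertices is excluded.
\<close>

definition degenerate :: "nat \<Rightarrow> 'v edges \<Rightarrow> bool" where
  "degenerate k F \<longleftrightarrow>
    (\<forall>W D. W \<subseteq> \<Union>F \<and> W \<noteq> {} \<and> D \<subseteq> F \<and> \<Union>D \<subseteq> W \<longrightarrow> (\<exists>v \<in> W. vertex_degree D v \<le> k))"

definition maximal_degenerate :: "nat \<Rightarrow> 'v edges \<Rightarrow> 'v edges \<Rightarrow> bool" where
  "maximal_degenerate k E F \<longleftrightarrow>
    F \<subseteq> E \<and> degenerate k F \<and> (\<forall>F'. F \<subset> F' \<and> F' \<subseteq> E \<longrightarrow> \<not> degenerate k F')"

text \<open>
  As an instance, a simple graph without isolated vertices is presented by a list of its edges, in an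
  arbitrary order and each given by its endpoints in an arbitrary order. Its vertices are named
  \<open>0, \<dots>, n - 1\<close>.
\<close>

type_synonym graph = "(nat \<times> nat) list"

definition edge_list :: "graph \<Rightarrow> nat set list" where
  "edge_list G = map (\<lambda>(a, b). {a, b}) G"

definition edges :: "graph \<Rightarrow> nat edges" where
  "edges G = set (edge_list G)"

definition vertices :: "graph \<Rightarrow> nat set" where
  "vertices G = \<Union>(edges G)"

definition simple_graph :: "graph \<Rightarrow> bool" where
  "simple_graph G \<longleftrightarrow>
    (\<forall>(a, b) \<in> set G. a \<noteq> b) \<and> distinct (edge_list G) \<and> vertices G = {..<card (vertices G)}"

definition degenerate_subgraph_listing :: "nat \<Rightarrow> (graph, nat set) listing_problem" where
  "degenerate_subgraph_listing k =
    \<lparr>instances = {G. simple_graph G},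
     universe = edge_list,
     solutions = (\<lambda>G. {F. maximal_degenerate k (edges G) F}),
     encode = (\<lambda>G. card (vertices G) # card (edges G) # concat (map (\<lambda>(a, b). [a, b]) G))\<rparr>"

end

theory Submission
  imports Defs "HOL-Library.Nat_Bijection"
begin

text \<open>
  Let \<open>e\<^sub>1, \<dots>, e\<^sub>r\<close> be the edges of a \<open>k\<close>-degenerate \<open>T\<close>, ordered such that each \<open>e\<^sub>i\<close> has an endpoint of
  degree at most \<open>k\<close> in \<open>e\<^sub>1, \<dots>, e\<^sub>i\<close>: repeatedly remove an edge at a vertex of low degree, from the
  back. The proximity of \<open>S\<close> to \<open>T\<close> is the longest prefix contained in \<open>S\<close>. Let \<open>e\<close> be the first edge
  outside \<open>S\<close>, and \<open>v\<close> its endpoint of low degree. Guess the at most \<open>k - 1\<close> other prefix edges at \<open>v\<close>,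
  remove the other edges at \<open>v\<close> from \<open>S\<close>, add \<open>e\<close> and complete greedily; this gives a neighbour with a
  longer common prefix. There are \<open>2 m\<close> choices of \<open>(e, v)\<close> and at most \<open>n\<close> to the \<open>k - 1\<close> guesses, and
  the completion takes \<open>m\<close> linear-time degeneracy tests.

  The enumeration is a breadth-first search along neighbours. A solution is stored as a single number,
  the binary code of its set of edges, which also serves as its address in a table of visited
  solutions.
\<close>

section \<open>A program logic with time bounds and outputs\<close>

text \<open>The programs never know \<open>T\<close> or its order; these only serve to show
  progress, while every edge, endpoint and guess is tried. A guess consists of other endpoints
  rather than edges: as \<open>G\<close> is simple they determine the edges at \<open>v\<close>, so
  that \<open>n\<close>, not \<open>m\<close>, gets the exponent \<open>k - 1\<close>. Guesses are
  run through as all tuples of length \<open>k - 1\<close>. Repeated entries cover smaller sets, and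
  the tuples outnumber the sets of size \<open>k - 1\<close> only by a factor depending on
  \<open>k\<close>, unless there are very few vertices. The case \<open>k = 0\<close> stands apart,
  since the new edge alone would exceed the degree bound; there the empty set is the only solution.
  The number of solutions may be exponential, so a bound on the total time says nothing about the
  delay. A logic for total time therefore handles everything up to one step of the search, and the
  search loop itself is analysed on its trace, piece by piece. Listing each solution once rests on
  the table \<open>D\<close>: arrays are unbounded and start at 0, so one look-up decides whether a
  code is new.\<close>

definition behaves :: "event list \<Rightarrow> nat list list \<Rightarrow> bool" where
  "behaves t os \<longleftrightarrow> (\<forall>u. outputs (t @ u) = os @ outputs u)"

section \<open>Traces and the outputs they contribute\<close>

lemma segments_not_Nil [simp]: "segments t \<noteq> []"
  by (cases t) auto

lemma segments_append_End:
  "End \<notin> set w \<Longrightarrow> segments (w @ End # u) = (w @ [End]) # segments u"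
  by (induction w) auto

lemma segments_no_End: "End \<notin> set w \<Longrightarrow> segments w = [w]"
  by (induction w) auto

lemma outputs_Nil [simp]: "outputs [] = []"
  by (simp add: outputs_def)

lemma outputs_Tick [simp]: "outputs (Tick # u) = outputs u"
  by (cases "segments u") (auto simp: outputs_def)

lemma outputs_eq_Nil_iff: "outputs t = [] \<longleftrightarrow> End \<notin> set t"
proof (cases "End \<in> set t")
  case True
  then obtain w u where "t = w @ End # u" "End \<notin> set w"
    by (meson split_list_first)
  then show ?thesis
    by (simp add: outputs_def segments_append_End)
qed (simp add: outputs_def segments_no_End)

lemma behaves_Nil [simp]: "behaves [] []"
  by (simp add: behaves_def)

text \<open>Contributions concatenate because \<open>behaves\<close> quantifies over all
  continuations \<open>u\<close>. The price is that \<open>t\<close> may not leave a half-written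
  object, whose letters would show up in the first object of \<open>u\<close>.\<close>

lemma behaves_append: "behaves t os \<Longrightarrow> behaves u os' \<Longrightarrow> behaves (t @ u) (os @ os')"
  by (simp add: behaves_def)

lemma behaves_ticks [simp]: "behaves (ticks n) []"
  by (induction n) (auto simp: behaves_def)

lemma behaves_ticks_append: "behaves t os \<Longrightarrow> behaves (ticks n @ t) os"
  using behaves_append[of "ticks n" "[]"] by simp

lemma behaves_append_End: "End \<notin> set w \<Longrightarrow> behaves (w @ [End]) [emitted w]"
proof -
  assume w: "End \<notin> set w"
  have "emitted (w @ [End]) = emitted w"
    by (induction w rule: emitted.induct) auto
  with w show ?thesis
    by (simp add: behaves_def outputs_def segments_append_End)
qed

lemma outputs_eq: "behaves t os \<Longrightarrow> outputs t = os"
  by (metis append_Nil2 behaves_def outputs_Nil)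

lemma no_End: "behaves t [] \<Longrightarrow> End \<notin> set t"
  by (metis outputs_eq outputs_eq_Nil_iff)

lemma emitted_append: "emitted (t @ u) = emitted t @ emitted u"
  by (induction t rule: emitted.induct) auto

lemma emitted_ticks [simp]: "emitted (ticks n) = []"
  by (induction n) auto

text \<open>The postcondition sees the outputs produced so far, starting from \<open>os\<close>.\<close>

definition wp :: "com \<Rightarrow> nat \<Rightarrow> (nat list list \<Rightarrow> state \<Rightarrow> bool) \<Rightarrow> nat list list \<Rightarrow> state \<Rightarrow> bool" where
  "wp c T Q os s \<longleftrightarrow>
    (\<exists>t s' os'. exec c s t s' \<and> length t \<le> T \<and> behaves t os' \<and> Q (os @ os') s')"

fun wvars :: "com \<Rightarrow> vname set" where
  "wvars (Assign x a) = {x}"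
| "wvars (Seq c d) = wvars c \<union> wvars d"
| "wvars (Cond b c d) = wvars c \<union> wvars d"
| "wvars (While b c) = wvars c"
| "wvars _ = {}"

fun warrs :: "com \<Rightarrow> vname set" where
  "warrs (Store x i a) = {x}"
| "warrs (Seq c d) = warrs c \<union> warrs d"
| "warrs (Cond b c d) = warrs c \<union> warrs d"
| "warrs (While b c) = warrs c"
| "warrs _ = {}"

definition frame :: "com \<Rightarrow> state \<Rightarrow> state \<Rightarrow> bool" where
  "frame c s s' \<longleftrightarrow>
    (\<forall>x. x \<notin> wvars c \<longrightarrow> var s' x = var s x) \<and> (\<forall>x. x \<notin> warrs c \<longrightarrow> arr s' x = arr s x)"

lemma frame_var: "frame c s s' \<Longrightarrow> x \<notin> wvars c \<Longrightarrow> var s' x = var s x"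
  and frame_arr: "frame c s s' \<Longrightarrow> x \<notin> warrs c \<Longrightarrow> arr s' x = arr s x"
  by (auto simp: frame_def)

lemma frame_refl [simp]: "frame c s s"
  by (simp add: frame_def)

lemma frame_trans: "frame c s s' \<Longrightarrow> frame c s' s'' \<Longrightarrow> frame c s s''"
  by (simp add: frame_def)

lemma exec_frame: "exec c s t s' \<Longrightarrow> frame c s s'"
  by (induction rule: exec.induct) (auto simp: frame_def)

text \<open>Every run leaves alone what its program does not write, so the frame condition comes for
  free when a postcondition is weakened. Specifications therefore mention only what changes.\<close>

lemma wp_mono:
  "wp c T Q os s \<Longrightarrow> T \<le> T' \<Longrightarrow> (\<And>os' s'. Q os' s' \<Longrightarrow> frame c s s' \<Longrightarrow> Q' os' s') \<Longrightarrow> wp c T' Q' os s"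
  unfolding wp_def using exec_frame by (meson le_trans)

lemma wp_Seq:
  assumes "wp c T (\<lambda>os' s'. frame c s s' \<longrightarrow> wp d T' Q os' s') os s" "T + T' \<le> T''"
  shows "wp (Seq c d) T'' Q os s"
proof -
  obtain t s' os' where 1: "exec c s t s'" "length t \<le> T" "behaves t os'" "wp d T' Q (os @ os') s'"
    using assms(1) exec_frame unfolding wp_def[of c] by blast
  then obtain u s'' os'' where "exec d s' u s''" "length u \<le> T'" "behaves u os''"
      "Q ((os @ os') @ os'') s''"
    unfolding wp_def by blast
  with 1 assms(2) have "exec (Seq c d) s (t @ u) s''" "length (t @ u) \<le> T''"
      "behaves (t @ u) (os' @ os'')" "Q (os @ os' @ os'') s''"
    by (auto intro: exec.Seq behaves_append)
  then show ?thesis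
    unfolding wp_def by blast
qed

lemma wp_Cond:
  assumes "bval b s \<Longrightarrow> wp c T Q os s" "\<not> bval b s \<Longrightarrow> wp d T Q os s" "bcost b + T \<le> T'"
  shows "wp (Cond b c d) T' Q os s"
proof (cases "bval b s")
  case True
  then obtain t s' os' where 1: "exec c s t s'" "length t \<le> T" "behaves t os'" "Q (os @ os') s'"
    using assms(1) unfolding wp_def by blast
  then have "exec (Cond b c d) s (ticks (bcost b) @ t) s'" "length (ticks (bcost b) @ t) \<le> T'"
      "behaves (ticks (bcost b) @ t) os'"
    using True assms(3) by (auto intro: exec.CondTrue behaves_ticks_append)
  with 1 show ?thesis unfolding wp_def by blast
next
  case False
  then obtain t s' os' where 1: "exec d s t s'" "length t \<le> T" "behaves t os'" "Q (os @ os') s'"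
    using assms(2) unfolding wp_def by blast
  then have "exec (Cond b c d) s (ticks (bcost b) @ t) s'" "length (ticks (bcost b) @ t) \<le> T'"
      "behaves (ticks (bcost b) @ t) os'"
    using False assms(3) by (auto intro: exec.CondFalse behaves_ticks_append)
  with 1 show ?thesis unfolding wp_def by blast
qed

text \<open>Programs without loops and output are run by the function \<open>sem\<close>, so the
  simplifier evaluates them symbolically.\<close>

fun straight :: "com \<Rightarrow> bool" where
  "straight SKIP = True"
| "straight (Assign x a) = True"
| "straight (Store x i a) = True"
| "straight (Seq c d) = (straight c \<and> straight d)"
| "straight (Cond b c d) = (straight c \<and> straight d)"
| "straight _ = False"

text \<open>A conditional is charged for both branches: cruder than the maximum, but linear. The
  value 0 for loops and output is a dummy that \<open>straight\<close> excludes.\<close>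

fun scost :: "com \<Rightarrow> nat" where
  "scost SKIP = 1"
| "scost (Assign x a) = acost a + 1"
| "scost (Store x i a) = acost i + acost a + 1"
| "scost (Seq c d) = scost c + scost d"
| "scost (Cond b c d) = bcost b + (scost c + scost d)"
| "scost _ = 0"

fun sem :: "com \<Rightarrow> state \<Rightarrow> state" where
  "sem (Assign x a) s = s\<lparr>var := (var s)(x := aval a s)\<rparr>"
| "sem (Store x i a) s = s\<lparr>arr := (arr s)(x := (arr s x)(aval i s := aval a s))\<rparr>"
| "sem (Seq c d) s = sem d (sem c s)"
| "sem (Cond b c d) s = (if bval b s then sem c s else sem d s)"
| "sem _ s = s"

lemma exec_sem: "straight c \<Longrightarrow> \<exists>n \<le> scost c. exec c s (ticks n) (sem c s)"
proof (induction c arbitrary: s)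
  case SKIP
  then show ?case using exec.Skip[of s] by (intro exI[of _ 1]) simp
next
  case (Assign x a)
  then show ?case using exec.Assign by auto
next
  case (Store x i a)
  then show ?case using exec.Store by auto
next
  case (Seq c d)
  then obtain p q where pq: "p \<le> scost c" "exec c s (ticks p) (sem c s)"
      "q \<le> scost d" "exec d (sem c s) (ticks q) (sem d (sem c s))"
    by (meson straight.simps(4))
  then have "exec (Seq c d) s (ticks (p + q)) (sem d (sem c s))"
    using exec.Seq by (fastforce simp: replicate_add)
  with pq show ?case by (intro exI[of _ "p + q"]) auto
next
  case (Cond b c d)
  then obtain p q where pq: "p \<le> scost c" "exec c s (ticks p) (sem c s)"
      "q \<le> scost d" "exec d s (ticks q) (sem d s)"
    by (meson straight.simps(5))
  have "exec (Cond b c d) s (ticks (bcost b + (if bval b s then p else q)))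
      (sem (Cond b c d) s)"
    using pq exec.CondTrue[of b s c _ _ d] exec.CondFalse[of b s d _ _ c]
    by (simp add: replicate_add)
  with pq show ?case by (intro exI[of _ "bcost b + (if bval b s then p else q)"]) auto
qed auto

lemma wp_straight:
  assumes "straight c" "scost c \<le> T" "Q os (sem c s)"
  shows "wp c T Q os s"
proof -
  obtain n where "n \<le> scost c" "exec c s (ticks n) (sem c s)"
    using exec_sem[OF assms(1)] by blast
  then show ?thesis
    unfolding wp_def using assms by (intro exI[of _ "ticks n"] exI[of _ "sem c s"] exI[of _ "[]"]) auto
qed

text \<open>\<open>\<Phi>\<close> is a potential that pays for all remaining iterations.\<close>

lemma wp_While:
  assumes "I os s"
    and body: "\<And>os' s'. I os' s' \<Longrightarrow> frame c s s' \<Longrightarrow> bval b s' \<Longrightarrow>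
      wp c (T s') (\<lambda>os'' s''. I os'' s'' \<and> \<Phi> s'' + T s' + bcost b \<le> \<Phi> s') os' s'"
    and post: "\<And>os' s'. I os' s' \<Longrightarrow> frame c s s' \<Longrightarrow> \<not> bval b s' \<Longrightarrow> Q os' s'"
    and "\<Phi> s + bcost b \<le> T'"
  shows "wp (While b c) T' Q os s"
proof -
  \<comment> \<open>A test takes time, so the potential strictly decreases and also proves
    termination.\<close>
  have pos: "0 < bcost b" by (cases b) auto
  have "frame c s s' \<Longrightarrow> I os' s' \<Longrightarrow> wp (While b c) (\<Phi> s' + bcost b) Q os' s'" for os' s'
  proof (induction "\<Phi> s'" arbitrary: os' s' rule: less_induct)
    case less
    show ?case
    proof (cases "bval b s'")
      case True
      then obtain t s2 os2 where 1: "exec c s' t s2" "length t \<le> T s'" "behaves t os2"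
          "I (os' @ os2) s2" "\<Phi> s2 + T s' + bcost b \<le> \<Phi> s'"
        using body[OF less.prems(2,1)] unfolding wp_def by blast
      then have "wp (While b c) (\<Phi> s2 + bcost b) Q (os' @ os2) s2"
        using less.hyps[of s2 "os' @ os2"] pos frame_trans[OF less.prems(1) exec_frame[OF 1(1)]]
        by linarith
      then obtain u s3 os3 where 2: "exec (While b c) s2 u s3" "length u \<le> \<Phi> s2 + bcost b"
          "behaves u os3" "Q ((os' @ os2) @ os3) s3"
        unfolding wp_def by blast
      from 1 2 True have "exec (While b c) s' (ticks (bcost b) @ t @ u) s3"
          "behaves (ticks (bcost b) @ t @ u) (os2 @ os3)" "Q (os' @ os2 @ os3) s3"
          "length (ticks (bcost b) @ t @ u) \<le> \<Phi> s' + bcost b"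
        by (auto intro: exec.WhileTrue behaves_ticks_append behaves_append)
      then show ?thesis unfolding wp_def by blast
    next
      case False
      with post less.prems have "Q os' s'" by blast
      then show ?thesis
        unfolding wp_def using exec.WhileFalse[OF False]
        by (intro exI[of _ "ticks (bcost b)"] exI[of _ s'] exI[of _ "[]"]) auto
    qed
  qed
  from this[of s os] show ?thesis
    using assms(1,4) by (auto intro: wp_mono)
qed

abbreviation incr :: "vname \<Rightarrow> com" where
  "incr x \<equiv> Assign x (Plus (V x) (N 1))"

definition For :: "vname \<Rightarrow> vname \<Rightarrow> com \<Rightarrow> com" where
  "For x y c = Seq (Assign x (N 0)) (While (Less (V x) (V y)) (Seq c (incr x)))"

lemma wvars_For [simp]: "wvars (For x y c) = insert x (wvars c)"
  and warrs_For [simp]: "warrs (For x y c) = warrs c"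
  by (auto simp: For_def)

text \<open>Each round costs 7 beyond the body, namely 3 for the test and 4 for the increment;
  initialisation and the last test cost 5. The body establishes the invariant for the state with the
  counter already advanced, so its proof never meets the increment.\<close>

lemma wp_For:
  assumes init: "I 0 os (s\<lparr>var := (var s)(x := 0)\<rparr>)"
    and body: "\<And>j os' s'. I j os' s' \<Longrightarrow> frame (For x y c) s s' \<Longrightarrow> j < var s y \<Longrightarrow> var s' x = j \<Longrightarrow>
      wp c T (\<lambda>os'' s''. frame c s' s'' \<longrightarrow> I (Suc j) os'' (s''\<lparr>var := (var s'')(x := Suc j)\<rparr>)) os' s'"
    and post: "\<And>os' s'. I (var s y) os' s' \<Longrightarrow> frame (For x y c) s s' \<Longrightarrow> Q os' s'"
    and "x \<notin> wvars c" "y \<notin> wvars c" "x \<noteq> y"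
    and "var s y * (T + 7) + 5 \<le> T'"
  shows "wp (For x y c) T' Q os s"
  unfolding For_def
proof (rule wp_Seq[where T = 2 and T' = "var s y * (T + 7) + 3"])
  let ?s = "sem (Assign x (N 0)) s"
  let ?b = "Less (V x) (V y)"
  have fr: "frame (For x y c) s s'" if "frame (Seq c (incr x)) ?s s'" for s'
    using that by (auto simp: frame_def)
  have y: "var s' y = var s y" if "frame (Seq c (incr x)) ?s s'" for s'
    using that assms(5,6) by (auto simp: frame_def)
  have "wp (While ?b (Seq c (incr x))) (var s y * (T + 7) + 3) Q os ?s"
  proof (rule wp_While[where I = "\<lambda>os s'. var s' x \<le> var s y \<and> I (var s' x) os s'"
        and T = "\<lambda>_. T + 4" and \<Phi> = "\<lambda>s'. (var s y - var s' x) * (T + 7)"])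
    fix os' s' assume s': "var s' x \<le> var s y \<and> I (var s' x) os' s'"
      "frame (Seq c (incr x)) ?s s'" "bval ?b s'"
    have lt: "var s' x < var s y" using s' y[of s'] by simp
    have arith: "(var s y - Suc (var s' x)) * (T + 7) + (T + 4) + bcost ?b
        \<le> (var s y - var s' x) * (T + 7)"
    proof -
      have "var s y - var s' x = Suc (var s y - Suc (var s' x))" using lt by simp
      then show ?thesis by simp
    qed
    show "wp (Seq c (incr x)) (T + 4) (\<lambda>os'' s''. (var s'' x \<le> var s y \<and> I (var s'' x) os'' s'') \<and>
        (var s y - var s'' x) * (T + 7) + (T + 4) + bcost ?b \<le> (var s y - var s' x) * (T + 7)) os' s'"
    proof (rule wp_Seq, rule wp_mono[OF body])
      show "I (var s' x) os' s'" "var s' x < var s y" "frame (For x y c) s s'"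
        using s' lt fr by auto
    next
      fix os'' s''
      assume q: "frame c s' s'' \<longrightarrow> I (Suc (var s' x)) os'' (s''\<lparr>var := (var s'')(x := Suc (var s' x))\<rparr>)"
        "frame c s' s''"
      then have v: "var s'' x = var s' x" using assms(4) by (auto simp: frame_def)
      show "frame c s' s'' \<longrightarrow> wp (incr x) 4 (\<lambda>os'' s''. (var s'' x \<le> var s y \<and> I (var s'' x) os'' s'') \<and>
        (var s y - var s'' x) * (T + 7) + (T + 4) + bcost ?b \<le> (var s y - var s' x) * (T + 7)) os'' s''"
        using arith lt q v by (auto intro!: wp_straight)
    qed auto
  next
    fix os' s' assume "var s' x \<le> var s y \<and> I (var s' x) os' s'"
      "frame (Seq c (incr x)) ?s s'" "\<not> bval ?b s'"
    then have "I (var s y) os' s'" "frame (For x y c) s s'"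
      using y[of s'] fr[of s'] by auto
    then show "Q os' s'" by (rule post)
  qed (use init assms(6) in auto)
  then show "wp (Assign x (N 0)) 2 (\<lambda>os' s'. frame (Assign x (N 0)) s s' \<longrightarrow>
      wp (While ?b (Seq c (incr x))) (var s y * (T + 7) + 3) Q os' s') os s"
    by (intro wp_straight) auto
qed (use assms(7) in simp)

section \<open>Degenerate edge sets\<close>

text \<open>A vertex of \<open>W\<close> that is not a vertex of \<open>F\<close> has degree 0 in
  \<open>D\<close>, so \<open>W\<close> may be arbitrary.\<close>

lemma degenerate_iff:
  "degenerate k F \<longleftrightarrow> (\<forall>W D. W \<noteq> {} \<and> D \<subseteq> F \<and> \<Union>D \<subseteq> W \<longrightarrow> (\<exists>v \<in> W. vertex_degree D v \<le> k))"
proof -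
  have "\<exists>v \<in> W. vertex_degree D v \<le> k"
    if F: "degenerate k F" and W: "W \<noteq> {}" "D \<subseteq> F" "\<Union>D \<subseteq> W" for W D
  proof (cases "W \<subseteq> \<Union>F")
    case True
    with F W show ?thesis unfolding degenerate_def by blast
  next
    case False
    then obtain v where v: "v \<in> W" "v \<notin> \<Union>F" by blast
    with W have "{e \<in> D. v \<in> e} = {}" by blast
    then have "vertex_degree D v = 0" unfolding vertex_degree_def by (metis card.empty)
    with v(1) show ?thesis by (intro bexI[of _ v]) simp_all
  qed
  then show ?thesis
    by (intro iffI allI impI) (metis, simp add: degenerate_def)
qed

lemma degenerateD:
  "degenerate k F \<Longrightarrow> W \<noteq> {} \<Longrightarrow> D \<subseteq> F \<Longrightarrow> \<Union>D \<subseteq> W \<Longrightarrow> \<exists>v \<in> W. vertex_degree D v \<le> k"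
  by (simp add: degenerate_iff)

lemma degenerate_mono: "degenerate k F \<Longrightarrow> F' \<subseteq> F \<Longrightarrow> degenerate k F'"
  unfolding degenerate_iff by (meson subset_trans)

lemma degenerate_empty [simp]: "degenerate k {}"
  by (simp add: degenerate_def)

lemma vertex_degree_mono: "finite D' \<Longrightarrow> D \<subseteq> D' \<Longrightarrow> vertex_degree D v \<le> vertex_degree D' v"
  unfolding vertex_degree_def by (rule card_mono) auto

text \<open>A subgraph containing \<open>v\<close> has \<open>v\<close> itself as witness; any other
  one avoids \<open>v\<close> and thus lies in \<open>S\<close>. This makes it safe to exchange the
  edges at a single vertex.\<close>

lemma degenerate_change_vertex:
  assumes "degenerate k S" "finite F" "{e \<in> F. v \<notin> e} \<subseteq> S" "vertex_degree F v \<le> k"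
  shows "degenerate k F"
  unfolding degenerate_iff
proof (intro allI impI, elim conjE)
  fix W D assume W: "W \<noteq> {}" "D \<subseteq> F" "\<Union>D \<subseteq> W"
  show "\<exists>v \<in> W. vertex_degree D v \<le> k"
  proof (cases "v \<in> W")
    case True
    moreover have "vertex_degree D v \<le> k"
      using vertex_degree_mono[OF assms(2) W(2), of v] assms(4) by simp
    ultimately show ?thesis by blast
  next
    case False
    with W assms(3) have "D \<subseteq> S" by blast
    then show ?thesis using degenerateD[OF assms(1) W(1) _ W(3)] by blast
  qed
qed

lemma degenerate_0_iff:
  assumes "{} \<notin> F" "finite F"
  shows "degenerate 0 F \<longleftrightarrow> F = {}"
proof
  assume F: "degenerate 0 F"
  show "F = {}"
  proof (rule ccontr)
    assume "F \<noteq> {}"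
    with assms have "\<Union>F \<noteq> {}" by auto
    then obtain v where v: "v \<in> \<Union>F" "vertex_degree F v \<le> 0"
      using degenerateD[OF F, of "\<Union>F" F] by blast
    then have "{e \<in> F. v \<in> e} = {}"
      using assms(2) by (simp add: vertex_degree_def)
    with v show False by blast
  qed
qed simp

section \<open>Elimination orders and proximity\<close>

definition elimination_order :: "nat \<Rightarrow> 'v edges \<Rightarrow> 'v set list \<Rightarrow> bool" where
  "elimination_order k F es \<longleftrightarrow> distinct es \<and> set es = F \<and>
    (\<forall>i < length es. \<exists>v \<in> es ! i. vertex_degree (set (take (Suc i) es)) v \<le> k)"

lemma elimination_order_exists:
  assumes "finite F" "degenerate k F" "{} \<notin> F"
  shows "\<exists>es. elimination_order k F es"
  using assms
proof (induction F rule: finite_psubset_induct)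
  case (psubset F)
  show ?case
  proof (cases "F = {}")
    case True
    then show ?thesis by (auto simp: elimination_order_def)
  next
    case False
    with psubset.prems have "\<Union>F \<noteq> {}" by auto
    then obtain v where "v \<in> \<Union>F" and deg: "vertex_degree F v \<le> k"
      using degenerateD[OF psubset.prems(1), of "\<Union>F" F] by blast
    then obtain e where e: "e \<in> F" "v \<in> e" by blast
    have "\<exists>es. elimination_order k (F - {e}) es"
      using psubset.prems e degenerate_mono[of k F "F - {e}"] by (intro psubset.IH) auto
    then obtain es where es: "elimination_order k (F - {e}) es" ..
    with e have F: "insert e (set es) = F" by (auto simp: elimination_order_def)
    have "elimination_order k F (es @ [e])"
      unfolding elimination_order_def
    proof (intro conjI allI impI)
      fix i assume "i < length (es @ [e])"
      then consider "i < length es" | "i = length es" by fastforce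
      then show "\<exists>v \<in> (es @ [e]) ! i. vertex_degree (set (take (Suc i) (es @ [e]))) v \<le> k"
      proof cases
        case 1
        with es show ?thesis by (auto simp: elimination_order_def nth_append)
      next
        case 2
        with e deg F show ?thesis by auto
      qed
    qed (use es e in \<open>auto simp: elimination_order_def\<close>)
    then show ?thesis ..
  qed
qed

text \<open>The order is chosen from \<open>k\<close> and \<open>T\<close> alone, so that the
  proximities of different \<open>S\<close> to the same \<open>T\<close> are measured along one
  order. The choice is never computed.\<close>

definition proximity :: "nat \<Rightarrow> 'v edges \<Rightarrow> 'v edges \<Rightarrow> 'v edges" where
  "proximity k S T = set (takeWhile (\<lambda>e. e \<in> S) (SOME es. elimination_order k T es))"

text \<open>Here \<open>P\<close> is the common prefix and \<open>e\<close> the edge that ends it,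
  so any \<open>S'\<close> containing both has a longer prefix. The order itself does not appear in
  what is obtained.\<close>

lemma proximity_step:
  assumes T: "finite T" "degenerate k T" "{} \<notin> T" and "\<not> T \<subseteq> S"
  obtains P e v where "P \<subseteq> S" "insert e P \<subseteq> T" "e \<notin> P" "v \<in> e" "vertex_degree (insert e P) v \<le> k"
    "\<And>S'. insert e P \<subseteq> S' \<Longrightarrow> card (proximity k S T) < card (proximity k S' T)"
proof -
  define es where "es = (SOME es. elimination_order k T es)"
  have es: "elimination_order k T es"
    unfolding es_def using elimination_order_exists[OF T] by (rule someI_ex)
  define i where "i = length (takeWhile (\<lambda>e. e \<in> S) es)"
  have i: "i < length es"
  proof (rule ccontr)
    assume "\<not> i < length es"
    then have "takeWhile (\<lambda>e. e \<in> S) es = es"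
      unfolding i_def by (metis takeWhile_eq_take not_less take_all)
    then have "set es \<subseteq> S" by (auto simp: takeWhile_eq_all_conv)
    with es \<open>\<not> T \<subseteq> S\<close> show False by (simp add: elimination_order_def)
  qed
  define e P where "e = es ! i" and "P = set (take i es)"
  have take_i: "takeWhile (\<lambda>e. e \<in> S) es = take i es"
    unfolding i_def by (rule takeWhile_eq_take)
  have PS: "P \<subseteq> S"
    unfolding P_def take_i[symmetric] by (auto dest: set_takeWhileD)
  have ins: "set (take (Suc i) es) = insert e P"
    using i by (simp add: take_Suc_conv_app_nth e_def P_def)
  have eP: "e \<notin> P"
    using es i by (auto simp: elimination_order_def e_def P_def in_set_conv_nth nth_eq_iff_index_eq)
  have "\<exists>v \<in> e. vertex_degree (set (take (Suc i) es)) v \<le> k"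
    using es i by (simp add: elimination_order_def e_def)
  then obtain v where v: "v \<in> e" "vertex_degree (insert e P) v \<le> k"
    unfolding ins by blast
  have "insert e P \<subseteq> T"
    using es set_take_subset[of "Suc i" es] unfolding ins by (simp add: elimination_order_def)
  moreover have "card (proximity k S T) < card (proximity k S' T)" if S': "insert e P \<subseteq> S'" for S'
  proof -
    have "takeWhile (\<lambda>e. e \<in> S') es
        = take (Suc i) es @ takeWhile (\<lambda>e. e \<in> S') (drop (Suc i) es)"
      using S' ins takeWhile_append2[of "take (Suc i) es" "\<lambda>e. e \<in> S'" "drop (Suc i) es"] by auto
    then have "insert e P \<subseteq> proximity k S' T"
      unfolding proximity_def es_def[symmetric] using ins by auto
    moreover have "proximity k S T = P"
      unfolding proximity_def es_def[symmetric] take_i P_def ..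
    ultimately show ?thesis
      using eP by (intro psubset_card_mono) (auto simp: proximity_def[of k S'])
  qed
  ultimately show ?thesis
    using that[OF PS _ eP v] by blast
qed

lemma proximity_subset:
  assumes "finite T" "degenerate k T" "{} \<notin> T"
  shows "proximity k S T \<subseteq> T"
  using someI_ex[OF elimination_order_exists[OF assms]] set_takeWhileD
  unfolding proximity_def elimination_order_def by fastforce

text \<open>Tuples with repetition are easier to run through than subsets. A set of fewer than
  \<open>d\<close> elements is padded with the value 0, hence \<open>0 < n\<close>.\<close>

lemma finite_subset_tuple:
  assumes "finite Q" "card Q \<le> d" "Q \<subseteq> {..<n}" "0 < n"
  shows "\<exists>u. (\<forall>i<d. u i < n) \<and> Q \<subseteq> u ` {..<d}"
proof -
  obtain xs where xs: "set xs = Q" "distinct xs"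
    using finite_distinct_list[OF assms(1)] by blast
  then have len: "length xs \<le> d" using assms(2) distinct_card by metis
  let ?u = "\<lambda>i. if i < length xs then xs ! i else 0"
  have "\<forall>i<d. ?u i < n" using xs assms(3,4) by (auto simp: subset_iff)
  moreover have "Q \<subseteq> ?u ` {..<d}"
  proof
    fix x assume "x \<in> Q"
    then obtain i where "i < length xs" "xs ! i = x" using xs by (auto simp: in_set_conv_nth)
    then show "x \<in> ?u ` {..<d}" using len by (intro image_eqI[of _ _ i]) auto
  qed
  ultimately show ?thesis by (intro exI[of _ ?u] conjI)
qed

section \<open>Neighbours of a solution\<close>

locale simple_graph_instance =
  fixes G :: graph and k :: nat
  assumes simple: "simple_graph G"
begin

abbreviation "m \<equiv> length G"
abbreviation "n \<equiv> card (vertices G)"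
abbreviation "ed j \<equiv> edge_list G ! j"
abbreviation "deg_ok A \<equiv> degenerate k (ed ` A)"

text \<open>Truncated subtraction is harmless here, as \<open>v\<close> is one of the two summands.\<close>

abbreviation "other v j \<equiv> fst (G ! j) + snd (G ! j) - v"

lemma length_edge_list [simp]: "length (edge_list G) = m"
  by (simp add: edge_list_def)

lemma ed_eq: "j < m \<Longrightarrow> ed j = {fst (G ! j), snd (G ! j)}"
  by (simp add: edge_list_def case_prod_beta)

lemma endpoints_neq: "j < m \<Longrightarrow> fst (G ! j) \<noteq> snd (G ! j)"
  using simple nth_mem[of j G] unfolding simple_graph_def by fastforce

lemma edges_eq: "edges G = ed ` {..<m}"
  by (auto simp: edges_def in_set_conv_nth)

lemma inj_ed: "inj_on ed {..<m}"
  using simple unfolding simple_graph_def by (auto simp: inj_on_def nth_eq_iff_index_eq)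

lemma ed_inject: "i < m \<Longrightarrow> j < m \<Longrightarrow> ed i = ed j \<longleftrightarrow> i = j"
  using inj_ed by (auto simp: inj_on_def)

lemma card_edges: "card (edges G) = m"
  unfolding edges_eq by (simp add: card_image inj_ed)

lemma vertices_eq: "vertices G = {..<n}"
  using simple unfolding simple_graph_def by blast

lemma ed_less:
  assumes "j < m" "v \<in> ed j"
  shows "v < n"
proof -
  have "v \<in> vertices G" using assms by (auto simp: vertices_def edges_eq)
  then show ?thesis using vertices_eq by blast
qed

lemma ed_other: "j < m \<Longrightarrow> v \<in> ed j \<Longrightarrow> ed j = {v, other v j} \<and> other v j \<noteq> v"
  using endpoints_neq[of j] by (auto simp: ed_eq)

lemma other_less: "j < m \<Longrightarrow> v \<in> ed j \<Longrightarrow> other v j < n"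
  using ed_other[of j v] ed_less by blast

text \<open>No vertex is isolated. Bounds in \<open>n\<close> thereby become polynomials in
  \<open>m\<close>, the size of the universe.\<close>

lemma n_le: "n \<le> 2 * m"
proof -
  have "n \<le> (\<Sum>j\<in>{..<m}. card (ed j))"
    unfolding vertices_def edges_eq by (rule card_UN_le) simp
  also have "\<dots> \<le> (\<Sum>j\<in>{..<m}. 2)"
    by (rule sum_mono) (auto simp: ed_eq card_insert_if)
  finally show ?thesis by simp
qed

text \<open>Edges are sets of vertices. This crude bound suffices for graphs with fewer than
  \<open>k - 1\<close> vertices, whose size only has to be bounded in terms of
  \<open>k\<close>.\<close>

lemma m_le: "m \<le> 2 ^ n"
proof -
  have "edges G \<subseteq> Pow {..<n}" using ed_less by (auto simp: edges_eq)
  then have "card (edges G) \<le> card (Pow {..<n})" by (intro card_mono) auto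
  then show ?thesis by (simp add: card_edges card_Pow)
qed

text \<open>Double counting of incidences. It pays for scanning the adjacency lists of all vertices,
  which makes one peeling run linear.\<close>

lemma sum_degrees: "(\<Sum>v<n. card {j. j < m \<and> v \<in> ed j}) \<le> 2 * m"
proof -
  have "(\<Sum>v<n. card {j. j < m \<and> v \<in> ed j}) = (\<Sum>v<n. \<Sum>j<m. if v \<in> ed j then 1 else 0)"
    by (intro sum.cong) (auto simp: sum.If_cases Int_def)
  also have "\<dots> = (\<Sum>j<m. \<Sum>v<n. if v \<in> ed j then 1 else 0)"
    by (rule sum.swap)
  also have "\<dots> \<le> (\<Sum>j<m. 2)"
  proof (rule sum_mono)
    fix j assume "j \<in> {..<m}"
    then have "card (ed j) \<le> 2" "finite (ed j)" by (auto simp: ed_eq card_insert_if)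
    then have "card ({..<n} \<inter> ed j) \<le> 2"
      using card_mono[of "ed j" "{..<n} \<inter> ed j"] by simp
    then show "(\<Sum>v<n. if v \<in> ed j then 1 else 0) \<le> (2::nat)"
      by (simp add: sum.If_cases Int_def)
  qed
  finally show ?thesis by simp
qed

lemma ed_nonempty: "A \<subseteq> {..<m} \<Longrightarrow> {} \<notin> ed ` A"
  using ed_eq by fastforce

lemma vertex_degree_image:
  "A \<subseteq> {..<m} \<Longrightarrow> vertex_degree (ed ` A) v = card {j \<in> A. v \<in> ed j}"
proof -
  assume A: "A \<subseteq> {..<m}"
  have "{e \<in> ed ` A. v \<in> e} = ed ` {j \<in> A. v \<in> ed j}" by blast
  then show ?thesis
    unfolding vertex_degree_def using inj_ed A
    by (metis (no_types, lifting) card_image inj_on_subset mem_Collect_eq subset_iff)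
qed

text \<open>Solutions are handled as sets of positions in the edge list, the form in which programs
  see them; \<open>ed\<close> is injective there.\<close>

definition sol :: "nat set \<Rightarrow> bool" where
  "sol A \<longleftrightarrow> A \<subseteq> {..<m} \<and> maximal_degenerate k (edges G) (ed ` A)"

lemma sol_subset: "sol A \<Longrightarrow> A \<subseteq> {..<m}"
  by (simp add: sol_def)

lemma sol_deg_ok: "sol A \<Longrightarrow> deg_ok A"
  by (simp add: sol_def maximal_degenerate_def)

lemma maximal_degenerate_iff: "maximal_degenerate k (edges G) F \<longleftrightarrow> (\<exists>A. sol A \<and> F = ed ` A)"
proof
  assume F: "maximal_degenerate k (edges G) F"
  then have "F \<subseteq> ed ` {..<m}" by (simp add: maximal_degenerate_def edges_eq)
  then obtain A where "A \<subseteq> {..<m}" "F = ed ` A" by (rule subset_imageE)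
  with F show "\<exists>A. sol A \<and> F = ed ` A" by (auto simp: sol_def)
qed (auto simp: sol_def)

section \<open>Greedy completion\<close>

fun greedy :: "nat set \<Rightarrow> nat \<Rightarrow> nat set" where
  "greedy A 0 = A"
| "greedy A (Suc f) = (let B = greedy A f in if deg_ok (insert f B) then insert f B else B)"

lemma greedy_subset: "A \<subseteq> {..<m} \<Longrightarrow> f \<le> m \<Longrightarrow> greedy A f \<subseteq> {..<m}"
  by (induction f) (auto simp: Let_def)

lemma greedy_deg_ok: "deg_ok A \<Longrightarrow> deg_ok (greedy A f)"
  by (induction f) (auto simp: Let_def)

lemma greedy_mono: "f \<le> g \<Longrightarrow> greedy A f \<subseteq> greedy A g"
  by (induction g) (auto simp: Let_def le_Suc_eq)

lemma subset_greedy: "A \<subseteq> greedy A f"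
  using greedy_mono[of 0 f A] by simp

text \<open>One pass suffices: subsets of degenerate sets are degenerate, so an edge that was
  rejected for a smaller set cannot be added later.\<close>

lemma sol_greedy:
  assumes "A \<subseteq> {..<m}" "deg_ok A"
  shows "sol (greedy A m)"
proof -
  have sub: "greedy A m \<subseteq> {..<m}" using assms by (simp add: greedy_subset)
  have "\<not> degenerate k F'" if F': "ed ` greedy A m \<subset> F'" "F' \<subseteq> edges G" for F'
  proof
    assume deg: "degenerate k F'"
    obtain x where x: "x \<in> F'" "x \<notin> ed ` greedy A m" using F'(1) by blast
    then have "x \<in> ed ` {..<m}" using F'(2) by (auto simp: edges_eq)
    with x obtain f where f: "f < m" "ed f \<in> F'" "f \<notin> greedy A m" by blast
    have "ed ` insert f (greedy A f) \<subseteq> F'"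
      using F' f greedy_mono[of f m A] by auto
    then have "deg_ok (insert f (greedy A f))" using deg degenerate_mono by blast
    then have "f \<in> greedy A (Suc f)" by (simp add: Let_def)
    then show False using f greedy_mono[of "Suc f" m A] by auto
  qed
  then show ?thesis
    unfolding sol_def maximal_degenerate_def
    using sub greedy_deg_ok[OF assms(2)] image_mono[OF sub] by (simp add: edges_eq)
qed

text \<open>All edges at \<open>v\<close> are removed, except \<open>e\<close> and those whose other end is among
  \<open>u 0, \<dots>, u (k - 2)\<close>.\<close>

definition candidate :: "nat set \<Rightarrow> nat \<Rightarrow> nat \<Rightarrow> (nat \<Rightarrow> nat) \<Rightarrow> nat set" where
  "candidate S e v u = insert e {f \<in> S. v \<notin> ed f \<or> other v f \<in> u ` {..<k - 1}}"

definition neighbours :: "nat set \<Rightarrow> nat set set" where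
  "neighbours S = {greedy (candidate S e v u) m | e v u. e < m \<and> v \<in> ed e \<and> (\<forall>i < k - 1. u i < n)}"

lemma candidate_subset: "S \<subseteq> {..<m} \<Longrightarrow> e < m \<Longrightarrow> candidate S e v u \<subseteq> {..<m}"
  by (auto simp: candidate_def)

text \<open>There are no parallel edges. Hence keeping the edges towards \<open>k - 1\<close>
  guessed vertices keeps at most \<open>k - 1\<close> edges at \<open>v\<close>.\<close>

lemma inj_other: "inj_on (other v) {f. f < m \<and> v \<in> ed f}"
proof (rule inj_onI)
  fix i j assume ij: "i \<in> {f. f < m \<and> v \<in> ed f}" "j \<in> {f. f < m \<and> v \<in> ed f}" "other v i = other v j"
  then have "ed i = {v, other v i}" "ed j = {v, other v j}"
    using ed_other by blast+
  then have "ed i = ed j" using ij by simp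
  then show "i = j" using ij by (simp add: ed_inject)
qed

text \<open>At \<open>v\<close> there are only \<open>e\<close> and at most \<open>k - 1\<close>
  kept edges; away from \<open>v\<close> nothing is added to \<open>S\<close>. With
  \<open>k = 0\<close> the edge \<open>e\<close> alone would be too much.\<close>

lemma candidate_deg_ok:
  assumes "S \<subseteq> {..<m}" "deg_ok S" "e < m" "v \<in> ed e" "0 < k"
  shows "deg_ok (candidate S e v u)"
proof (rule degenerate_change_vertex[where S = "ed ` S" and v = v])
  let ?C = "candidate S e v u"
  let ?K = "{f \<in> S. v \<in> ed f \<and> other v f \<in> u ` {..<k - 1}}"
  have fin: "finite ?K" "finite ?C"
    using assms(1) finite_subset[OF assms(1)] by (auto simp: candidate_def)
  have "card ?K = card (other v ` ?K)"
    using assms(1) by (intro card_image[symmetric] inj_on_subset[OF inj_other]) auto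
  also have "\<dots> \<le> card (u ` {..<k - 1})" by (intro card_mono) auto
  also have "\<dots> \<le> k - 1" using card_image_le[of "{..<k - 1}" u] by simp
  finally have K: "card ?K \<le> k - 1" .
  have "vertex_degree (ed ` ?C) v = card {j \<in> ?C. v \<in> ed j}"
    using assms by (intro vertex_degree_image candidate_subset)
  also have "\<dots> \<le> card (insert e ?K)"
    using fin by (intro card_mono) (auto simp: candidate_def)
  also have "\<dots> \<le> Suc (k - 1)"
    using K fin by (simp add: card_insert_if)
  finally show "vertex_degree (ed ` ?C) v \<le> k" using \<open>0 < k\<close> by simp
  show "{e \<in> ed ` ?C. v \<notin> e} \<subseteq> ed ` S"
    using assms(4) by (auto simp: candidate_def)
  show "finite (ed ` ?C)" using fin by simp
qed (use assms in auto)

lemma sol_neighbours: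
  assumes "sol S" "0 < k" "S' \<in> neighbours S"
  shows "sol S'"
proof -
  obtain e v u where S': "S' = greedy (candidate S e v u) m" "e < m" "v \<in> ed e"
    using assms(3) by (auto simp: neighbours_def)
  show ?thesis
    unfolding S'(1) using assms S'
    by (intro sol_greedy candidate_subset candidate_deg_ok sol_subset sol_deg_ok)
qed

lemma neighbour_closer:
  assumes "sol S" "sol T" "S \<noteq> T" "0 < k"
  shows "\<exists>S' \<in> neighbours S. card (proximity k (ed ` S) (ed ` T)) < card (proximity k (ed ` S') (ed ` T))"
proof -
  \<comment> \<open>Different maximal sets are incomparable, so \<open>T\<close> has an edge outside
    \<open>S\<close>.\<close>
  have TS: "\<not> ed ` T \<subseteq> ed ` S"
  proof
    assume "ed ` T \<subseteq> ed ` S"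
    moreover have "ed ` T \<noteq> ed ` S"
      using assms inj_ed sol_subset by (metis inj_on_image_eq_iff)
    ultimately have "\<not> deg_ok S"
      using assms(1,2) unfolding sol_def maximal_degenerate_def by blast
    then show False using assms(1) sol_deg_ok by blast
  qed
  have T: "finite (ed ` T)" "deg_ok T" "{} \<notin> ed ` T"
    using assms(2) finite_subset[of T "{..<m}"] sol_subset sol_deg_ok ed_nonempty by auto
  obtain P e v where P: "P \<subseteq> ed ` S" "insert e P \<subseteq> ed ` T" "e \<notin> P" "v \<in> e"
      "vertex_degree (insert e P) v \<le> k"
      "\<And>S'. insert e P \<subseteq> S' \<Longrightarrow> card (proximity k (ed ` S) (ed ` T)) < card (proximity k S' (ed ` T))"
    by (rule proximity_step[OF T TS]) (rule that)
  obtain j where j: "j < m" "e = ed j"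
  proof -
    have "e \<in> ed ` T" using P(2) by simp
    then show ?thesis using that sol_subset[OF assms(2)] by auto
  qed
  obtain A where A: "A \<subseteq> S" "P = ed ` A" using P(1) by (metis subset_imageE)
  have Am: "A \<subseteq> {..<m}" using A sol_subset[OF assms(1)] by blast
  have "j \<notin> A" using P(3) A j by blast
  \<comment> \<open>The right guess: the other ends of the prefix edges at \<open>v\<close>.\<close>
  define Q where "Q = other v ` {f \<in> A. v \<in> ed f}"
  have finA: "finite {f \<in> A. v \<in> ed f}" using finite_subset[OF Am] by simp
  have "vertex_degree (ed ` insert j A) v = card {f \<in> insert j A. v \<in> ed f}"
    using Am j by (intro vertex_degree_image) auto
  also have "{f \<in> insert j A. v \<in> ed f} = insert j {f \<in> A. v \<in> ed f}"
    using P(4) j by auto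
  also have "card \<dots> = Suc (card {f \<in> A. v \<in> ed f})"
    using finA \<open>j \<notin> A\<close> by simp
  \<comment> \<open>The edge \<open>e\<close> takes one of the \<open>k\<close> places at
    \<open>v\<close>, which leaves \<open>k - 1\<close> for the prefix.\<close>
  finally have "Suc (card {f \<in> A. v \<in> ed f}) \<le> k" using P(5) A j by simp
  then have "card Q \<le> k - 1"
    using card_image_le[OF finA, of "other v"] by (simp add: Q_def)
  moreover have "Q \<subseteq> {..<n}" using Am other_less by (auto simp: Q_def)
  moreover have "0 < n" using ed_less[OF j(1), of v] P(4) j by auto
  moreover have "finite Q" using finA by (simp add: Q_def)
  ultimately obtain u where u: "\<forall>i < k - 1. u i < n" "Q \<subseteq> u ` {..<k - 1}"
    using finite_subset_tuple[of Q "k - 1" n] by auto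
  let ?S' = "greedy (candidate S j v u) m"
  have "insert j A \<subseteq> candidate S j v u"
    using A u by (auto simp: candidate_def Q_def)
  then have "insert j A \<subseteq> ?S'" using subset_greedy by (rule subset_trans)
  then have "insert e P \<subseteq> ed ` ?S'" using A(2) j(2) by auto
  moreover have "?S' \<in> neighbours S"
    using j P(4) u unfolding neighbours_def by blast
  ultimately show ?thesis using P(6) by blast
qed

lemma finite_sols: "finite {A. sol A}"
  by (rule finite_subset[of _ "Pow {..<m}"]) (auto simp: sol_def)

text \<open>For a solution \<open>T\<close>, consider a member of \<open>X\<close> with the largest
  proximity to \<open>T\<close>. Were it not \<open>T\<close>, one of its neighbours, again in
  \<open>X\<close>, would be closer. This shows that the search misses nothing.\<close>

lemma closed_under_neighbours:
  assumes "0 < k" "X \<subseteq> {A. sol A}" "X \<noteq> {}" "\<And>S. S \<in> X \<Longrightarrow> neighbours S \<subseteq> X"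
  shows "X = {A. sol A}"
proof
  show "{A. sol A} \<subseteq> X"
  proof
    fix T assume "T \<in> {A. sol A}"
    then have T: "sol T" by simp
    let ?f = "\<lambda>S. card (proximity k (ed ` S) (ed ` T))"
    have "finite X" using assms(2) finite_sols finite_subset by blast
    then have "Max (?f ` X) \<in> ?f ` X" using assms(3) by (intro Max_in) auto
    then obtain S where "S \<in> X" "?f S = Max (?f ` X)" by auto
    with \<open>finite X\<close> have S: "S \<in> X" "\<And>S'. S' \<in> X \<Longrightarrow> ?f S' \<le> ?f S"
      by auto
    have "S = T"
    proof (rule ccontr)
      assume "S \<noteq> T"
      moreover have "sol S" using S(1) assms(2) by blast
      ultimately obtain S' where "S' \<in> neighbours S" "?f S < ?f S'"
        using neighbour_closer T assms(1) by blast
      then show False using S assms(4) by (meson not_less subsetD)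
    qed
    then show "T \<in> X" using S by simp
  qed
qed (use assms in blast)

section \<open>Testing degeneracy by peeling off vertices of low degree\<close>

definition alive :: "nat set \<Rightarrow> nat set \<Rightarrow> nat \<Rightarrow> nat set" where
  "alive A R v = {j \<in> A. v \<in> ed j \<and> ed j \<inter> R = {}}"

text \<open>Of the vertices in \<open>W\<close>, take the one peeled first: no other vertex of
  \<open>W\<close> was gone by then, so all its edges in \<open>D\<close> were still alive.\<close>

lemma peeled_deg_ok:
  fixes vs :: "nat \<Rightarrow> nat"
  assumes A: "A \<subseteq> {..<m}" and vs: "{..<n} \<subseteq> vs ` {..<q}"
    and deg: "\<And>i. i < q \<Longrightarrow> card (alive A (vs ` {..<i}) (vs i)) \<le> k"
  shows "deg_ok A"
  unfolding degenerate_def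
proof (intro allI impI, elim conjE)
  fix W D assume W: "W \<subseteq> \<Union> (ed ` A)" "W \<noteq> {}" "D \<subseteq> ed ` A" "\<Union>D \<subseteq> W"
  have "W \<subseteq> vs ` {..<q}" using W(1) A vs ed_less by fastforce
  then obtain i0 where "i0 < q \<and> vs i0 \<in> W"
    using W(2) by auto
  then obtain i where i: "i < q" "vs i \<in> W"
      and least: "\<And>i'. i' < i \<Longrightarrow> \<not> (i' < q \<and> vs i' \<in> W)"
    using exists_least_iff[of "\<lambda>i. i < q \<and> vs i \<in> W"] by blast
  obtain B where B: "B \<subseteq> A" "D = ed ` B" using W(3) by (rule subset_imageE)
  have "W \<inter> vs ` {..<i} = {}"
    using least i by fastforce
  then have sub: "{j \<in> B. vs i \<in> ed j} \<subseteq> alive A (vs ` {..<i}) (vs i)"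
    using B W(4) by (auto simp: alive_def)
  have "vertex_degree D (vs i) = card {j \<in> B. vs i \<in> ed j}"
    using B A vertex_degree_image[of B] by auto
  also have "\<dots> \<le> card (alive A (vs ` {..<i}) (vs i))"
    using finite_subset[OF A] sub by (intro card_mono) (auto simp: alive_def)
  finally show "\<exists>v \<in> W. vertex_degree D v \<le> k"
    using i deg[of i] by (meson le_trans)
qed

text \<open>The vertices outside \<open>R\<close> and the edges among them form a subgraph with all
  degrees above \<open>k\<close>.\<close>

lemma stuck_not_deg_ok:
  assumes A: "A \<subseteq> {..<m}" and "v0 < n" "v0 \<notin> R"
    and deg: "\<And>v. v < n \<Longrightarrow> v \<notin> R \<Longrightarrow> k < card (alive A R v)"
  shows "\<not> deg_ok A"
proof
  assume "deg_ok A"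
  let ?W = "{..<n} - R" and ?B = "{j \<in> A. ed j \<inter> R = {}}"
  have "?W \<noteq> {}" using assms by blast
  moreover have "ed ` ?B \<subseteq> ed ` A" by auto
  moreover have "\<Union> (ed ` ?B) \<subseteq> ?W" using A ed_less by fastforce
  ultimately obtain v where v: "v \<in> ?W" "vertex_degree (ed ` ?B) v \<le> k"
    using \<open>deg_ok A\<close> unfolding degenerate_iff by meson
  moreover have "?B \<subseteq> {..<m}" using A by auto
  then have "vertex_degree (ed ` ?B) v = card {j \<in> ?B. v \<in> ed j}"
    by (rule vertex_degree_image)
  moreover have "{j \<in> ?B. v \<in> ed j} = alive A R v"
    by (auto simp: alive_def)
  ultimately show False using deg[of v] by auto
qed

end

section \<open>Preprocessing\<close>

text \<open>
  The programs use the following arrays. The edges at \<open>v\<close> are listed in \<open>A\<close>, from position \<open>P v\<close> up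
  to but excluding \<open>Z v\<close>; \<open>W\<close> holds the powers of 2. \<open>B\<close> is the edge set under construction and \<open>R\<close>
  the solution whose neighbours are generated, both as bit vectors. The degeneracy test keeps the
  remaining degrees in \<open>C\<close> and the vertices of low degree, in the order of their discovery, in \<open>O\<close>.
  The guessed vertices are in \<open>U\<close>. The search keeps the codes of the solutions found in \<open>Q\<close>, and \<open>D\<close>
  marks these codes.
\<close>

definition fst_end :: "aexp \<Rightarrow> aexp" where
  "fst_end i = Arr ''I'' (Plus (Plus i i) (N 3))"

definition snd_end :: "aexp \<Rightarrow> aexp" where
  "snd_end i = Arr ''I'' (Plus (Plus i i) (N 4))"

lemma end_simps [simp]:
  "aval (fst_end i) s = arr s ''I'' (aval i s + aval i s + 3)"
  "aval (snd_end i) s = arr s ''I'' (aval i s + aval i s + 4)"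
  "acost (fst_end i) = 2 * acost i + 4" "acost (snd_end i) = 2 * acost i + 4"
  by (simp_all add: fst_end_def snd_end_def)

definition bor :: "bexp \<Rightarrow> bexp \<Rightarrow> bexp" where
  "bor b c = BNot (BAnd (BNot b) (BNot c))"

lemma bor_simps [simp]: "bval (bor b c) s \<longleftrightarrow> bval b s \<or> bval c s" "bcost (bor b c) = bcost b + bcost c + 4"
  by (auto simp: bor_def)

definition incident :: "vname \<Rightarrow> vname \<Rightarrow> bexp" where
  "incident v e = bor (Eq (fst_end (V e)) (V v)) (Eq (snd_end (V e)) (V v))"

definition collect_incident :: com where
  "collect_incident = For ''e'' ''m''
    (Cond (incident ''v'' ''e'') (Seq (Store ''A'' (V ''p'') (V ''e'')) (incr ''p'')) SKIP)"

text \<open>Scanning all edges for every vertex takes time proportional to \<open>n * m\<close>,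
  which is affordable because \<open>n \<le> 2 * m\<close> and the delay is at least cubic in
  \<open>m\<close>.\<close>

definition adjacency :: com where
  "adjacency = Seq (Assign ''p'' (N 0)) (For ''v'' ''n''
    (Seq (Store ''P'' (V ''v'') (V ''p'')) (Seq collect_incident (Store ''Z'' (V ''v'') (V ''p'')))))"

text \<open>The model has no multiplication, so the powers arise by doubling.\<close>

definition powers :: com where
  "powers = Seq (Assign ''w'' (N 1)) (For ''e'' ''m''
    (Seq (Store ''W'' (V ''e'') (V ''w'')) (Assign ''w'' (Plus (V ''w'') (V ''w'')))))"

definition preprocess :: com where
  "preprocess = Seq (Seq (Assign ''n'' (Arr ''I'' (N 1))) (Assign ''m'' (Arr ''I'' (N 2))))
    (Seq adjacency powers)"

lemma writes_preprocess [simp]: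
  "wvars collect_incident = {''e'', ''p''}" "warrs collect_incident = {''A''}"
  "wvars adjacency = {''e'', ''p'', ''v''}" "warrs adjacency = {''A'', ''P'', ''Z''}"
  "wvars powers = {''e'', ''w''}" "warrs powers = {''W''}"
  "wvars preprocess = {''n'', ''m'', ''e'', ''p'', ''v'', ''w''}"
  "warrs preprocess = {''A'', ''P'', ''Z'', ''W''}"
  by (auto simp: collect_incident_def adjacency_def powers_def preprocess_def)

lemma map_upt_upd: "b \<le> i \<Longrightarrow> map (f(i := x)) [a..<b] = map f [a..<b]"
  by auto

section \<open>Correctness of the preprocessing\<close>

context simple_graph_instance
begin

text \<open>Cell 0 of \<open>I\<close> holds the length of the input and cells 1 and 2 hold
  \<open>n\<close> and \<open>m\<close>; hence the offsets 3 and 4 for the endpoints.\<close>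

definition graph_input :: "state \<Rightarrow> bool" where
  "graph_input s \<longleftrightarrow> var s ''n'' = n \<and> var s ''m'' = m \<and>
    (\<forall>j<m. arr s ''I'' (j + j + 3) = fst (G ! j) \<and> arr s ''I'' (j + j + 4) = snd (G ! j))"

definition adjacency_lists :: "state \<Rightarrow> bool" where
  "adjacency_lists s \<longleftrightarrow> (\<forall>v<n. arr s ''P'' v \<le> arr s ''Z'' v \<and>
    map (arr s ''A'') [arr s ''P'' v..<arr s ''Z'' v] = filter (\<lambda>j. v \<in> ed j) [0..<m])"

definition ready :: "state \<Rightarrow> bool" where
  "ready s \<longleftrightarrow> graph_input s \<and> adjacency_lists s \<and> (\<forall>j<m. arr s ''W'' j = 2 ^ j)"

text \<open>After preprocessing, the input and the tables are only read, so \<open>ready\<close> is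
  carried through all later programs by their frame conditions.\<close>

lemma ready_frame:
  "ready s \<Longrightarrow> frame c s s' \<Longrightarrow> wvars c \<inter> {''n'', ''m''} = {} \<Longrightarrow>
    warrs c \<inter> {''I'', ''A'', ''P'', ''Z'', ''W''} = {} \<Longrightarrow> ready s'"
  unfolding frame_def ready_def graph_input_def adjacency_lists_def by auto

lemma collect_incident_spec:
  assumes "graph_input s"
  shows "wp collect_incident (m * 50 + 5) (\<lambda>os' s'. os' = os \<and> var s ''p'' \<le> var s' ''p'' \<and>
    (\<forall>i < var s ''p''. arr s' ''A'' i = arr s ''A'' i) \<and>
    map (arr s' ''A'') [var s ''p''..<var s' ''p''] = filter (\<lambda>j. var s ''v'' \<in> ed j) [0..<m]) os s"
  unfolding collect_incident_def
proof (rule wp_For[where T = 43 and I = "\<lambda>j os' s'. os' = os \<and> var s ''p'' \<le> var s' ''p'' \<and>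
    (\<forall>i < var s ''p''. arr s' ''A'' i = arr s ''A'' i) \<and>
    map (arr s' ''A'') [var s ''p''..<var s' ''p''] = filter (\<lambda>j. var s ''v'' \<in> ed j) [0..<j]"],
    goal_cases init body post)
  case (body j os' s')
  then show ?case
    using assms by (intro wp_straight) (auto simp: incident_def frame_def graph_input_def ed_eq map_upt_upd)
qed (use assms in \<open>auto simp: graph_input_def\<close>)

lemma adjacency_spec:
  assumes "graph_input s"
  shows "wp adjacency (n * (m * 50 + 30) + 10) (\<lambda>os' s'. os' = os \<and> adjacency_lists s') os s"
  unfolding adjacency_def
proof (rule wp_Seq[where T = 2 and T' = "n * (m * 50 + 30) + 8"], rule wp_straight, goal_cases)
  case 3
  let ?s = "sem (Assign ''p'' (N 0)) s"
  \<comment> \<open>The bound \<open>arr s' ''Z'' v \<le> var s' ''p''\<close> protects finished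
    lists: later writes to \<open>A\<close> happen from position \<open>p\<close> on.\<close>
  let ?I = "\<lambda>i os' s'. os' = os \<and> (\<forall>v<i. arr s' ''P'' v \<le> arr s' ''Z'' v \<and> arr s' ''Z'' v \<le> var s' ''p'' \<and>
    map (arr s' ''A'') [arr s' ''P'' v..<arr s' ''Z'' v] = filter (\<lambda>j. v \<in> ed j) [0..<m])"
  show ?case
  proof (intro impI, rule wp_For[where T = "m * 50 + 23" and I = ?I], goal_cases init body post)
    case (body i os' s')
    have gi: "graph_input (sem (Store ''P'' (V ''v'') (V ''p'')) s')" and "i < n"
      using assms body by (auto simp: frame_def graph_input_def)
    show ?case
    proof (rule wp_Seq[where T = 3 and T' = "m * 50 + 20"], rule wp_straight, goal_cases)
      case 3
      let ?s' = "sem (Store ''P'' (V ''v'') (V ''p'')) s'"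
      show ?case
      proof (intro impI, rule wp_Seq[where T = "m * 50 + 5" and T' = 3],
          rule wp_mono[OF collect_incident_spec[OF gi]], goal_cases)
        case (2 os'' s'')
        have eqs: "var s'' ''v'' = i" "arr s'' ''P'' = (arr s' ''P'')(i := var s' ''p'')"
            "arr s'' ''Z'' = arr s' ''Z''"
          using 2(3) body(5) by (simp_all add: frame_def)
        have new: "os'' = os" "var s' ''p'' \<le> var s'' ''p''"
            "map (arr s'' ''A'') [var s' ''p''..<var s'' ''p''] = filter (\<lambda>j. i \<in> ed j) [0..<m]"
          using 2(2) body(2,5) by simp_all
        have "\<forall>v<i. arr s' ''P'' v \<le> arr s' ''Z'' v \<and> arr s' ''Z'' v \<le> var s'' ''p'' \<and>
          map (arr s'' ''A'') [arr s' ''P'' v..<arr s' ''Z'' v] = filter (\<lambda>j. v \<in> ed j) [0..<m]"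
        proof (intro allI impI)
          fix v assume "v < i"
          then have v: "arr s' ''P'' v \<le> arr s' ''Z'' v" "arr s' ''Z'' v \<le> var s' ''p''"
              "map (arr s' ''A'') [arr s' ''P'' v..<arr s' ''Z'' v] = filter (\<lambda>j. v \<in> ed j) [0..<m]"
            using body(2) by auto
          then have "map (arr s'' ''A'') [arr s' ''P'' v..<arr s' ''Z'' v] =
              map (arr s' ''A'') [arr s' ''P'' v..<arr s' ''Z'' v]"
            using 2(2) by (intro map_cong) auto
          with v new(2) show "arr s' ''P'' v \<le> arr s' ''Z'' v \<and> arr s' ''Z'' v \<le> var s'' ''p'' \<and>
              map (arr s'' ''A'') [arr s' ''P'' v..<arr s' ''Z'' v] = filter (\<lambda>j. v \<in> ed j) [0..<m]"
            by simp
        qed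
        with eqs new show ?case
          by (intro impI wp_straight) (simp_all add: All_less_Suc)
      qed auto
    qed auto
  next
    case (post os' s')
    then show ?case
      using assms by (auto simp: adjacency_lists_def graph_input_def)
  qed (use assms in \<open>auto simp: graph_input_def algebra_simps\<close>)
qed auto

lemma powers_spec:
  assumes "graph_input s"
  shows "wp powers (m * 20 + 10) (\<lambda>os' s'. os' = os \<and> (\<forall>j<m. arr s' ''W'' j = 2 ^ j)) os s"
  unfolding powers_def
proof (rule wp_Seq[where T = 2 and T' = "m * 20 + 8"], rule wp_straight, goal_cases)
  case 3
  show ?case
  proof (intro impI, rule wp_For[where T = 13 and
        I = "\<lambda>i os' s'. os' = os \<and> var s' ''w'' = 2 ^ i \<and> (\<forall>j<i. arr s' ''W'' j = 2 ^ j)"],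
      goal_cases init body post)
    case (body i os' s')
    then show ?case by (intro wp_straight) (auto simp: less_Suc_eq)
  qed (use assms in \<open>auto simp: graph_input_def\<close>)
qed auto

lemma preprocess_spec:
  assumes "arr s ''I'' = array_of (encode (degenerate_subgraph_listing k) G)"
  shows "wp preprocess (n * (m * 50 + 30) + m * 20 + 40) (\<lambda>os' s'. os' = os \<and> ready s') os s"
proof -
  have nth: "concat (map (\<lambda>(a, b). [a, b]) H) ! (j + j) = fst (H ! j)"
      "concat (map (\<lambda>(a, b). [a, b]) H) ! Suc (j + j) = snd (H ! j)"
    if "j < length H" for H :: graph and j
    using that
  proof (induction H arbitrary: j)
    case (Cons p H)
    {
      case 1
      with Cons show ?case by (cases j; cases p) auto
    next
      case 2
      with Cons show ?case by (cases j; cases p) auto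
    }
  qed auto
  have len: "length (concat (map (\<lambda>(a, b). [a, b]) H)) = length H + length H" for H :: graph
    by (induction H) auto
  let ?s = "sem (Seq (Assign ''n'' (Arr ''I'' (N 1))) (Assign ''m'' (Arr ''I'' (N 2)))) s"
  have gi: "graph_input ?s"
    using assms nth[of _ G] len[of G]
    by (simp add: graph_input_def degenerate_subgraph_listing_def array_of_def card_edges
        numeral_eq_Suc nth_Cons split: nat.split)
  show ?thesis
    unfolding preprocess_def
  proof (rule wp_Seq[where T = 6 and T' = "n * (m * 50 + 30) + m * 20 + 34"], rule wp_straight, goal_cases)
    case 3
    show ?case
    proof (intro impI, rule wp_Seq[where T' = "m * 20 + 10"], rule wp_mono[OF adjacency_spec[OF gi]],
        goal_cases)
      case (2 os' s')
      then have "graph_input s'" using gi by (auto simp: frame_def graph_input_def)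
      then show ?case
        using 2 gi
        by (intro impI wp_mono[OF powers_spec])
          (auto simp: ready_def graph_input_def adjacency_lists_def frame_def)
    qed auto
  qed auto
qed

end

section \<open>The peeling program\<close>

definition bitset :: "(nat \<Rightarrow> nat) \<Rightarrow> nat \<Rightarrow> nat set" where
  "bitset a b = {j. j < b \<and> a j \<noteq> 0}"

lemma bitset_subset: "bitset a b \<subseteq> {..<b}"
  by (auto simp: bitset_def)

lemma bitset_upd:
  "j < b \<Longrightarrow> bitset (a(j := x)) b = (if x = 0 then bitset a b - {j} else insert j (bitset a b))"
  by (auto simp: bitset_def)

definition clear_degrees :: com where
  "clear_degrees = For ''v'' ''n'' (Store ''C'' (V ''v'') (N 0))"

definition count_degrees :: com where
  "count_degrees = For ''e'' ''m'' (Cond (Eq (Arr ''B'' (V ''e'')) (N 0)) SKIP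
    (Seq (Store ''C'' (fst_end (V ''e'')) (Plus (Arr ''C'' (fst_end (V ''e''))) (N 1)))
         (Store ''C'' (snd_end (V ''e'')) (Plus (Arr ''C'' (snd_end (V ''e''))) (N 1)))))"

definition push :: "vname \<Rightarrow> com" where
  "push v = Seq (Store ''O'' (V ''q'') (V v)) (incr ''q'')"

definition push_low :: "nat \<Rightarrow> com" where
  "push_low k = Seq (Assign ''q'' (N 0)) (For ''v'' ''n'' (Cond (Less (N k) (Arr ''C'' (V ''v''))) SKIP (push ''v'')))"

text \<open>A vertex is queued at the moment its counter drops from \<open>k + 1\<close> to
  \<open>k\<close>, hence at most once. Edges towards removed vertices are not skipped; they only
  lower counters that are already at most \<open>k\<close>.\<close>

definition peel_edge :: "nat \<Rightarrow> com" where
  "peel_edge k = Seq (Assign ''e'' (Arr ''A'' (V ''p''))) (Seq (Cond (Eq (Arr ''B'' (V ''e'')) (N 0)) SKIP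
    (Seq (Assign ''u'' (Minus (Plus (fst_end (V ''e'')) (snd_end (V ''e''))) (V ''v'')))
    (Seq (Store ''C'' (V ''u'') (Minus (Arr ''C'' (V ''u'')) (N 1)))
         (Cond (Eq (Arr ''C'' (V ''u'')) (N k)) (push ''u'') SKIP)))) (incr ''p''))"

definition pop :: com where
  "pop = Seq (Seq (Assign ''v'' (Arr ''O'' (V ''h''))) (incr ''h''))
    (Seq (Assign ''p'' (Arr ''P'' (V ''v''))) (Assign ''z'' (Arr ''Z'' (V ''v''))))"

definition peel_edges :: "nat \<Rightarrow> com" where
  "peel_edges k = While (Less (V ''p'') (V ''z'')) (peel_edge k)"

definition peel_all :: "nat \<Rightarrow> com" where
  "peel_all k = Seq (Assign ''h'' (N 0)) (While (Less (V ''h'') (V ''q'')) (Seq pop (peel_edges k)))"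

definition peel :: "nat \<Rightarrow> com" where
  "peel k = Seq (Seq clear_degrees count_degrees) (Seq (push_low k) (peel_all k))"

lemma writes_peel [simp]:
  "wvars clear_degrees = {''v''}" "warrs clear_degrees = {''C''}"
  "wvars count_degrees = {''e''}" "warrs count_degrees = {''C''}"
  "wvars (push_low k) = {''q'', ''v''}" "warrs (push_low k) = {''O''}"
  "wvars (peel_edge k) = {''e'', ''u'', ''q'', ''p''}" "warrs (peel_edge k) = {''C'', ''O''}"
  "wvars pop = {''v'', ''h'', ''p'', ''z''}" "warrs pop = {}"
  "wvars (peel_edges k) = {''e'', ''u'', ''q'', ''p''}" "warrs (peel_edges k) = {''C'', ''O''}"
  "wvars (peel_all k) = {''v'', ''h'', ''p'', ''z'', ''e'', ''u'', ''q''}" "warrs (peel_all k) = {''C'', ''O''}"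
  "wvars (peel k) = {''v'', ''h'', ''p'', ''z'', ''e'', ''u'', ''q''}" "warrs (peel k) = {''C'', ''O''}"
  by (auto simp: clear_degrees_def count_degrees_def push_low_def push_def peel_edge_def pop_def
      peel_edges_def peel_all_def peel_def)

definition complete :: "nat \<Rightarrow> com" where
  "complete k = For ''f'' ''m'' (Cond (Eq (Arr ''B'' (V ''f'')) (N 0))
    (Seq (Store ''B'' (V ''f'') (N 1)) (Seq (peel k)
      (Cond (Eq (V ''q'') (V ''n'')) SKIP (Store ''B'' (V ''f'') (N 0))))) SKIP)"

lemma writes_complete [simp]:
  "wvars (complete k) = {''f'', ''v'', ''h'', ''p'', ''z'', ''e'', ''u'', ''q''}"
  "warrs (complete k) = {''B'', ''C'', ''O''}"
  by (auto simp: complete_def)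

section \<open>Correctness and linear running time of peeling\<close>

context simple_graph_instance
begin

lemma alive_empty: "alive A {} v = {j \<in> A. v \<in> ed j}"
  by (auto simp: alive_def)

text \<open>Removed vertices stay in the array, so \<open>q\<close> counts all vertices that ever
  reached low degree. The test is decided by comparing it with \<open>n\<close>.\<close>

definition queue :: "(nat \<Rightarrow> nat) \<Rightarrow> (nat \<Rightarrow> nat) \<Rightarrow> nat \<Rightarrow> bool" where
  "queue C Q q \<longleftrightarrow> inj_on Q {..<q} \<and> Q ` {..<q} = {v. v < n \<and> C v \<le> k}"

lemma queue_push:
  assumes "queue C Q q" "u < n" "C u = Suc k"
  shows "queue (C(u := k)) (Q(q := u)) (Suc q)"
proof -
  have img: "(Q(q := u)) ` {..<q} = Q ` {..<q}" by auto
  have "u \<notin> Q ` {..<q}" using assms by (auto simp: queue_def)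
  moreover have "inj_on (Q(q := u)) {..<q}"
    using assms(1) by (auto simp: queue_def inj_on_def)
  ultimately have "inj_on (Q(q := u)) {..<Suc q}"
    unfolding lessThan_Suc using img by (simp add: inj_on_insert)
  moreover have "(Q(q := u)) ` {..<Suc q} = {v. v < n \<and> (C(u := k)) v \<le> k}"
    unfolding lessThan_Suc image_insert img using assms by (auto simp: queue_def)
  ultimately show ?thesis by (simp add: queue_def)
qed

lemma queue_decrement: "queue C Q q \<Longrightarrow> C u \<noteq> Suc k \<Longrightarrow> queue (C(u := C u - 1)) Q q"
proof -
  assume "queue C Q q" "C u \<noteq> Suc k"
  moreover from this have "(C(u := C u - 1)) v \<le> k \<longleftrightarrow> C v \<le> k" for v by auto
  ultimately show ?thesis by (simp add: queue_def)
qed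

lemma clear_degrees_spec:
  assumes "graph_input s"
  shows "wp clear_degrees (n * 10 + 5) (\<lambda>os' s'. os' = os \<and> (\<forall>v<n. arr s' ''C'' v = 0)) os s"
  unfolding clear_degrees_def
proof (rule wp_For[where T = 3 and I = "\<lambda>i os' s'. os' = os \<and> (\<forall>v<i. arr s' ''C'' v = 0)"],
    goal_cases init body post)
  case (body i os' s')
  then show ?case by (intro wp_straight) (auto simp: less_Suc_eq)
qed (use assms in \<open>auto simp: graph_input_def\<close>)

lemma card_incident_Suc:
  "card {j. j < Suc i \<and> j \<in> A \<and> v \<in> ed j} =
    card {j. j < i \<and> j \<in> A \<and> v \<in> ed j} + (if i \<in> A \<and> v \<in> ed i then 1 else 0)"
proof -
  have "{j. j < Suc i \<and> j \<in> A \<and> v \<in> ed j} =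
      (if i \<in> A \<and> v \<in> ed i then {i} else {}) \<union> {j. j < i \<and> j \<in> A \<and> v \<in> ed j}"
    by (auto simp: less_Suc_eq)
  then show ?thesis by simp
qed

lemma count_degrees_spec:
  assumes "graph_input s" "\<forall>v<n. arr s ''C'' v = 0"
  shows "wp count_degrees (m * 70 + 5) (\<lambda>os' s'. os' = os \<and>
    (\<forall>v<n. arr s' ''C'' v = card {j \<in> bitset (arr s ''B'') m. v \<in> ed j})) os s"
  unfolding count_degrees_def
proof (rule wp_For[where T = 63 and I = "\<lambda>i os' s'. os' = os \<and>
      (\<forall>v<n. arr s' ''C'' v = card {j. j < i \<and> j \<in> bitset (arr s ''B'') m \<and> v \<in> ed j})"],
    goal_cases init body post)
  case (body i os' s')
  then have i: "i < m" "var s' ''e'' = i" "arr s' ''B'' = arr s ''B''"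
      "arr s' ''I'' (i + i + 3) = fst (G ! i)" "arr s' ''I'' (i + i + 4) = snd (G ! i)"
    using assms(1) by (auto simp: graph_input_def frame_def)
  moreover have "arr s ''B'' i = 0 \<longleftrightarrow> i \<notin> bitset (arr s ''B'') m"
    using i by (simp add: bitset_def)
  ultimately show ?case
    using body(1) endpoints_neq[of i]
    by (intro wp_straight) (auto simp: card_incident_Suc ed_eq)
next
  case (post os' s')
  moreover have "{j. j < m \<and> j \<in> bitset (arr s ''B'') m \<and> v \<in> ed j} = {j \<in> bitset (arr s ''B'') m. v \<in> ed j}" for v
    by (auto simp: bitset_def)
  ultimately show ?case using assms by (simp add: graph_input_def)
qed (use assms in \<open>auto simp: graph_input_def\<close>)

lemma push_low_spec:
  assumes "graph_input s"
  shows "wp (push_low k) (n * 30 + 10) (\<lambda>os' s'. os' = os \<and> queue (arr s' ''C'') (arr s' ''O'') (var s' ''q'')) os s"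
  unfolding push_low_def
proof (rule wp_Seq[where T = 2 and T' = "n * 30 + 8"], rule wp_straight, goal_cases)
  case 3
  show ?case
  proof (intro impI, rule wp_For[where T = 15 and I = "\<lambda>i os' s'. os' = os \<and>
      inj_on (arr s' ''O'') {..<var s' ''q''} \<and>
      arr s' ''O'' ` {..<var s' ''q''} = {v. v < i \<and> arr s ''C'' v \<le> k}"],
      goal_cases init body post)
    case (body i os' s')
    let ?O = "arr s' ''O''" and ?q = "var s' ''q''"
    have C: "arr s' ''C'' = arr s ''C''" using body by (auto simp: frame_def push_def)
    have img: "?O(?q := i) ` {..<?q} = ?O ` {..<?q}" by auto
    have "i \<notin> ?O ` {..<?q}" using body(2) by auto
    moreover have "inj_on (?O(?q := i)) {..<?q}"
      using body(2) by (auto simp: inj_on_def)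
    ultimately have inj: "inj_on (?O(?q := i)) {..<Suc ?q}"
      unfolding lessThan_Suc using img by (simp add: inj_on_insert)
    have img': "?O(?q := i) ` {..<Suc ?q} = insert i (?O ` {..<?q})"
      unfolding lessThan_Suc image_insert img by simp
    show ?case
    proof (rule wp_straight, goal_cases)
      case 3
      show ?case
      proof (cases "arr s ''C'' i \<le> k")
        case True
        with body C inj img' show ?thesis
          by (auto simp: push_def less_Suc_eq)
      next
        case False
        then have "{v. v < Suc i \<and> arr s ''C'' v \<le> k} = {v. v < i \<and> arr s ''C'' v \<le> k}"
          by (auto simp: less_Suc_eq)
        with False body C show ?thesis by auto
      qed
    qed (auto simp: push_def)
  next
    case (post os' s')
    then show ?case using assms by (auto simp: queue_def frame_def graph_input_def push_def)
  qed (use assms in \<open>auto simp: graph_input_def push_def\<close>)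
qed auto

text \<open>While the edges at \<open>v\<close> are processed, \<open>D\<close> is the set of those already done.\<close>

definition partial_degrees :: "nat set \<Rightarrow> nat set \<Rightarrow> nat \<Rightarrow> nat set \<Rightarrow> (nat \<Rightarrow> nat) \<Rightarrow> bool" where
  "partial_degrees A R v D C \<longleftrightarrow> (\<forall>u<n. u \<notin> insert v R \<longrightarrow> C u = card (alive A R u - D))"

lemma partial_degrees_skip:
  "partial_degrees A R v D C \<Longrightarrow> j \<notin> A \<Longrightarrow> partial_degrees A R v (insert j D) C"
proof -
  assume "partial_degrees A R v D C" "j \<notin> A"
  moreover from this have "alive A R u - insert j D = alive A R u - D" for u
    by (auto simp: alive_def)
  ultimately show ?thesis by (simp add: partial_degrees_def)
qed

text \<open>Besides \<open>v\<close>, only the other end of \<open>j\<close> loses an edge. The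
  invariant exempts \<open>v\<close> and \<open>R\<close>, so a decrement at a removed vertex does
  no harm.\<close>

lemma partial_degrees_step:
  assumes "partial_degrees A R v D C" "A \<subseteq> {..<m}" "j \<in> A" "v \<in> ed j" "v \<notin> R" "j \<notin> D"
  shows "partial_degrees A R v (insert j D) (C(other v j := C (other v j) - 1))"
  unfolding partial_degrees_def
proof (intro allI impI)
  fix u assume u: "u < n" "u \<notin> insert v R"
  then have C: "C u = card (alive A R u - D)" using assms(1) by (simp add: partial_degrees_def)
  have j: "j < m" "ed j = {v, other v j}" "other v j \<noteq> v" using assms ed_other[of j v] by auto
  show "(C(other v j := C (other v j) - 1)) u = card (alive A R u - insert j D)"
  proof (cases "u = other v j")
    case True
    have "j \<in> alive A R u - D" using True j assms u by (auto simp: alive_def)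
    moreover have "alive A R u - insert j D = (alive A R u - D) - {j}" by auto
    ultimately show ?thesis using True C by simp
  next
    case False
    then have "j \<notin> alive A R u" using j u by (auto simp: alive_def)
    then have "alive A R u - insert j D = alive A R u - D" by auto
    then show ?thesis using False C by simp
  qed
qed

lemma partial_degrees_done:
  assumes "partial_degrees A R v {j. j < m \<and> v \<in> ed j} C" "A \<subseteq> {..<m}" "u < n" "u \<notin> insert v R"
  shows "C u = card (alive A (insert v R) u)"
proof -
  have "alive A R u - {j. j < m \<and> v \<in> ed j} = alive A (insert v R) u"
    using assms(2) by (auto simp: alive_def)
  then show ?thesis using assms by (simp add: partial_degrees_def)
qed

lemma peel_edges_spec:
  assumes "0 < k" "graph_input s" "v < n" "v \<notin> R" and v: "var s ''v'' = v"
    and edges: "map (arr s ''A'') [var s ''p''..<var s ''z''] = filter (\<lambda>j. v \<in> ed j) [0..<m]"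
    and "queue (arr s ''C'') (arr s ''O'') (var s ''q'')"
    and "partial_degrees A R v {} (arr s ''C'')" and A: "A = bitset (arr s ''B'') m"
  shows "wp (peel_edges k) (card {j. j < m \<and> v \<in> ed j} * 70 + 5) (\<lambda>os' s'. os' = os \<and>
    queue (arr s' ''C'') (arr s' ''O'') (var s' ''q'') \<and> var s ''q'' \<le> var s' ''q'' \<and>
    (\<forall>i < var s ''q''. arr s' ''O'' i = arr s ''O'' i) \<and>
    partial_degrees A R v {j. j < m \<and> v \<in> ed j} (arr s' ''C'')) os s"
proof -
  define es where "es = filter (\<lambda>j. v \<in> ed j) [0..<m]"
  define p where "p = var s ''p''"
  have len: "length es = var s ''z'' - p"
    unfolding es_def edges[symmetric] p_def by simp
  have nth: "arr s ''A'' (p + i) = es ! i" if "i < length es" for i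
    using that len unfolding es_def edges[symmetric] p_def by simp
  have set_es: "set es = {j. j < m \<and> v \<in> ed j}" and "distinct es" by (auto simp: es_def)
  then have len': "length es = card {j. j < m \<and> v \<in> ed j}" by (metis distinct_card)
  let ?I = "\<lambda>os' s'. os' = os \<and> p \<le> var s' ''p'' \<and> var s' ''p'' - p \<le> length es \<and>
    queue (arr s' ''C'') (arr s' ''O'') (var s' ''q'') \<and> var s ''q'' \<le> var s' ''q'' \<and>
    (\<forall>i < var s ''q''. arr s' ''O'' i = arr s ''O'' i) \<and>
    partial_degrees A R v (set (take (var s' ''p'' - p) es)) (arr s' ''C'')"
  show ?thesis
    unfolding peel_edges_def
  proof (rule wp_While[where I = ?I and \<Phi> = "\<lambda>s'. (length es - (var s' ''p'' - p)) * 70" and T = "\<lambda>_. 60"],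
      goal_cases init body post time)
    case init
    then show ?case using assms by (simp add: p_def)
  next
    case (body os' s')
    define i where "i = var s' ''p'' - p"
    define j where "j = es ! i"
    have eqs: "var s' ''v'' = v" "var s' ''z'' = var s ''z''" "arr s' ''A'' = arr s ''A''"
        "arr s' ''B'' = arr s ''B''" "arr s' ''I'' = arr s ''I''"
      using body(2) v by (auto simp: frame_def)
    have i: "i < length es" "var s' ''p'' = p + i"
      using body(1,3) eqs len by (auto simp: i_def)
    have e: "arr s' ''A'' (p + i) = j" using nth i eqs by (simp add: j_def)
    have "j \<in> set es" using i by (simp add: j_def)
    then have j: "j < m" "v \<in> ed j" using set_es by auto
    have I: "arr s' ''I'' (j + j + 3) = fst (G ! j)" "arr s' ''I'' (j + j + 4) = snd (G ! j)"
      using assms(2) j eqs by (auto simp: graph_input_def)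
    have take: "set (take (Suc i) es) = insert j (set (take i es))"
      using i by (simp add: take_Suc_conv_app_nth j_def)
    have notin: "j \<notin> set (take i es)"
      using i \<open>distinct es\<close> by (auto simp: j_def in_set_conv_nth nth_eq_iff_index_eq)
    have jA: "arr s' ''B'' j \<noteq> 0 \<longleftrightarrow> j \<in> A" using j eqs A by (simp add: bitset_def)
    have pd: "partial_degrees A R v (set (take i es)) (arr s' ''C'')" using body(1) i by simp
    have other: "other v j < n" "other v j \<noteq> v" using j other_less ed_other by auto
    have arith: "Suc (p + i) - p = Suc i" by simp
    have time: "(length es - Suc i) * 70 + 60 + 3 \<le> (length es - i) * 70" using i by simp
    show ?case
    proof (rule wp_straight, goal_cases)
      case 3
      show ?case
      proof (cases "j \<in> A")
        case False
        then show ?thesis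
          using body(1) i e jA partial_degrees_skip[OF pd False] take time
          by (simp add: peel_edge_def arith)
      next
        case True
        let ?C = "arr s' ''C''" and ?u = "other v j"
        have pd': "partial_degrees A R v (insert j (set (take i es))) (?C(?u := ?C ?u - 1))"
          using True A by (intro partial_degrees_step pd j assms notin) (simp_all add: bitset_subset)
        have q: "queue ?C (arr s' ''O'') (var s' ''q'')" using body(1) by simp
        show ?thesis
        proof (cases "?C ?u = Suc k")
          case c: True
          have "queue (?C(?u := k)) ((arr s' ''O'')(var s' ''q'' := ?u)) (Suc (var s' ''q''))"
            using q other c by (intro queue_push)
          then show ?thesis
            using body(1) i e jA True pd' take time I eqs c
            by (simp add: peel_edge_def push_def arith)
        next
          case c: False
          \<comment> \<open>Truncation matters here: a counter at 0 stays at 0, and a vertex would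
            be queued again if \<open>k\<close> were 0.\<close>
          then have "?C ?u - 1 \<noteq> k" using \<open>0 < k\<close> by auto
          moreover have "queue (?C(?u := ?C ?u - 1)) (arr s' ''O'') (var s' ''q'')"
            using q c by (rule queue_decrement)
          ultimately show ?thesis
            using body(1) i e jA True pd' take time I eqs
            by (simp add: peel_edge_def arith)
        qed
      qed
    qed (simp_all add: peel_edge_def push_def)
  next
    case (post os' s')
    then have "var s' ''z'' = var s ''z''" "\<not> var s' ''p'' < var s' ''z''" "var s' ''p'' - p \<le> length es"
      by (simp_all add: frame_def)
    then have "var s' ''p'' - p = length es" using len by linarith
    with post show ?case by (simp add: set_es)
  next
    case time
    then show ?case by (simp add: p_def len')
  qed
qed

text \<open>If all vertices get queued, the order of removal certifies degeneracy. Otherwise the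
  vertices never queued span a subgraph without a vertex of low degree.\<close>

lemma peel_all_spec:
  assumes "0 < k" "ready s"
    and "queue (arr s ''C'') (arr s ''O'') (var s ''q'')"
    and A: "A = bitset (arr s ''B'') m"
    and C: "\<forall>v<n. arr s ''C'' v = card {j \<in> A. v \<in> ed j}"
  shows "wp (peel_all k) (n * 40 + m * 140 + 10) (\<lambda>os' s'. os' = os \<and>
    (var s' ''q'' = n \<longleftrightarrow> deg_ok A)) os s"
  unfolding peel_all_def
proof (rule wp_Seq[where T = 2 and T' = "n * 40 + m * 140 + 8"], rule wp_straight, goal_cases)
  case 3
  let ?s = "sem (Assign ''h'' (N 0)) s"
  let ?R = "\<lambda>s'. arr s' ''O'' ` {..<var s' ''h''}"
  let ?d = "\<lambda>v. card {j. j < m \<and> v \<in> ed j}"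
  \<comment> \<open>The last conjunct records the degree of each vertex at the time of its removal,
    as the certificate requires.\<close>
  let ?I = "\<lambda>os' s'. os' = os \<and> queue (arr s' ''C'') (arr s' ''O'') (var s' ''q'') \<and>
    var s' ''h'' \<le> var s' ''q'' \<and>
    (\<forall>u<n. u \<notin> ?R s' \<longrightarrow> arr s' ''C'' u = card (alive A (?R s') u)) \<and>
    (\<forall>i < var s' ''h''. card (alive A (arr s' ''O'' ` {..<i}) (arr s' ''O'' i)) \<le> k)"
  \<comment> \<open>Each vertex not yet removed is paid for by its degree in \<open>G\<close> plus a
    constant, so the total is linear in \<open>n + m\<close>.\<close>
  let ?\<Phi> = "\<lambda>s'. \<Sum>v\<in>{..<n} - ?R s'. ?d v * 70 + 40"
  show ?case
  proof (intro impI, rule wp_While[where I = ?I and \<Phi> = ?\<Phi> and T = "\<lambda>s'. ?d (arr s' ''O'' (var s' ''h'')) * 70 + 25"],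
      goal_cases init body post time)
    case init
    then show ?case using assms by (simp add: alive_empty)
  next
    case (body os' s')
    let ?O = "arr s' ''O''" and ?h = "var s' ''h''"
    define v where "v = ?O ?h"
    define R where "R = ?O ` {..<?h}"
    have h: "?h < var s' ''q''" and q: "queue (arr s' ''C'') ?O (var s' ''q'')"
      using body(2,4) by simp_all
    then have v: "v < n" "arr s' ''C'' v \<le> k" by (auto simp: queue_def v_def)
    have vR: "v \<notin> R"
    proof
      assume "v \<in> R"
      then obtain i where "i < ?h" "?O i = ?O ?h" by (auto simp: v_def R_def)
      moreover have "inj_on ?O {..<var s' ''q''}" using q by (simp add: queue_def)
      ultimately show False using h by (auto dest: inj_onD)
    qed
    have rd: "ready s'"
      by (rule ready_frame[OF assms(2), of "peel_all k"])
        (use body(3) in \<open>auto simp: frame_def\<close>)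
    have B: "A = bitset (arr s' ''B'') m" using body(3) A by (simp add: frame_def)
    have Cv: "arr s' ''C'' v = card (alive A R v)"
      using body(2) v vR by (simp add: R_def)
    let ?t = "sem pop s'"
    have "wp (peel_edges k) (?d v * 70 + 5) (\<lambda>os'' s''. os'' = os' \<and>
      queue (arr s'' ''C'') (arr s'' ''O'') (var s'' ''q'') \<and> var ?t ''q'' \<le> var s'' ''q'' \<and>
      (\<forall>i < var ?t ''q''. arr s'' ''O'' i = arr ?t ''O'' i) \<and>
      partial_degrees A R v {j. j < m \<and> v \<in> ed j} (arr s'' ''C'')) os' ?t"
    proof (rule peel_edges_spec)
      show "graph_input ?t" using rd by (auto simp: ready_def graph_input_def pop_def)
      show "map (arr ?t ''A'') [var ?t ''p''..<var ?t ''z''] = filter (\<lambda>j. v \<in> ed j) [0..<m]"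
        using rd v by (simp add: ready_def adjacency_lists_def pop_def v_def)
      show "queue (arr ?t ''C'') (arr ?t ''O'') (var ?t ''q'')" using q by (simp add: pop_def)
      show "partial_degrees A R v {} (arr ?t ''C'')"
        using body(2) by (auto simp: partial_degrees_def pop_def R_def)
    qed (use assms(1) v vR B in \<open>auto simp: pop_def v_def\<close>)
    then have *: "wp (peel_edges k) (?d v * 70 + 5) (\<lambda>os'' s''. ?I os'' s'' \<and>
        ?\<Phi> s'' + (?d v * 70 + 25) + bcost (Less (V ''h'') (V ''q'')) \<le> ?\<Phi> s') os' ?t"
    proof (rule wp_mono, goal_cases)
      case (2 os'' s'')
      have h'': "var s'' ''h'' = Suc ?h" using 2(2) by (simp add: frame_def pop_def)
      have O: "arr s'' ''O'' i = ?O i" if "i \<le> ?h" for i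
        using 2(1) h that by (simp add: pop_def)
      have img: "arr s'' ''O'' ` {..<i} = ?O ` {..<i}" if "i \<le> Suc ?h" for i
        using O that by (intro image_cong) auto
      have R'': "?R s'' = insert v R"
        unfolding h'' img[OF order.refl] by (simp add: lessThan_Suc v_def R_def)
      have "arr s'' ''C'' u = card (alive A (insert v R) u)" if "u < n" "u \<notin> insert v R" for u
        using 2(1) that bitset_subset B by (intro partial_degrees_done) auto
      moreover have "card (alive A (arr s'' ''O'' ` {..<i}) (arr s'' ''O'' i)) \<le> k" if "i < Suc ?h" for i
      proof (cases "i = ?h")
        case True
        then show ?thesis using O img v Cv by (simp add: v_def R_def)
      next
        case False
        then show ?thesis using that O img body(2) by simp
      qed
      moreover have "?\<Phi> s'' + (?d v * 70 + 40) = ?\<Phi> s'"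
      proof -
        have "{..<n} - ?R s' = insert v ({..<n} - insert v R)" using v vR by (auto simp: R_def)
        then show ?thesis unfolding R'' by simp
      qed
      ultimately show ?case
        using 2(1) h R'' h'' body(2) by (simp add: pop_def)
    qed simp
    show ?case
      unfolding v_def[symmetric]
    proof (rule wp_Seq[where T = 20 and T' = "?d v * 70 + 5"], rule wp_straight, goal_cases)
      case 3
      then show ?case using * by blast
    qed (simp_all add: pop_def)
  next
    case (post os' s')
    let ?O = "arr s' ''O''" and ?q = "var s' ''q''"
    have hq: "var s' ''h'' = ?q" and q: "queue (arr s' ''C'') ?O ?q" and os: "os' = os"
      using post(2,4) by simp_all
    have Am: "A \<subseteq> {..<m}" using A bitset_subset by simp
    have sub: "?O ` {..<?q} \<subseteq> {..<n}" using q by (auto simp: queue_def)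
    have "inj_on ?O {..<?q}" using q by (simp add: queue_def)
    then have card: "card (?O ` {..<?q}) = ?q" by (simp add: card_image)
    have "?q = n \<longleftrightarrow> deg_ok A"
    proof
      assume "?q = n"
      with sub card have "?O ` {..<?q} = {..<n}" by (intro card_subset_eq) auto
      then show "deg_ok A"
        using post(2) hq Am by (intro peeled_deg_ok[of A ?O ?q]) auto
    next
      assume ok: "deg_ok A"
      show "?q = n"
      proof (rule ccontr)
        assume "?q \<noteq> n"
        then have "?O ` {..<?q} \<noteq> {..<n}" using card by auto
        then obtain v0 where "v0 < n" "v0 \<notin> ?O ` {..<?q}" using sub by auto
        moreover have "k < card (alive A (?O ` {..<?q}) v)" if "v < n" "v \<notin> ?O ` {..<?q}" for v
        proof -
          have "k < arr s' ''C'' v" using q that by (auto simp: queue_def)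
          then show ?thesis using post(2) hq that by simp
        qed
        ultimately show False using stuck_not_deg_ok[OF Am] ok by blast
      qed
    qed
    with os show ?case by simp
  next
    case time
    have "(\<Sum>v<n. ?d v * 70 + 40) = (\<Sum>v<n. ?d v) * 70 + n * 40"
      by (simp add: sum.distrib sum_distrib_right)
    also have "\<dots> \<le> 2 * m * 70 + n * 40" using sum_degrees by simp
    finally show ?case by simp
  qed
qed auto

lemma peel_spec:
  assumes "0 < k" "ready s"
  shows "wp (peel k) (n * 80 + m * 210 + 40) (\<lambda>os' s'. os' = os \<and>
    (var s' ''q'' = n \<longleftrightarrow> deg_ok (bitset (arr s ''B'') m))) os s"
  unfolding peel_def
proof (rule wp_Seq[where T = "n * 10 + m * 70 + 10" and T' = "n * 70 + m * 140 + 20"],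
    rule wp_Seq[where T = "n * 10 + 5" and T' = "m * 70 + 5"], rule wp_mono[OF clear_degrees_spec], goal_cases)
  case (3 os' s')
  then have "graph_input s'" "arr s' ''B'' = arr s ''B''" using assms(2)
    by (auto simp: ready_def graph_input_def frame_def)
  then show ?case
  proof (intro impI wp_mono[OF count_degrees_spec], goal_cases)
    case (4 os'' s'')
    have rd: "ready s''"
      by (rule ready_frame[OF assms(2), of "Seq clear_degrees count_degrees"])
        (use 3 4 in \<open>auto simp: frame_def\<close>)
    have B: "arr s'' ''B'' = arr s ''B''" using 3 4 by (simp add: frame_def)
    have C: "\<forall>v<n. arr s'' ''C'' v = card {j \<in> bitset (arr s ''B'') m. v \<in> ed j}" "os'' = os"
      using 3 4 by simp_all
    show ?case
    proof (rule wp_Seq[where T = "n * 30 + 10" and T' = "n * 40 + m * 140 + 10"],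
        rule wp_mono[OF push_low_spec], goal_cases)
      case (3 os3 s3)
      have rd3: "ready s3" by (rule ready_frame[OF rd 3(2)]) auto
      show ?case
      proof (intro impI wp_mono[OF peel_all_spec[where A = "bitset (arr s ''B'') m"]], goal_cases)
        case (7 os4 s4)
        then show ?case using 3 C B by (simp add: frame_def)
      qed (use assms rd3 3 B C in \<open>auto simp: frame_def\<close>)
    qed (use rd in \<open>auto simp: ready_def\<close>)
  qed (use 3 in auto)
qed (use assms in \<open>auto simp: ready_def\<close>)

lemma complete_spec:
  assumes "0 < k" "ready s" "deg_ok (bitset (arr s ''B'') m)"
  shows "wp (complete k) (m * (n * 80 + m * 210 + 90) + 10) (\<lambda>os' s'. os' = os \<and>
    bitset (arr s' ''B'') m = greedy (bitset (arr s ''B'') m) m) os s"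
  unfolding complete_def
proof (rule wp_For[where T = "n * 80 + m * 210 + 80" and I = "\<lambda>f os' s'. os' = os \<and>
      bitset (arr s' ''B'') m = greedy (bitset (arr s ''B'') m) f"], fold complete_def,
    goal_cases init body post)
  case (body f os' s')
  have rd: "ready s'" by (rule ready_frame[OF assms(2) body(2)]) auto
  have nm: "var s ''m'' = m" "f < m" using assms(2) body(3) by (auto simp: ready_def graph_input_def)
  define A where "A = greedy (bitset (arr s ''B'') m) f"
  have A: "bitset (arr s' ''B'') m = A" "deg_ok A" "os' = os"
    using body(1) assms(3) greedy_deg_ok by (simp_all add: A_def)
  have in_A: "arr s' ''B'' f = 0 \<longleftrightarrow> f \<notin> A"
    using nm A(1) by (auto simp: bitset_def)
  show ?case
  proof (rule wp_Cond[where T = "n * 80 + m * 210 + 60"], goal_cases)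
    case 1
    then have f: "f \<notin> A" using in_A body(4) by simp
    let ?s = "sem (Store ''B'' (V ''f'') (N 1)) s'"
    have rd': "ready ?s" using rd by (simp add: ready_def graph_input_def adjacency_lists_def)
    have bs: "bitset (arr ?s ''B'') m = insert f A"
      using A nm body(4) by (simp add: bitset_upd)
    show ?case
    proof (rule wp_Seq[where T = 3 and T' = "n * 80 + m * 210 + 57"], rule wp_straight, goal_cases)
      case 3
      show ?case
      proof (intro impI, rule wp_Seq[where T = "n * 80 + m * 210 + 40" and T' = 17],
          rule wp_mono[OF peel_spec[OF assms(1) rd']], goal_cases)
        case (2 os'' s'')
        have B: "arr s'' ''B'' = arr ?s ''B''" and f': "var s'' ''f'' = f" and n: "var s'' ''n'' = n"
          using 2(3) rd body(4) by (simp_all add: frame_def ready_def graph_input_def)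
        have bs'': "bitset (arr s'' ''B'') m = insert f A" unfolding B bs ..
        moreover have "bitset ((arr s'' ''B'')(f := 0)) m = A"
          using bs'' f nm by (simp add: bitset_upd)
        moreover have "os'' = os" and "var s'' ''q'' = n \<longleftrightarrow> deg_ok (insert f A)"
          using 2(2) A(3) unfolding bs by simp_all
        ultimately show ?case
          using f' n by (intro impI wp_straight) (simp_all add: A_def[symmetric] Let_def)
      qed auto
    qed auto
  next
    case 2
    then have "f \<in> A" using in_A body(4) by simp
    then have "insert f A = A" by auto
    then show ?case
      using A by (intro wp_straight) (simp_all add: A_def[symmetric] Let_def)
  qed auto
qed (use assms(2) in \<open>auto simp: ready_def graph_input_def algebra_simps\<close>)

end

section \<open>Generating the neighbours\<close>

text \<open>As \<open>d\<close> is \<open>k - 1\<close> in the programs, a constant, membership in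
  the tuple is an unrolled disjunction. The empty disjunction is the false test
  \<open>0 < 0\<close>.\<close>

fun member :: "nat \<Rightarrow> aexp \<Rightarrow> bexp" where
  "member 0 x = Less (N 0) (N 0)"
| "member (Suc j) x = bor (Eq (Arr ''U'' (N j)) x) (member j x)"

lemma bval_member [simp]: "bval (member d x) s \<longleftrightarrow> aval x s \<in> arr s ''U'' ` {..<d}"
  by (induction d) (auto simp: lessThan_Suc)

lemma bcost_member: "bcost (member d x) = 3 + d * (acost x + 7)"
  by (induction d) auto

definition keep :: "nat \<Rightarrow> bexp" where
  "keep d = bor (Eq (V ''g'') (V ''a'')) (BAnd (BNot (Eq (Arr ''R'' (V ''g'')) (N 0)))
    (bor (BNot (incident ''b'' ''g''))
      (member d (Minus (Plus (fst_end (V ''g'')) (snd_end (V ''g''))) (V ''b'')))))"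

definition build :: "nat \<Rightarrow> com" where
  "build d = For ''g'' ''m'' (Cond (keep d) (Store ''B'' (V ''g'') (N 1)) (Store ''B'' (V ''g'') (N 0)))"

text \<open>A nest of \<open>j\<close> loops, unrolled by recursion. The cells of \<open>U\<close>
  themselves are the loop counters, so \<open>c\<close> finds the current tuple there.\<close>

fun tuples :: "nat \<Rightarrow> com \<Rightarrow> com" where
  "tuples 0 c = c"
| "tuples (Suc j) c = Seq (Store ''U'' (N j) (N 0)) (While (Less (Arr ''U'' (N j)) (V ''n''))
    (Seq (tuples j c) (Store ''U'' (N j) (Plus (Arr ''U'' (N j)) (N 1)))))"

text \<open>The parameter \<open>post\<close> says what happens to a neighbour: it is output when
  neighbours are computed and saved during the search. One generator thus serves both
  claims.\<close>

definition visit :: "nat \<Rightarrow> com \<Rightarrow> com" where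
  "visit k post = Seq (build (k - 1)) (Seq (complete k) post)"

definition expand :: "nat \<Rightarrow> com \<Rightarrow> com" where
  "expand k post = For ''a'' ''m''
    (Seq (Assign ''b'' (fst_end (V ''a''))) (Seq (tuples (k - 1) (visit k post))
    (Seq (Assign ''b'' (snd_end (V ''a''))) (tuples (k - 1) (visit k post)))))"

lemma wvars_tuples [simp]: "wvars (tuples j c) = wvars c"
  by (induction j) auto

lemma warrs_tuples: "warrs (tuples j c) \<subseteq> insert ''U'' (warrs c)"
  by (induction j) auto

lemma writes_build [simp]: "wvars (build d) = {''g''}" "warrs (build d) = {''B''}"
  by (auto simp: build_def)

lemma writes_visit [simp]:
  "wvars (visit k post) = {''g'', ''f'', ''v'', ''h'', ''p'', ''z'', ''e'', ''u'', ''q''} \<union> wvars post"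
  "warrs (visit k post) = {''B'', ''C'', ''O''} \<union> warrs post"
  by (auto simp: visit_def)

lemma writes_expand:
  "wvars (expand k post) = {''a'', ''b'', ''g'', ''f'', ''v'', ''h'', ''p'', ''z'', ''e'', ''u'', ''q''} \<union> wvars post"
  "warrs (expand k post) \<subseteq> {''U'', ''B'', ''C'', ''O''} \<union> warrs post"
  using warrs_tuples[of "k - 1" "visit k post"] by (auto simp: expand_def)

text \<open>The contents of \<open>U\<close> are functions on all numbers; cells from
  \<open>j\<close> on keep whatever value \<open>u0\<close> they had.\<close>

definition tuple_variants :: "nat \<Rightarrow> nat \<Rightarrow> (nat \<Rightarrow> nat) \<Rightarrow> (nat \<Rightarrow> nat) set" where
  "tuple_variants b j u0 = {u. (\<forall>i<j. u i < b) \<and> (\<forall>i\<ge>j. u i = u0 i)}"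

lemma tuple_variants_0: "tuple_variants b 0 u0 = {u0}"
  by (auto simp: tuple_variants_def)

lemma tuple_variants_Suc: "tuple_variants b (Suc j) u0 = (\<Union>a<b. tuple_variants b j (u0(j := a)))"
proof (intro set_eqI iffI)
  fix u assume "u \<in> tuple_variants b (Suc j) u0"
  then have u: "\<And>i. i < Suc j \<Longrightarrow> u i < b" "\<And>i. i \<ge> Suc j \<Longrightarrow> u i = u0 i"
    by (auto simp: tuple_variants_def)
  have "u i = (u0(j := u j)) i" if "i \<ge> j" for i
    using that u(2)[of i] by (cases "i = j") auto
  then have "u \<in> tuple_variants b j (u0(j := u j))"
    unfolding tuple_variants_def mem_Collect_eq using u(1) less_SucI by blast
  moreover have "u j < b" by (rule u(1)) simp
  ultimately show "u \<in> (\<Union>a<b. tuple_variants b j (u0(j := a)))" by blast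
qed (auto simp: tuple_variants_def less_Suc_eq Suc_le_eq)

lemma tuple_variants_cong: "(\<And>i. i \<ge> j \<Longrightarrow> u i = u' i) \<Longrightarrow> tuple_variants b j u = tuple_variants b j u'"
  by (auto simp: tuple_variants_def)

text \<open>The set \<open>X\<close> is a ghost variable collecting the contents of \<open>U\<close>
  for which \<open>c\<close> has been run. The base \<open>b + 1\<close> instead of \<open>b\<close>
  leaves room for the loop overhead, even if \<open>b = 0\<close>.\<close>

lemma tuples_spec:
  assumes body: "\<And>X os s. J X os s \<Longrightarrow> wp c T (\<lambda>os' s'. J (insert (arr s ''U'') X) os' s') os s"
    and J_upd: "\<And>X os s i x. J X os s \<Longrightarrow> J X os (s\<lparr>arr := (arr s)(''U'' := (arr s ''U'')(i := x))\<rparr>)"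
    and J_n: "\<And>X os s. J X os s \<Longrightarrow> var s ''n'' = b"
    and U: "''U'' \<notin> warrs c"
  shows "J X os s \<Longrightarrow> wp (tuples j c) ((b + 1) ^ j * (T + 20 * j)) (\<lambda>os' s'.
    J (X \<union> tuple_variants b j (arr s ''U'')) os' s' \<and> (\<forall>i\<ge>j. arr s' ''U'' i = arr s ''U'' i)) os s"
proof (induction j arbitrary: X os s)
  case 0
  show ?case
    unfolding tuples.simps
    by (rule wp_mono[OF body[OF 0]]) (use U in \<open>simp_all add: tuple_variants_0 frame_def\<close>)
next
  case (Suc j)
  define T' where "T' = (b + 1) ^ j * (T + 20 * j)"
  define u0 where "u0 = arr s ''U''"
  let ?s = "sem (Store ''U'' (N j) (N 0)) s"
  let ?I = "\<lambda>os' s'. arr s' ''U'' j \<le> b \<and>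
    J (X \<union> (\<Union>a < arr s' ''U'' j. tuple_variants b j (u0(j := a)))) os' s' \<and>
    (\<forall>i>j. arr s' ''U'' i = u0 i)"
  have time: "(b * (T' + 10) + 4) + 3 \<le> (b + 1) ^ Suc j * (T + 20 * Suc j)"
  proof -
    have "b * (T' + 10) + 7 \<le> (b + 1) * T' + 20 * (b + 1)" by (simp add: algebra_simps)
    also have "\<dots> \<le> (b + 1) * T' + 20 * (b + 1) ^ Suc j"
      using power_increasing[of 1 "Suc j" "b + 1"] by (intro add_left_mono mult_left_mono) simp_all
    also have "\<dots> = (b + 1) ^ Suc j * (T + 20 * Suc j)"
      by (simp add: T'_def algebra_simps)
    finally show ?thesis by simp
  qed
  have "wp (While (Less (Arr ''U'' (N j)) (V ''n''))
      (Seq (tuples j c) (Store ''U'' (N j) (Plus (Arr ''U'' (N j)) (N 1)))))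
      (b * (T' + 10) + 4) (\<lambda>os' s'. J (X \<union> tuple_variants b (Suc j) (arr s ''U'')) os' s' \<and>
        (\<forall>i\<ge>Suc j. arr s' ''U'' i = arr s ''U'' i)) os ?s"
  proof (rule wp_While[where I = ?I and \<Phi> = "\<lambda>s'. (b - arr s' ''U'' j) * (T' + 10)" and T = "\<lambda>_. T' + 6"],
      goal_cases init body post time)
    case init
    then show ?case using J_upd[OF Suc.prems] by (simp add: u0_def)
  next
    case (body os' s')
    define a where "a = arr s' ''U'' j"
    define X' where "X' = X \<union> (\<Union>a' < a. tuple_variants b j (u0(j := a')))"
    have J: "J X' os' s'" using body(1) by (simp add: X'_def a_def)
    then have a: "a < b" using body(3) J_n by (simp add: a_def)
    have u: "arr s' ''U'' i = (u0(j := a)) i" if "i \<ge> j" for i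
      using body(1) that by (cases "i = j") (auto simp: a_def)
    have X'': "X' \<union> tuple_variants b j (arr s' ''U'') = X \<union> (\<Union>a' < Suc a. tuple_variants b j (u0(j := a')))"
    proof -
      have "tuple_variants b j (arr s' ''U'') = tuple_variants b j (u0(j := a))"
        by (rule tuple_variants_cong) (rule u)
      then show ?thesis by (auto simp: X'_def lessThan_Suc)
    qed
    have arith: "(b - Suc a) * (T' + 10) + (T' + 10) = (b - a) * (T' + 10)"
    proof -
      have "b - a = Suc (b - Suc a)" using a by simp
      then show ?thesis by simp
    qed
    show ?case
    proof (rule wp_Seq[where T = T' and T' = 6], rule wp_mono[OF Suc.IH[OF J]], goal_cases)
      case (2 os'' s'')
      have *: "arr s'' ''U'' i = (u0(j := a)) i" if "i \<ge> j" for i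
        using 2(1) u that by simp
      have "arr s'' ''U'' j = a" "\<forall>i>j. arr s'' ''U'' i = u0 i" using * by simp_all
      moreover have "J (X \<union> (\<Union>a' < Suc a. tuple_variants b j (u0(j := a')))) os'' s''"
        using 2(1) unfolding X'' by blast
      ultimately show ?case
        using J_upd[of _ os'' s'' j "Suc a"] arith a
        by (intro impI wp_straight) (simp_all add: X'' a_def[symmetric])
    qed (simp_all add: T'_def)
  next
    case (post os' s')
    then have "arr s' ''U'' j = b" using J_n by fastforce
    then show ?case
      using post by (simp add: tuple_variants_Suc u0_def)
  qed (use J_n Suc.prems in \<open>simp_all add: J_upd\<close>)
  then show ?case
    unfolding tuples.simps
    by (intro wp_Seq[where T = 3, OF _ time[unfolded add.commute[of _ 3]]] wp_straight) auto
qed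

section \<open>Correctness of the neighbour generator\<close>

context simple_graph_instance
begin

lemma build_spec:
  assumes "ready s" "var s ''a'' = e" "var s ''b'' = v"
  shows "wp (build (k - 1)) (m * (k * 30 + 150) + 5) (\<lambda>os' s'. os' = os \<and>
    bitset (arr s' ''B'') m = {f. f < m \<and> (f = e \<or> f \<in> bitset (arr s ''R'') m \<and>
      (v \<notin> ed f \<or> other v f \<in> arr s ''U'' ` {..<k - 1}))}) os s"
  unfolding build_def
proof (rule wp_For[where T = "k * 30 + 143" and I = "\<lambda>j os' s'. os' = os \<and>
    (\<forall>f<j. arr s' ''B'' f \<noteq> 0 \<longleftrightarrow> (f = e \<or> f \<in> bitset (arr s ''R'') m \<and>
      (v \<notin> ed f \<or> other v f \<in> arr s ''U'' ` {..<k - 1})))"], goal_cases init body post)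
  case (body j os' s')
  have j: "j < m" using assms(1) body(3) by (simp add: ready_def graph_input_def)
  have eqs: "var s' ''a'' = e" "var s' ''b'' = v" "arr s' ''R'' = arr s ''R''" "arr s' ''U'' = arr s ''U''"
    using body(2) assms by (simp_all add: frame_def)
  have I: "arr s' ''I'' (j + j + 3) = fst (G ! j)" "arr s' ''I'' (j + j + 4) = snd (G ! j)"
    using body(2) assms(1) j by (auto simp: frame_def ready_def graph_input_def)
  have keep: "bval (keep (k - 1)) s' \<longleftrightarrow> (j = e \<or> j \<in> bitset (arr s ''R'') m \<and>
      (v \<notin> ed j \<or> other v j \<in> arr s ''U'' ` {..<k - 1}))"
    using body(4) eqs I j by (auto simp: keep_def incident_def bitset_def ed_eq)
  have cost: "bcost (keep (k - 1)) \<le> k * 30 + 100"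
    by (simp add: keep_def incident_def bcost_member)
  show ?case
  proof (rule wp_straight, goal_cases)
    case 3
    with body(1,4) keep show ?case by (simp add: All_less_Suc)
  qed (use cost in simp_all)
next
  case (post os' s')
  then show ?case using assms(1) by (auto simp: bitset_def ready_def graph_input_def)
qed (use assms in \<open>auto simp: ready_def graph_input_def algebra_simps\<close>)

definition visit_time :: "nat \<Rightarrow> nat" where
  "visit_time T = m * (k * 30 + 150) + m * (n * 80 + m * 210 + 90) + T + 20"

lemma visit_spec:
  assumes "0 < k" "ready s" "var s ''a'' = e" "var s ''b'' = v" "e < m" "v \<in> ed e"
    and S: "S = bitset (arr s ''R'') m" "deg_ok S"
    and post: "\<And>s'. frame (Seq (build (k - 1)) (complete k)) s s' \<Longrightarrow>
      bitset (arr s' ''B'') m = greedy (candidate S e v (arr s ''U'')) m \<Longrightarrow> wp post T Q os s'"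
  shows "wp (visit k post) (visit_time T) Q os s"
  unfolding visit_def
proof (rule wp_Seq[where T' = "m * (n * 80 + m * 210 + 90) + T + 10"],
    rule wp_mono[OF build_spec[OF assms(2-4)] order.refl], goal_cases)
  case (1 os' s')
  have cand: "bitset (arr s' ''B'') m = candidate S e v (arr s ''U'')"
    using 1(1) \<open>e < m\<close> S(1) bitset_subset[of "arr s ''R''" m] by (auto simp: candidate_def)
  have Sm: "S \<subseteq> {..<m}" using S(1) bitset_subset by simp
  have rd: "ready s'" by (rule ready_frame[OF assms(2) 1(2)]) auto
  have ok: "deg_ok (bitset (arr s' ''B'') m)"
    unfolding cand using assms Sm by (intro candidate_deg_ok)
  show ?case
  proof (intro impI, rule wp_Seq[where T' = T], rule wp_mono[OF complete_spec[OF assms(1) rd ok] order.refl],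
      goal_cases)
    case (1 os'' s'')
    then show ?case
      using \<open>_ \<and> bitset (arr s' ''B'') m = _\<close> \<open>frame (build (k - 1)) s s'\<close> cand
      by (intro impI) (auto intro!: post simp: frame_def)
  qed simp
qed (simp add: visit_time_def)

lemma candidate_cong: "(\<And>i. i < k - 1 \<Longrightarrow> u i = u' i) \<Longrightarrow> candidate S e v u = candidate S e v u'"
proof -
  assume "\<And>i. i < k - 1 \<Longrightarrow> u i = u' i"
  then have "u ` {..<k - 1} = u' ` {..<k - 1}" by (intro image_cong) auto
  then show ?thesis by (simp add: candidate_def)
qed

text \<open>A candidate reads only the first \<open>k - 1\<close> entries, so what \<open>U\<close>
  contains beyond them is irrelevant.\<close>

lemma candidates_tuple_variants:
  "{greedy (candidate S e v u) m | u. u \<in> tuple_variants n (k - 1) u0} =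
   {greedy (candidate S e v u) m | u. \<forall>i < k - 1. u i < n}" (is "?L = ?R")
proof
  show "?L \<subseteq> ?R" by (auto simp: tuple_variants_def)
  show "?R \<subseteq> ?L"
  proof
    fix A assume "A \<in> ?R"
    then obtain u where u: "A = greedy (candidate S e v u) m" "\<forall>i < k - 1. u i < n" by blast
    let ?u = "\<lambda>i. if i < k - 1 then u i else u0 i"
    have "candidate S e v u = candidate S e v ?u" by (rule candidate_cong) simp
    moreover have "?u \<in> tuple_variants n (k - 1) u0" using u(2) by (simp add: tuple_variants_def)
    ultimately show "A \<in> ?L" using u(1) by auto
  qed
qed

definition expand_time :: "nat \<Rightarrow> nat" where
  "expand_time T = m * (2 * ((n + 1) ^ (k - 1) * (visit_time T + 20 * k)) + 60) + 10"

text \<open>\<open>K Y\<close> is the claim maintained by \<open>post\<close> once it has handled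
  the neighbours in \<open>Y\<close>. By \<open>K_cong\<close> it depends on the outputs and the
  search queue only, so building and completing candidates cannot disturb it.\<close>

lemma expand_spec:
  assumes k: "0 < k" and rd: "ready s" and S: "S = bitset (arr s ''R'') m" "deg_ok S"
    and wvars_post: "wvars post \<subseteq> {''g'', ''c'', ''tl''}" and warrs_post: "warrs post \<subseteq> {''D'', ''Q''}"
    and K_cong: "\<And>Y os s s'. K Y os s \<Longrightarrow> var s' ''tl'' = var s ''tl'' \<Longrightarrow> arr s' ''D'' = arr s ''D'' \<Longrightarrow>
      arr s' ''Q'' = arr s ''Q'' \<Longrightarrow> K Y os s'"
    and post: "\<And>Y os s. K Y os s \<Longrightarrow> ready s \<Longrightarrow> sol (bitset (arr s ''B'') m) \<Longrightarrow>
      wp post T (\<lambda>os' s'. K (insert (bitset (arr s ''B'') m) Y) os' s') os s"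
    and "K {} os s"
  shows "wp (expand k post) (expand_time T) (K (neighbours S)) os s"
proof -
  let ?nb = "\<lambda>e v U. {greedy (candidate S e v u) m | u. u \<in> U}"
  define all where "all e v = {greedy (candidate S e v u) m | u. \<forall>i < k - 1. u i < n}" for e v
  define J where "J e v Y X os' s' \<longleftrightarrow> K (Y \<union> ?nb e v X) os' s' \<and> ready s' \<and>
    arr s' ''R'' = arr s ''R'' \<and> var s' ''a'' = e \<and> var s' ''b'' = v" for e v Y X os' s'
  have Sm: "S \<subseteq> {..<m}" using S(1) bitset_subset by simp
  have side: "wp (tuples (k - 1) (visit k post)) ((n + 1) ^ (k - 1) * (visit_time T + 20 * k))
      (\<lambda>os'' s''. K (Y \<union> all e v) os'' s'' \<and> ready s'' \<and> arr s'' ''R'' = arr s ''R'' \<and> var s'' ''a'' = e) os' s'"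
    if J0: "J e v Y {} os' s'" and ev: "e < m" "v \<in> ed e" for e v Y os' s'
  proof -
    have "wp (tuples (k - 1) (visit k post)) ((n + 1) ^ (k - 1) * (visit_time T + 20 * (k - 1)))
      (\<lambda>os'' s''. J e v Y ({} \<union> tuple_variants n (k - 1) (arr s' ''U'')) os'' s'' \<and>
        (\<forall>i\<ge>k - 1. arr s'' ''U'' i = arr s' ''U'' i)) os' s'"
    proof (rule tuples_spec[where J = "J e v Y" and b = n and T = "visit_time T"], goal_cases body upd n U init)
      case (body X os1 s1)
      then have s1: "K (Y \<union> ?nb e v X) os1 s1" "ready s1" "arr s1 ''R'' = arr s ''R''"
          "var s1 ''a'' = e" "var s1 ''b'' = v"
        by (simp_all add: J_def)
      show ?case
      proof (rule visit_spec[OF k s1(2,4,5) ev, where S = S and T = T], goal_cases)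
        case (3 s2)
        let ?A = "greedy (candidate S e v (arr s1 ''U'')) m"
        have s2: "K (Y \<union> ?nb e v X) os1 s2"
          using 3(1) by (intro K_cong[OF s1(1)]) (simp_all add: frame_def)
        have rd2: "ready s2" by (rule ready_frame[OF s1(2) 3(1)]) auto
        have A: "bitset (arr s2 ''B'') m = ?A" by (rule 3(2))
        have "sol ?A"
          using candidate_deg_ok[OF Sm S(2) ev k] candidate_subset[OF Sm ev(1)] by (intro sol_greedy)
        with A have "wp post T (K (insert ?A (Y \<union> ?nb e v X))) os1 s2"
          using post[OF s2 rd2] by simp
        then show ?case
        proof (rule wp_mono, goal_cases)
          case (2 os3 s3)
          have "ready s3"
            by (rule ready_frame[OF rd2 2(2)]) (use wvars_post warrs_post in auto)
          moreover have "insert ?A (Y \<union> ?nb e v X) = Y \<union> ?nb e v (insert (arr s1 ''U'') X)" by blast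
          moreover have "arr s3 ''R'' = arr s ''R''" "var s3 ''a'' = e" "var s3 ''b'' = v"
          proof -
            have "''R'' \<notin> warrs post" "''a'' \<notin> wvars post" "''b'' \<notin> wvars post"
              using wvars_post warrs_post by auto
            moreover have "arr s2 ''R'' = arr s1 ''R''" "var s2 ''a'' = var s1 ''a''" "var s2 ''b'' = var s1 ''b''"
              using 3(1) by (simp_all add: frame_def)
            ultimately show "arr s3 ''R'' = arr s ''R''" "var s3 ''a'' = e" "var s3 ''b'' = v"
              using frame_arr[OF 2(2), of "''R''"] frame_var[OF 2(2), of "''a''"]
                frame_var[OF 2(2), of "''b''"] s1(3-5) by simp_all
          qed
          ultimately show ?case using 2(1) by (simp add: J_def)
        qed simp
      qed (use S s1 in simp_all)
    next
      case (upd X os1 s1 i x)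
      then have "K (Y \<union> ?nb e v X) os1 s1" by (simp add: J_def)
      then have "K (Y \<union> ?nb e v X) os1 (s1\<lparr>arr := (arr s1)(''U'' := (arr s1 ''U'')(i := x))\<rparr>)"
        by (rule K_cong) simp_all
      with upd show ?case
        by (simp add: J_def ready_def graph_input_def adjacency_lists_def)
    next
      case (n X os1 s1)
      then show ?case by (simp add: J_def ready_def graph_input_def)
    next
      case U
      then show ?case using warrs_post by auto
    next
      case init
      show ?case by (rule J0)
    qed
    then show ?thesis
      by (rule wp_mono) (simp_all add: J_def candidates_tuple_variants[simplified] all_def)
  qed
  have "neighbours S = (\<Union>e<m. \<Union>v\<in>ed e. all e v)"
    unfolding neighbours_def all_def by blast
  also have "\<dots> = (\<Union>e<m. all e (fst (G ! e)) \<union> all e (snd (G ! e)))"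
    by (intro SUP_cong) (auto simp: ed_eq)
  finally have all_nb: "neighbours S = (\<Union>e<m. all e (fst (G ! e)) \<union> all e (snd (G ! e)))" .
  let ?t = "(n + 1) ^ (k - 1) * (visit_time T + 20 * k)"
  let ?Y = "\<lambda>j. \<Union>e<j. all e (fst (G ! e)) \<union> all e (snd (G ! e))"
  show ?thesis
    unfolding expand_def
  proof (rule wp_For[where T = "2 * ?t + 40" and I = "\<lambda>j os' s'. K (?Y j) os' s' \<and> ready s' \<and>
      arr s' ''R'' = arr s ''R''"], goal_cases init body post)
    case init
    have "K {} os (s\<lparr>var := (var s)(''a'' := 0)\<rparr>)"
      using \<open>K {} os s\<close> by (rule K_cong) simp_all
    then show ?case using rd by (simp add: ready_def graph_input_def adjacency_lists_def)
  next
    case (body j os' s')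
    have j: "j < m" using rd body(3) by (simp add: ready_def graph_input_def)
    have I: "aval (fst_end (V ''a'')) s'' = fst (G ! j)" "aval (snd_end (V ''a'')) s'' = snd (G ! j)"
      if "ready s''" "var s'' ''a'' = j" for s''
      using that j by (simp_all add: ready_def graph_input_def)
    have J: "J j x Y {} os'' (s''\<lparr>var := (var s'')(''b'' := x)\<rparr>)"
      if "K Y os'' s''" "ready s''" "arr s'' ''R'' = arr s ''R''" "var s'' ''a'' = j" for x Y os'' s''
    proof -
      have "K Y os'' (s''\<lparr>var := (var s'')(''b'' := x)\<rparr>)" using that(1) by (rule K_cong) simp_all
      then show ?thesis using that by (simp add: J_def ready_def graph_input_def adjacency_lists_def)
    qed
    have fs: "fst (G ! j) \<in> ed j" "snd (G ! j) \<in> ed j" using j by (simp_all add: ed_eq)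
    show ?case
    proof (rule wp_Seq[where T = 10 and T' = "2 * ?t + 20"], rule wp_straight, goal_cases)
      case 3
      have J1: "J j (fst (G ! j)) (?Y j) {} os' (sem (Assign ''b'' (fst_end (V ''a''))) s')"
        using J[of "?Y j" os' s'] body(1,4) I by simp
      show ?case
      proof (intro impI, rule wp_Seq[where T = ?t and T' = "?t + 20"],
          rule wp_mono[OF side[OF J1 j fs(1)]], goal_cases)
        case (2 os2 s2)
        show ?case
        proof (intro impI, rule wp_Seq[where T = 10 and T' = ?t], rule wp_straight, goal_cases)
          case 3
          have J2: "J j (snd (G ! j)) (?Y j \<union> all j (fst (G ! j))) {} os2 (sem (Assign ''b'' (snd_end (V ''a''))) s2)"
            using J[of _ os2 s2] 2(2) I by simp
          show ?case
          proof (intro impI, rule wp_mono[OF side[OF J2 j fs(2)]], goal_cases)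
            case (2 os3 s3)
            have Y: "?Y (Suc j) = ?Y j \<union> all j (fst (G ! j)) \<union> all j (snd (G ! j))"
              by (auto simp: lessThan_Suc)
            have "K (?Y (Suc j)) os3 (s3\<lparr>var := (var s3)(''a'' := Suc j)\<rparr>)"
              unfolding Y using 2(2) by (intro K_cong[OF conjunct1[OF 2(2)]]) simp_all
            then show ?case
              using 2(2) by (simp add: ready_def graph_input_def adjacency_lists_def)
          qed simp
        qed auto
      qed auto
    qed auto
  next
    case (post os' s')
    then show ?case using rd by (simp add: all_nb ready_def graph_input_def)
  qed (use rd wvars_post in \<open>auto simp: ready_def graph_input_def expand_time_def algebra_simps\<close>)
qed

end

section \<open>Input and output of solutions\<close>

definition emit_set_loop :: "vname \<Rightarrow> com" where
  "emit_set_loop x = While (Less (V ''g'') (V ''m''))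
    (Seq (Cond (Eq (Arr x (V ''g'')) (N 0)) SKIP (Emit (V ''g''))) (incr ''g''))"

definition emit_set :: "vname \<Rightarrow> com" where
  "emit_set x = Seq (Assign ''g'' (N 0)) (Seq (emit_set_loop x) Finish)"

lemma writes_emit_set [simp]: "wvars (emit_set x) = {''g''}" "warrs (emit_set x) = {}"
  by (auto simp: emit_set_def emit_set_loop_def)

text \<open>A half-written object has no description by \<open>behaves\<close>, hence none by
  \<open>wp\<close>, so the run is exhibited with its trace. Starting from an arbitrary value of
  \<open>g\<close> is what the induction needs.\<close>

lemma exec_emit_set_loop:
  "\<exists>t s'. exec (emit_set_loop x) s t s' \<and> End \<notin> set t \<and>
    emitted t = filter (\<lambda>j. arr s x j \<noteq> 0) [var s ''g''..<var s ''m''] \<and>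
    length t \<le> (var s ''m'' - var s ''g'') * 20 + 3"
proof (induction "var s ''m'' - var s ''g''" arbitrary: s)
  case 0
  then have "exec (emit_set_loop x) s (ticks 3) s"
    unfolding emit_set_loop_def
    using exec.WhileFalse[of "Less (V ''g'') (V ''m'')" s] by (simp add: numeral_eq_Suc)
  with 0 show ?case by (intro exI[of _ "ticks 3"] exI[of _ s]) simp
next
  case (Suc d)
  let ?c = "Cond (Eq (Arr x (V ''g'')) (N 0)) SKIP (Emit (V ''g''))"
  let ?s = "s\<lparr>var := (var s)(''g'' := Suc (var s ''g''))\<rparr>"
  obtain t s' where t: "exec (emit_set_loop x) ?s t s'" "End \<notin> set t"
      "emitted t = filter (\<lambda>j. arr s x j \<noteq> 0) [Suc (var s ''g'')..<var s ''m'']"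
      "length t \<le> (var s ''m'' - Suc (var s ''g'')) * 20 + 3"
  proof -
    have "d = var ?s ''m'' - var ?s ''g''" using Suc.hyps(2) by simp
    from Suc.hyps(1)[OF this] show ?thesis using that by auto
  qed
  define w where "w = ticks 4 @ (if arr s x (var s ''g'') = 0 then [Tick] else [Tick, Out (var s ''g'')])"
  have "exec ?c s w s"
  proof (cases "arr s x (var s ''g'') = 0")
    case True
    then show ?thesis using exec.CondTrue[OF _ exec.Skip, of "Eq (Arr x (V ''g'')) (N 0)" s]
      by (simp add: w_def numeral_eq_Suc)
  next
    case False
    then show ?thesis using exec.CondFalse[OF _ exec.Emit[of "V ''g''" s], of "Eq (Arr x (V ''g'')) (N 0)"]
      by (simp add: w_def numeral_eq_Suc)
  qed
  moreover have "exec (incr ''g'') s (ticks 4) ?s"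
    using exec.Assign[of "''g''" "Plus (V ''g'') (N 1)" s] by (simp add: numeral_eq_Suc)
  ultimately have step: "exec (Seq ?c (incr ''g'')) s (w @ ticks 4) ?s" by (rule exec.Seq)
  have lt: "var s ''g'' < var s ''m''" using Suc.hyps(2) by linarith
  then have "exec (emit_set_loop x) s (ticks (bcost (Less (V ''g'') (V ''m''))) @ (w @ ticks 4) @ t) s'"
    unfolding emit_set_loop_def
    by (intro exec.WhileTrue[OF _ step t(1)[unfolded emit_set_loop_def]]) simp
  then have "exec (emit_set_loop x) s (ticks 3 @ (w @ ticks 4) @ t) s'" by (simp add: numeral_eq_Suc)
  moreover have "length (ticks 3 @ (w @ ticks 4) @ t) \<le> (var s ''m'' - var s ''g'') * 20 + 3"
  proof -
    have "var s ''m'' - var s ''g'' = Suc (var s ''m'' - Suc (var s ''g''))" using lt by simp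
    moreover have "length w \<le> 6" by (simp add: w_def)
    ultimately show ?thesis using t(4) by simp
  qed
  moreover have "emitted (ticks 3 @ (w @ ticks 4) @ t) = filter (\<lambda>j. arr s x j \<noteq> 0) [var s ''g''..<var s ''m'']"
    using t(3) lt by (simp add: emitted_append w_def upt_conv_Cons)
  moreover have "End \<notin> set (ticks 3 @ (w @ ticks 4) @ t)" using t(2) by (auto simp: w_def)
  ultimately show ?case by blast
qed

lemma exec_emit_set:
  "\<exists>t s'. exec (emit_set x) s (t @ [End]) s' \<and> End \<notin> set t \<and>
    emitted t = filter (\<lambda>j. arr s x j \<noteq> 0) [0..<var s ''m''] \<and> length t \<le> var s ''m'' * 20 + 5"
proof -
  let ?s = "s\<lparr>var := (var s)(''g'' := 0)\<rparr>"
  obtain t s' where t: "exec (emit_set_loop x) ?s t s'" "End \<notin> set t"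
      "emitted t = filter (\<lambda>j. arr s x j \<noteq> 0) [0..<var s ''m'']" "length t \<le> var s ''m'' * 20 + 3"
    using exec_emit_set_loop[of x ?s] by auto
  have "exec (Assign ''g'' (N 0)) s (ticks 2) ?s"
    using exec.Assign[of "''g''" "N 0" s] by (simp add: numeral_eq_Suc)
  then have "exec (emit_set x) s (ticks 2 @ t @ [End]) s'"
    unfolding emit_set_def by (rule exec.Seq[OF _ exec.Seq[OF t(1) exec.Finish]])
  with t show ?thesis
    by (intro exI[of _ "ticks 2 @ t"] exI[of _ s']) (auto simp: emitted_append)
qed

definition read_solution :: com where
  "read_solution = Seq (Assign ''l'' (Arr ''S'' (N 0)))
    (For ''i'' ''l'' (Store ''R'' (Arr ''S'' (Plus (V ''i'') (N 1))) (N 1)))"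

definition encode_bits :: com where
  "encode_bits = Seq (Assign ''c'' (N 0)) (For ''g'' ''m'' (Cond (Eq (Arr ''B'' (V ''g'')) (N 0)) SKIP
    (Assign ''c'' (Plus (V ''c'') (Arr ''W'' (V ''g''))))))"

text \<open>Codes can be almost as large as \<open>2 ^ m\<close>, but access to any array cell costs
  one step.\<close>

definition enqueue :: com where
  "enqueue = Cond (Eq (Arr ''D'' (V ''c'')) (N 0))
    (Seq (Store ''D'' (V ''c'') (N 1)) (Seq (Store ''Q'' (V ''tl'') (V ''c'')) (incr ''tl''))) SKIP"

definition save :: com where
  "save = Seq encode_bits enqueue"

text \<open>Without division, the bits are read from the top by comparison with a power of 2 and
  subtraction.\<close>

definition load :: com where
  "load = Seq (Assign ''c'' (Arr ''Q'' (V ''hd''))) (For ''g'' ''m''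
    (Seq (Assign ''i'' (Minus (Minus (V ''m'') (V ''g'')) (N 1)))
      (Cond (Less (V ''c'') (Arr ''W'' (V ''i''))) (Store ''R'' (V ''i'') (N 0))
        (Seq (Store ''R'' (V ''i'') (N 1)) (Assign ''c'' (Minus (V ''c'') (Arr ''W'' (V ''i''))))))))"

lemma writes_save_load [simp]:
  "wvars read_solution = {''l'', ''i''}" "warrs read_solution = {''R''}"
  "wvars encode_bits = {''c'', ''g''}" "warrs encode_bits = {}"
  "wvars save = {''c'', ''g'', ''tl''}" "warrs save = {''D'', ''Q''}"
  "wvars load = {''c'', ''g'', ''i''}" "warrs load = {''R''}"
  by (auto simp: read_solution_def encode_bits_def enqueue_def save_def load_def)

text \<open>All bits below \<open>i\<close> together stay below \<open>2 ^ i\<close>, so one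
  comparison decides bit \<open>i\<close> once the higher ones are gone.\<close>

lemma set_encode_less: "B \<subseteq> {..<i} \<Longrightarrow> set_encode B < 2 ^ i"
proof (induction i arbitrary: B)
  case (Suc i)
  have fin: "finite B" using Suc.prems finite_subset by blast
  have "set_encode (B - {i}) < 2 ^ i"
    using Suc.prems by (intro Suc.IH) (auto simp: less_Suc_eq subset_iff)
  moreover have "set_encode B \<le> 2 ^ i + set_encode (B - {i})"
  proof (cases "i \<in> B")
    case True
    then have "set_encode B = set_encode (insert i (B - {i}))" by (simp add: insert_absorb)
    also have "\<dots> = 2 ^ i + set_encode (B - {i})" using fin by (intro set_encode_insert) auto
    finally show ?thesis by simp
  qed simp
  ultimately show ?case by simp
qed simp

lemma set_encode_Int_Suc:
  "set_encode (A \<inter> {..<Suc i}) = (if i \<in> A then 2 ^ i else 0) + set_encode (A \<inter> {..<i})"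
proof -
  have "A \<inter> {..<Suc i} = (if i \<in> A then insert i (A \<inter> {..<i}) else A \<inter> {..<i})"
    by (auto simp: less_Suc_eq)
  then show ?thesis by simp
qed

section \<open>Correctness of reading, writing and coding solutions\<close>

context simple_graph_instance
begin

definition listing :: "nat set \<Rightarrow> nat list" where
  "listing A = filter (\<lambda>j. j \<in> A) [0..<m]"

lemma represents_listing: "A \<subseteq> {..<m} \<Longrightarrow> represents (edge_list G) (listing A) (ed ` A)"
  by (auto simp: represents_def listing_def)

lemma listing_bitset: "filter (\<lambda>j. a j \<noteq> 0) [0..<m] = listing (bitset a m)"
  unfolding listing_def by (rule filter_cong) (auto simp: bitset_def)

lemma emit_set_spec:
  assumes "var s ''m'' = m"
  shows "wp (emit_set x) (m * 20 + 6) (\<lambda>os' s'. os' = os @ [listing (bitset (arr s x) m)]) os s"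
proof -
  obtain t s' where "exec (emit_set x) s (t @ [End]) s'" "End \<notin> set t"
      "emitted t = listing (bitset (arr s x) m)" "length t \<le> m * 20 + 5"
    using exec_emit_set[of x s] assms listing_bitset[of "arr s x"] by auto
  moreover from this have "behaves (t @ [End]) [listing (bitset (arr s x) m)]"
    using behaves_append_End[of t] by simp
  ultimately show ?thesis
    unfolding wp_def
    by (intro exI[of _ "t @ [End]"] exI[of _ s'] exI[of _ "[listing (bitset (arr s x) m)]"]) simp
qed

lemma read_solution_spec:
  assumes "arr s ''S'' = array_of xs" "set xs \<subseteq> {..<m}" "distinct xs" "arr s ''R'' = (\<lambda>_. 0)"
  shows "wp read_solution (m * 20 + 20) (\<lambda>os' s'. os' = os \<and> bitset (arr s' ''R'') m = set xs) os s"
  unfolding read_solution_def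
proof (rule wp_Seq[where T = 3 and T' = "m * 20 + 10"], rule wp_straight, goal_cases)
  case 3
  have len: "length xs \<le> m"
    using assms(2,3) card_mono[of "{..<m}" "set xs"] by (simp add: distinct_card)
  have 0: "array_of xs 0 = length xs" by (simp add: array_of_def)
  show ?case
  proof (intro impI, rule wp_For[where T = 6 and I = "\<lambda>i os' s'. os' = os \<and>
      bitset (arr s' ''R'') m = set (take i xs)"], goal_cases init body post)
    case init
    then show ?case using assms by (simp add: bitset_def)
  next
    case (body i os' s')
    have i: "i < length xs" using body(4) assms(1) 0 by simp
    have "xs ! i \<in> {..<m}" using assms(2) nth_mem[OF i] by blast
    moreover have "arr s' ''S'' (Suc i) = xs ! i"
      using body(3) assms(1) i by (simp add: frame_def array_of_def)
    ultimately have x: "arr s' ''S'' (Suc i) = xs ! i" "xs ! i < m" by simp_all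
    then show ?case
      using body(2,5) i by (intro wp_straight) (simp_all add: bitset_upd take_Suc_conv_app_nth)
  next
    case (post os' s')
    then show ?case using assms(1) 0 by simp
  qed (use len assms(1) 0 in simp_all)
qed auto

lemma encode_bits_spec:
  assumes "ready s"
  shows "wp encode_bits (m * 30 + 10) (\<lambda>os' s'. os' = os \<and>
    var s' ''c'' = set_encode (bitset (arr s ''B'') m)) os s"
  unfolding encode_bits_def
proof (rule wp_Seq[where T = 2 and T' = "m * 30 + 8"], rule wp_straight, goal_cases)
  case 3
  let ?A = "bitset (arr s ''B'') m"
  show ?case
  proof (intro impI, rule wp_For[where T = 23 and I = "\<lambda>g os' s'. os' = os \<and>
      var s' ''c'' = set_encode (?A \<inter> {..<g})"], goal_cases init body post)
    case (body g os' s')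
    have g: "g < m" using body(4) assms by (simp add: ready_def graph_input_def)
    have "arr s' ''W'' g = 2 ^ g" "arr s' ''B'' g = 0 \<longleftrightarrow> g \<notin> ?A"
      using body(3) assms g by (auto simp: frame_def ready_def bitset_def)
    then show ?case
      using body(2,5) by (intro wp_straight) (simp_all add: set_encode_Int_Suc)
  next
    case (post os' s')
    then show ?case
      using assms bitset_subset[of "arr s ''B''" m] by (simp add: ready_def graph_input_def Int_absorb2)
  qed (use assms in \<open>auto simp: ready_def graph_input_def\<close>)
qed auto

text \<open>Positions before \<open>hd\<close> are not discarded: \<open>qs\<close> lists everything
  found so far in the order of discovery, so \<open>D\<close> can be described by membership in
  \<open>qs\<close>.\<close>

definition queued :: "nat set list \<Rightarrow> state \<Rightarrow> bool" where
  "queued qs s \<longleftrightarrow> distinct qs \<and> (\<forall>A \<in> set qs. A \<subseteq> {..<m}) \<and> var s ''tl'' = length qs \<and>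
    (\<forall>i < length qs. arr s ''Q'' i = set_encode (qs ! i)) \<and>
    (\<forall>A. A \<subseteq> {..<m} \<longrightarrow> (arr s ''D'' (set_encode A) \<noteq> 0 \<longleftrightarrow> A \<in> set qs))"

lemma queued_cong:
  "queued qs s \<Longrightarrow> var s' ''tl'' = var s ''tl'' \<Longrightarrow> arr s' ''D'' = arr s ''D'' \<Longrightarrow>
    arr s' ''Q'' = arr s ''Q'' \<Longrightarrow> queued qs s'"
  by (simp add: queued_def)

lemma set_encode_inject: "A \<subseteq> {..<m} \<Longrightarrow> B \<subseteq> {..<m} \<Longrightarrow> set_encode A = set_encode B \<longleftrightarrow> A = B"
  by (rule set_encode_eq) (simp_all add: finite_subset[of _ "{..<m}"])

lemma save_spec:
  assumes "ready s" "queued qs s" and A: "A = bitset (arr s ''B'') m"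
  shows "wp save (m * 30 + 50) (\<lambda>os' s'. os' = os \<and>
    queued (if A \<in> set qs then qs else qs @ [A]) s') os s"
  unfolding save_def
proof (rule wp_Seq[where T' = 30], rule wp_mono[OF encode_bits_spec[OF assms(1)] order.refl], goal_cases)
  case (1 os' s')
  have Am: "A \<subseteq> {..<m}" using A bitset_subset by simp
  have c: "var s' ''c'' = set_encode A" "os' = os" using 1(1) A by simp_all
  have "queued qs s'" by (rule queued_cong[OF assms(2)]) (use 1(2) in \<open>auto simp: frame_def\<close>)
  then have q: "distinct qs" "\<And>A. A \<in> set qs \<Longrightarrow> A \<subseteq> {..<m}" "var s' ''tl'' = length qs"
      "\<And>i. i < length qs \<Longrightarrow> arr s' ''Q'' i = set_encode (qs ! i)"
      "\<And>A. A \<subseteq> {..<m} \<Longrightarrow> 0 < arr s' ''D'' (set_encode A) \<longleftrightarrow> A \<in> set qs"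
    by (auto simp: queued_def)
  show ?case
    unfolding enqueue_def
  proof (intro impI, rule wp_straight, goal_cases)
    case 3
    show ?case
    proof (cases "A \<in> set qs")
      case True
      then show ?thesis using c q(5)[OF Am] \<open>queued qs s'\<close> by simp
    next
      case False
      have "queued (qs @ [A]) (s'\<lparr>arr := (arr s')(''D'' := (arr s' ''D'')(set_encode A := Suc 0),
          ''Q'' := (arr s' ''Q'')(length qs := set_encode A)),
          var := (var s')(''tl'' := Suc (length qs))\<rparr>)"
        unfolding queued_def
      proof (intro conjI allI impI ballI, goal_cases)
        case (4 i)
        then show ?case using q(4) by (simp add: nth_append)
      next
        case (5 B)
        then show ?case using q(5)[OF 5] Am by (simp add: set_encode_inject)
      qed (use False q(1,2) Am in auto)
      then show ?thesis using False c q(3) q(5)[OF Am] by simp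
    qed
  qed auto
qed auto

lemma load_spec:
  assumes "ready s" "queued qs s" "var s ''hd'' < length qs"
  shows "wp load (m * 50 + 20) (\<lambda>os' s'. os' = os \<and> bitset (arr s' ''R'') m = qs ! var s ''hd'') os s"
  unfolding load_def
proof (rule wp_Seq[where T = 3 and T' = "m * 50 + 10"], rule wp_straight, goal_cases)
  case 3
  define A where "A = qs ! var s ''hd''"
  have Am: "A \<subseteq> {..<m}" using assms(2,3) by (simp add: queued_def A_def)
  have Q: "arr s ''Q'' (var s ''hd'') = set_encode A" using assms(2,3) by (simp add: queued_def A_def)
  have m: "var s ''m'' = m" using assms(1) by (simp add: ready_def graph_input_def)
  show ?case
    unfolding A_def[symmetric]
  \<comment> \<open>After \<open>g\<close> rounds the top \<open>g\<close> bits are known and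
    \<open>c\<close> is the code of the rest.\<close>
  proof (intro impI, rule wp_For[where T = 40 and I = "\<lambda>g os' s'. os' = os \<and>
      var s' ''c'' = set_encode (A \<inter> {..<m - g}) \<and>
      (\<forall>j. m - g \<le> j \<and> j < m \<longrightarrow> (arr s' ''R'' j \<noteq> 0 \<longleftrightarrow> j \<in> A))"], goal_cases init body post)
    case init
    then show ?case using Q Am by (auto simp: Int_absorb2)
  next
    case (body g os' s')
    define i where "i = m - Suc g"
    have g: "g < m" using body(4) m by simp
    then have i: "m - g = Suc i" "i < m" "m - g - 1 = i" by (auto simp: i_def)
    have eqs: "arr s' ''W'' i = 2 ^ i" "var s' ''m'' = m"
      using body(3) assms(1) i m by (auto simp: frame_def ready_def)
    have c: "var s' ''c'' = (if i \<in> A then 2 ^ i else 0) + set_encode (A \<inter> {..<i})"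
      using body(2) i(1) by (simp add: set_encode_Int_Suc)
    have less: "set_encode (A \<inter> {..<i}) < 2 ^ i" by (rule set_encode_less) auto
    have R: "\<And>j. Suc i \<le> j \<Longrightarrow> j < m \<Longrightarrow> 0 < arr s' ''R'' j \<longleftrightarrow> j \<in> A"
      using body(2) i(1) by auto
    have R': "\<forall>j. i \<le> j \<and> j < m \<longrightarrow> (((arr s' ''R'')(i := x)) j \<noteq> 0 \<longleftrightarrow> j \<in> A)" if "x \<noteq> 0 \<longleftrightarrow> i \<in> A" for x
    proof (intro allI impI)
      fix j assume j: "i \<le> j \<and> j < m"
      show "((arr s' ''R'')(i := x)) j \<noteq> 0 \<longleftrightarrow> j \<in> A"
        using that R[of j] j by (cases "j = i") auto
    qed
    have idx: "m - g - Suc 0 = i" "m - Suc g = i" by (simp_all add: i_def)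
    show ?case
    proof (rule wp_straight, goal_cases)
      case 3
      show ?case
      proof (cases "i \<in> A")
        case True
        with c less eqs idx body(2,5) R'[of 1] show ?thesis by simp
      next
        case False
        with c less eqs idx body(2,5) R'[of 0] show ?thesis by simp
      qed
    qed auto
  next
    case (post os' s')
    then show ?case using m Am by (auto simp: bitset_def)
  qed (use m in auto)
qed auto

end

section \<open>Breadth-first search\<close>

definition find_solution :: "nat \<Rightarrow> com" where
  "find_solution k = Seq preprocess (Seq (complete k) (emit_set ''B''))"

definition list_neighbours :: "nat \<Rightarrow> com" where
  "list_neighbours k = Seq preprocess (Seq read_solution (expand k (emit_set ''B'')))"

definition process :: "nat \<Rightarrow> com" where
  "process k = Seq load (Seq (incr ''hd'') (expand k save))"

text \<open>Expansion overwrites \<open>B\<close> but not \<open>R\<close>, so the solution can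
  still be written from \<open>R\<close> afterwards. Each iteration outputs exactly one solution, so
  apart from the preparation its running time is the delay.\<close>

definition search :: "nat \<Rightarrow> com" where
  "search k = While (Less (V ''hd'') (V ''tl'')) (Seq (process k) (emit_set ''R''))"

definition enumerate :: "nat \<Rightarrow> com" where
  "enumerate k = Seq (Seq preprocess (Seq (complete k) save)) (search k)"

text \<open>Appending an \<open>End\<close> would reveal any letters that \<open>t\<close> has left
  pending.\<close>

lemma emitted_quiet: "behaves t [] \<Longrightarrow> emitted t = []"
proof -
  assume t: "behaves t []"
  then have "behaves (t @ [End]) [emitted t]" by (intro behaves_append_End no_End)
  then have "outputs (t @ [End]) = [emitted t]" by (rule outputs_eq)
  moreover have "outputs (t @ [End]) = [[]]"
    using t by (simp add: behaves_def outputs_def)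
  ultimately show ?thesis by simp
qed

lemma segments_pieces:
  "\<forall>p \<in> set ps. End \<notin> set p \<Longrightarrow> End \<notin> set r \<Longrightarrow>
    segments (concat (map (\<lambda>p. p @ [End]) ps) @ r) = map (\<lambda>p. p @ [End]) ps @ [r]"
  by (induction ps) (simp_all add: segments_no_End segments_append_End)

lemma outputs_pieces:
  assumes "\<forall>p \<in> set ps. End \<notin> set p" "End \<notin> set r"
  shows "outputs (concat (map (\<lambda>p. p @ [End]) ps) @ r) = map emitted ps"
  unfolding outputs_def segments_pieces[OF assms] by (simp add: emitted_append)

lemma delay_pieces_le:
  assumes "\<forall>p \<in> set ps. End \<notin> set p \<and> length p \<le> b" "End \<notin> set r" "length r \<le> b"
  shows "delay (concat (map (\<lambda>p. p @ [End]) ps) @ r) \<le> b + 1"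
proof -
  have "\<forall>p \<in> set ps. End \<notin> set p" using assms(1) by blast
  note segments = segments_pieces[OF this assms(2)]
  show ?thesis
    unfolding delay_def segments using assms by (intro Max.boundedI) auto
qed

lemma initial_simps [simp]:
  "var (initial xs ys) = (\<lambda>_. 0)" "arr (initial xs ys) ''I'' = array_of xs"
  "arr (initial xs ys) ''S'' = array_of ys"
  "x \<noteq> ''I'' \<Longrightarrow> x \<noteq> ''S'' \<Longrightarrow> arr (initial xs ys) x = (\<lambda>_. 0)"
  by (auto simp: initial_def)

section \<open>Correctness and delay of the search\<close>

context simple_graph_instance
begin

abbreviation "start ys \<equiv> initial (encode (degenerate_subgraph_listing k) G) ys"

definition preprocess_time :: nat where
  "preprocess_time = n * (m * 50 + 30) + m * 20 + 40"

definition complete_time :: nat where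
  "complete_time = m * (n * 80 + m * 210 + 90) + 10"

lemma preprocess_start:
  "wp preprocess preprocess_time (\<lambda>os' s'. os' = os \<and> ready s' \<and>
    (\<forall>x. x \<notin> {''I'', ''S'', ''A'', ''P'', ''Z'', ''W''} \<longrightarrow> arr s' x = (\<lambda>_. 0)) \<and>
    arr s' ''S'' = array_of ys \<and> var s' ''hd'' = 0 \<and> var s' ''tl'' = 0) os (start ys)"
  unfolding preprocess_time_def
  by (rule wp_mono[OF preprocess_spec]) (auto simp: frame_def)

lemma first_spec:
  assumes "0 < k" "ready s" "arr s ''B'' = (\<lambda>_. 0)"
  shows "wp (complete k) complete_time (\<lambda>os' s'. os' = os \<and> ready s' \<and> sol (bitset (arr s' ''B'') m)) os s"
proof -
  have "bitset (arr s ''B'') m = {}" using assms(3) by (simp add: bitset_def)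
  then show ?thesis
    unfolding complete_time_def
    using wp_mono[OF complete_spec[OF assms(1,2)] order.refl] ready_frame[OF assms(2)] sol_greedy[of "{}"]
    by simp
qed

lemma find_solution_spec:
  assumes "0 < k"
  shows "\<exists>t s' A. exec (find_solution k) (start ys) t s' \<and>
    length t \<le> preprocess_time + complete_time + m * 20 + 6 \<and> outputs t = [listing A] \<and> sol A"
proof -
  have "wp (find_solution k) (preprocess_time + (complete_time + (m * 20 + 6)))
      (\<lambda>os' s'. \<exists>A. os' = [listing A] \<and> sol A) [] (start ys)"
    unfolding find_solution_def
  proof (rule wp_Seq[OF _ order.refl], rule wp_mono[OF preprocess_start order.refl], goal_cases)
    case (1 os' s')
    then have s': "os' = []" "ready s'" "arr s' ''B'' = (\<lambda>_. 0)" by simp_all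
    show ?case
    proof (intro impI, rule wp_Seq[OF _ order.refl],
        rule wp_mono[OF first_spec[OF assms s'(2,3)] order.refl], goal_cases)
      case (1 os'' s'')
      then show ?case
        using s'(1) by (intro impI wp_mono[OF emit_set_spec]) (auto simp: ready_def graph_input_def)
    qed
  qed
  then obtain t s' A where "exec (find_solution k) (start ys) t s'" "behaves t [listing A]" "sol A"
      "length t \<le> preprocess_time + (complete_time + (m * 20 + 6))"
    unfolding wp_def by auto
  then show ?thesis using outputs_eq by (intro exI[of _ t] exI[of _ s'] exI[of _ A]) simp
qed

lemma list_neighbours_spec:
  assumes "0 < k" "sol S" "set xs = S" "distinct xs"
  shows "\<exists>t s' As. exec (list_neighbours k) (start xs) t s' \<and>
    length t \<le> preprocess_time + m * 20 + 20 + expand_time (m * 20 + 6) \<and>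
    outputs t = map listing As \<and> set As = neighbours S"
proof -
  \<comment> \<open>Different guesses may lead to the same neighbour, which is then output
    repeatedly; only the set of outputs matters.\<close>
  let ?K = "\<lambda>Y os s. \<exists>As. os = map listing As \<and> set As = Y"
  have "wp (list_neighbours k) (preprocess_time + ((m * 20 + 20) + expand_time (m * 20 + 6)))
      (?K (neighbours S)) [] (start xs)"
    unfolding list_neighbours_def
  proof (rule wp_Seq[OF _ order.refl], rule wp_mono[OF preprocess_start order.refl], goal_cases)
    case (1 os' s')
    then have s': "os' = []" "ready s'" "arr s' ''R'' = (\<lambda>_. 0)" "arr s' ''S'' = array_of xs" by simp_all
    have "set xs \<subseteq> {..<m}" using assms(2,3) sol_subset by simp
    note read = read_solution_spec[OF s'(4) this assms(4) s'(3)]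
    show ?case
    proof (intro impI, rule wp_Seq[OF _ order.refl], rule wp_mono[OF read order.refl], goal_cases)
      case (1 os'' s'')
      have rd: "ready s''" by (rule ready_frame[OF s'(2) 1(3)]) auto
      have S: "S = bitset (arr s'' ''R'') m" using 1(2) assms(3) by simp
      have os: "os'' = []" using 1(2) s'(1) by simp
      show ?case
      proof (intro impI, rule expand_spec[OF assms(1) rd S sol_deg_ok[OF assms(2)]], goal_cases)
        case (4 Y os1 s1)
        then have "var s1 ''m'' = m" by (simp add: ready_def graph_input_def)
        from emit_set_spec[OF this, of "''B''" os1] show ?case
        proof (rule wp_mono, goal_cases)
          case (2 os2 s2)
          obtain As where "os1 = map listing As" "set As = Y" using 4(2) by blast
          then show ?case
            using 2 by (intro exI[of _ "As @ [bitset (arr s1 ''B'') m]"]) simp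
        qed simp
      qed (use os in simp_all)
    qed
  qed
  then obtain t s' As where "exec (list_neighbours k) (start xs) t s'" "behaves t (map listing As)"
      "set As = neighbours S" "length t \<le> preprocess_time + ((m * 20 + 20) + expand_time (m * 20 + 6))"
    unfolding wp_def by auto
  then show ?thesis using outputs_eq by (intro exI[of _ t] exI[of _ s'] exI[of _ As]) simp
qed

definition process_time :: nat where
  "process_time = m * 50 + 30 + expand_time (m * 30 + 50)"

text \<open>New solutions are only appended, which is expressed by
  \<open>take (length qs) qs' = qs\<close>. Hence positions that were already expanded keep their
  solutions.\<close>

lemma process_spec:
  assumes "0 < k" "ready s" "queued qs s" "var s ''hd'' < length qs" and A: "A = qs ! var s ''hd''" "sol A"
  shows "wp (process k) process_time (\<lambda>os' s'. os' = os \<and> ready s' \<and>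
    var s' ''hd'' = Suc (var s ''hd'') \<and> bitset (arr s' ''R'') m = A \<and>
    (\<exists>qs'. queued qs' s' \<and> take (length qs) qs' = qs \<and> set qs' = set qs \<union> neighbours A)) os s"
  unfolding process_def
proof (rule wp_Seq[where T = "m * 50 + 20" and T' = "10 + expand_time (m * 30 + 50)"],
    rule wp_mono[OF load_spec[OF assms(2-4)] order.refl], goal_cases)
  case (1 os' s')
  let ?s = "sem (incr ''hd'') s'"
  let ?K = "\<lambda>Y os' s'. os' = os \<and> (\<exists>qs'. queued qs' s' \<and> take (length qs) qs' = qs \<and> set qs' = set qs \<union> Y)"
  have rd: "ready s'" by (rule ready_frame[OF assms(2) 1(2)]) auto
  have rd': "ready ?s" using rd by (simp add: ready_def graph_input_def adjacency_lists_def)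
  have hd: "var s' ''hd'' = var s ''hd''" using 1(2) by (simp add: frame_def)
  have R: "bitset (arr ?s ''R'') m = A" using 1(1) A by simp
  have "queued qs s'" by (rule queued_cong[OF assms(3)]) (use 1(2) in \<open>simp_all add: frame_def\<close>)
  then have q: "queued qs ?s" by (rule queued_cong) simp_all
  have "wp (expand k save) (expand_time (m * 30 + 50)) (?K (neighbours A)) os ?s"
  proof (rule expand_spec[OF assms(1) rd' R[symmetric] sol_deg_ok[OF A(2)]], goal_cases)
    case (3 Y os1 s1 s2)
    then show ?case using queued_cong[of _ s1 s2] by blast
  next
    case (4 Y os1 s1)
    let ?B = "bitset (arr s1 ''B'') m"
    obtain qs1 where qs1: "queued qs1 s1" "take (length qs) qs1 = qs" "set qs1 = set qs \<union> Y"
      using 4(1) by blast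
    then have len: "length qs \<le> length qs1" by (metis length_take min.cobounded1)
    show ?case
    proof (rule wp_mono[OF save_spec[OF 4(2) qs1(1) refl] order.refl], goal_cases)
      case (1 os2 s2)
      then show ?case
        using qs1 4(1) len
        by (intro conjI exI[of _ "if ?B \<in> set qs1 then qs1 else qs1 @ [?B]"]) auto
    qed
  next
    case 5
    then show ?case using q by auto
  qed auto
  then have *: "wp (expand k save) (expand_time (m * 30 + 50)) (\<lambda>os' s'. os' = os \<and> ready s' \<and>
    var s' ''hd'' = Suc (var s ''hd'') \<and> bitset (arr s' ''R'') m = A \<and>
    (\<exists>qs'. queued qs' s' \<and> take (length qs) qs' = qs \<and> set qs' = set qs \<union> neighbours A)) os ?s"
  proof (rule wp_mono[OF _ order.refl], goal_cases)
    case (1 os2 s2)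
    have w: "''hd'' \<notin> wvars (expand k save)" "''R'' \<notin> warrs (expand k save)"
      using writes_expand(2)[of k save] by (auto simp: writes_expand(1))
    have "ready s2"
      by (rule ready_frame[OF rd' 1(2)]) (use writes_expand(2)[of k save] in \<open>auto simp: writes_expand(1)\<close>)
    moreover have "var s2 ''hd'' = Suc (var s ''hd'')" using frame_var[OF 1(2) w(1)] hd by simp
    moreover have "bitset (arr s2 ''R'') m = A" using frame_arr[OF 1(2) w(2)] R by simp
    ultimately show ?case using 1(1) by simp
  qed
  show ?case
  proof (intro impI, rule wp_Seq[where T = 10 and T' = "expand_time (m * 30 + 50)"], rule wp_straight, goal_cases)
    case 3
    then show ?case using * 1(1) by simp
  qed auto
qed (simp add: process_time_def)

text \<open>Each iteration yields one piece: 3 for the test, \<open>process_time\<close>, and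
  \<open>m * 20 + 5\<close> for writing before the \<open>End\<close>. The final 3 ticks are the
  failing test. The induction is on the number of solutions not yet output.\<close>

lemma search_spec:
  assumes "0 < k" "ready s" "queued qs s" "qs \<noteq> []" "\<forall>A \<in> set qs. sol A" "var s ''hd'' \<le> length qs"
    "\<forall>i < var s ''hd''. neighbours (qs ! i) \<subseteq> set qs"
  shows "\<exists>ps qs' s'. exec (search k) s (concat (map (\<lambda>p. p @ [End]) ps) @ ticks 3) s' \<and>
    (\<forall>p \<in> set ps. End \<notin> set p \<and> length p \<le> process_time + m * 20 + 8) \<and>
    map emitted ps = map listing (drop (var s ''hd'') qs') \<and>
    distinct qs' \<and> set qs' = {A. sol A} \<and> take (length qs) qs' = qs"
  using assms(2-)
proof (induction "card {A. sol A} - var s ''hd''" arbitrary: s qs rule: less_induct)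
  case less
  let ?h = "var s ''hd''" and ?b = "Less (V ''hd'') (V ''tl'')"
  have tl: "var s ''tl'' = length qs" and dist: "distinct qs"
    using less.prems(2) by (simp_all add: queued_def)
  show ?case
  proof (cases "?h < length qs")
    case True
    \<comment> \<open>The queue is free of repetitions, so it cannot outgrow the finite set of
      solutions; this makes the measure drop.\<close>
    have "length qs \<le> card {A. sol A}"
      using dist less.prems(4) finite_sols card_mono[of "{A. sol A}" "set qs"]
      by (auto simp: distinct_card)
    then have dec: "card {A. sol A} - Suc ?h < card {A. sol A} - ?h" using True by simp
    define A where "A = qs ! ?h"
    have A: "sol A" "A \<in> set qs" using less.prems(4) True by (simp_all add: A_def)
    obtain t s1 where t: "exec (process k) s t s1" "length t \<le> process_time" "behaves t []"
        "ready s1" "var s1 ''hd'' = Suc ?h" "bitset (arr s1 ''R'') m = A"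
        "\<exists>qs1. queued qs1 s1 \<and> take (length qs) qs1 = qs \<and> set qs1 = set qs \<union> neighbours A"
      using process_spec[OF assms(1) less.prems(1,2) True A_def A(1), of "[]"] unfolding wp_def by auto
    then obtain qs1 where qs1: "queued qs1 s1" "take (length qs) qs1 = qs" "set qs1 = set qs \<union> neighbours A"
      by blast
    have len: "length qs \<le> length qs1" using qs1(2) by (metis length_take min.cobounded1)
    have nth: "qs1 ! i = qs ! i" if "i < length qs" for i using qs1(2) that by (metis nth_take)
    have m: "var s1 ''m'' = m" using t(4) by (simp add: ready_def graph_input_def)
    obtain u s2 where u: "exec (emit_set ''R'') s1 (u @ [End]) s2" "End \<notin> set u"
        "emitted u = listing A" "length u \<le> m * 20 + 5"
      using exec_emit_set[of "''R''" s1] m t(6) listing_bitset[of "arr s1 ''R''"] by auto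
    have fr: "frame (emit_set ''R'') s1 s2" by (rule exec_frame[OF u(1)])
    have hd2: "var s2 ''hd'' = Suc ?h" using fr t(5) by (simp add: frame_def)
    have "\<exists>ps qs' s'. exec (search k) s2 (concat (map (\<lambda>p. p @ [End]) ps) @ ticks 3) s' \<and>
      (\<forall>p \<in> set ps. End \<notin> set p \<and> length p \<le> process_time + m * 20 + 8) \<and>
      map emitted ps = map listing (drop (var s2 ''hd'') qs') \<and>
      distinct qs' \<and> set qs' = {A. sol A} \<and> take (length qs1) qs' = qs1"
    proof (rule less.hyps)
      show "card {A. sol A} - var s2 ''hd'' < card {A. sol A} - ?h" using dec hd2 by simp
      show "ready s2" by (rule ready_frame[OF t(4) fr]) auto
      show "queued qs1 s2" by (rule queued_cong[OF qs1(1)]) (use fr in \<open>simp_all add: frame_def\<close>)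
      show "qs1 \<noteq> []" using len less.prems(3) by auto
      show "\<forall>A \<in> set qs1. sol A"
        using qs1(3) less.prems(4) sol_neighbours[OF A(1) assms(1)] by auto
      show "var s2 ''hd'' \<le> length qs1" using hd2 True len by simp
      show "\<forall>i < var s2 ''hd''. neighbours (qs1 ! i) \<subseteq> set qs1"
      proof (intro allI impI)
        fix i assume "i < var s2 ''hd''"
        then consider "i < ?h" | "i = ?h" using hd2 by linarith
        then show "neighbours (qs1 ! i) \<subseteq> set qs1"
        proof cases
          case 1
          then show ?thesis using less.prems(6) nth[of i] True qs1(3) by auto
        next
          case 2
          then show ?thesis using nth[of i] True qs1(3) by (simp add: A_def)
        qed
      qed
    qed
    then obtain ps qs' s' where ps: "exec (search k) s2 (concat (map (\<lambda>p. p @ [End]) ps) @ ticks 3) s'"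
      "\<forall>p \<in> set ps. End \<notin> set p \<and> length p \<le> process_time + m * 20 + 8"
      "map emitted ps = map listing (drop (Suc ?h) qs')"
      "distinct qs'" "set qs' = {A. sol A}" "take (length qs1) qs' = qs1"
      unfolding hd2 by blast
    have len': "length qs1 \<le> length qs'" using ps(6) by (metis length_take min.cobounded1)
    have take': "take (length qs) qs' = qs"
      using ps(6) qs1(2) len by (metis min.absorb1 take_take)
    then have "qs' ! ?h = A" using True unfolding A_def by (metis nth_take)
    then have drop: "drop ?h qs' = A # drop (Suc ?h) qs'"
      using Cons_nth_drop_Suc[of ?h qs'] True len len' by simp
    define p where "p = ticks (bcost ?b) @ t @ u"
    have "exec (Seq (process k) (emit_set ''R'')) s (t @ u @ [End]) s2"
      by (rule exec.Seq[OF t(1) u(1)])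
    then have "exec (search k) s (ticks (bcost ?b) @ (t @ u @ [End]) @ (concat (map (\<lambda>p. p @ [End]) ps) @ ticks 3)) s'"
      using ps(1) True tl unfolding search_def by (intro exec.WhileTrue) simp_all
    then have ex: "exec (search k) s (concat (map (\<lambda>p. p @ [End]) (p # ps)) @ ticks 3) s'"
      by (simp add: p_def)
    have p: "End \<notin> set p" "length p \<le> process_time + m * 20 + 8" "emitted p = listing A"
      using t(2) u no_End[OF t(3)] emitted_quiet[OF t(3)] by (auto simp: p_def emitted_append)
    show ?thesis
      by (intro exI[of _ "p # ps"] exI[of _ qs'] exI[of _ s'] conjI ex take' ps(4,5))
        (use p ps(2,3) drop in auto)
  next
    case False
    then have hd: "?h = length qs" using less.prems(5) by simp
    \<comment> \<open>Everything queued has been expanded, so the queue is closed under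
      neighbours.\<close>
    have "neighbours S \<subseteq> set qs" if "S \<in> set qs" for S
      using that less.prems(6) hd by (metis in_set_conv_nth)
    then have "set qs = {A. sol A}"
      using less.prems(3,4) by (intro closed_under_neighbours[OF assms(1)]) auto
    moreover have "exec (search k) s (ticks 3) s"
      using exec.WhileFalse[of ?b s] hd tl by (simp add: search_def numeral_eq_Suc)
    ultimately show ?thesis
      using dist hd by (intro exI[of _ "[]"] exI[of _ qs] exI[of _ s]) simp
  qed
qed

definition enumeration_delay :: nat where
  "enumeration_delay = preprocess_time + complete_time + process_time + m * 50 + 70"

lemma enumerate_spec:
  assumes "0 < k"
  shows "\<exists>t s' qs. exec (enumerate k) (start []) t s' \<and> outputs t = map listing qs \<and>
    distinct qs \<and> set qs = {A. sol A} \<and> delay t \<le> enumeration_delay"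
proof -
  have "wp (Seq preprocess (Seq (complete k) save)) (preprocess_time + (complete_time + (m * 30 + 50)))
      (\<lambda>os' s'. os' = [] \<and> ready s' \<and> var s' ''hd'' = 0 \<and> (\<exists>A. sol A \<and> queued [A] s')) [] (start [])"
  proof (rule wp_Seq[OF _ order.refl], rule wp_mono[OF preprocess_start order.refl], goal_cases)
    case (1 os' s')
    then have s': "os' = []" "ready s'" "arr s' ''B'' = (\<lambda>_. 0)" by simp_all
    show ?case
    proof (intro impI, rule wp_Seq[OF _ order.refl],
        rule wp_mono[OF first_spec[OF assms s'(2,3)] order.refl], goal_cases)
      case (1 os'' s'')
      then have s'': "os'' = []" "ready s''" "sol (bitset (arr s'' ''B'') m)" using s'(1) by simp_all
      have hd: "var s'' ''hd'' = 0" and q: "queued [] s''"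
        using 1(3) \<open>os' = [] \<and> _\<close> by (simp_all add: frame_def queued_def)
      show ?case
      proof (intro impI, rule wp_mono[OF save_spec[OF s''(2) q refl] order.refl], goal_cases)
        case (1 os3 s3)
        have "ready s3" by (rule ready_frame[OF s''(2) 1(3)]) auto
        moreover have "var s3 ''hd'' = 0" using 1(3) hd by (simp add: frame_def)
        ultimately show ?case using 1(2) s'' by auto
      qed
    qed
  qed
  then obtain t0 s0 A where t0: "exec (Seq preprocess (Seq (complete k) save)) (start []) t0 s0"
      "length t0 \<le> preprocess_time + (complete_time + (m * 30 + 50))" "behaves t0 []"
      "ready s0" "var s0 ''hd'' = 0" "sol A" "queued [A] s0"
    unfolding wp_def by auto
  obtain ps qs s' where ps: "exec (search k) s0 (concat (map (\<lambda>p. p @ [End]) ps) @ ticks 3) s'"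
      "\<forall>p \<in> set ps. End \<notin> set p \<and> length p \<le> process_time + m * 20 + 8"
      "map emitted ps = map listing qs" "distinct qs" "set qs = {A. sol A}" "take 1 qs = [A]"
    using search_spec[OF assms t0(4,7)] t0(5,6) by auto
  have "qs \<noteq> []" using ps(6) by auto
  then obtain p ps' where p: "ps = p # ps'" using ps(3) by (cases ps) auto
  \<comment> \<open>The preparation outputs nothing, so its time counts towards the first output,
    which exists because there is at least one solution.\<close>
  let ?ps = "(t0 @ p) # ps'"
  let ?t = "concat (map (\<lambda>p. p @ [End]) ?ps) @ ticks 3"
  have "exec (enumerate k) (start []) ?t s'"
    using exec.Seq[OF t0(1) ps(1)] by (simp add: enumerate_def p)
  moreover have ends: "\<forall>p \<in> set ?ps. End \<notin> set p \<and> length p \<le> enumeration_delay - 1"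
    using ps(2) t0(2) no_End[OF t0(3)] by (auto simp: p enumeration_delay_def)
  moreover have "outputs ?t = map listing qs"
    using ps(3) ends emitted_quiet[OF t0(3)] by (subst outputs_pieces) (auto simp: p emitted_append)
  moreover have "delay ?t \<le> enumeration_delay - 1 + 1"
    using ends by (intro delay_pieces_le) (auto simp: enumeration_delay_def)
  moreover have "enumeration_delay - 1 + 1 = enumeration_delay" by (simp add: enumeration_delay_def)
  ultimately show ?thesis
    using ps(4,5) by (intro exI[of _ ?t] exI[of _ s'] exI[of _ qs]) simp
qed

end

section \<open>Time bounds\<close>

text \<open>From the lower bound \<open>(b / d) ^ d\<close> for the binomial coefficient. It
  replaces the number of tuples by that of sets at the price of the constant
  \<open>d ^ d\<close>.\<close>

lemma power_le_binomial: "d \<le> b \<Longrightarrow> b ^ d \<le> d ^ d * (b choose d)"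
proof (cases "d = 0")
  case False
  assume "d \<le> b"
  have "(real b / real d) ^ d \<le> real (b choose d)"
    using binomial_ge_n_over_k_pow_k[OF \<open>d \<le> b\<close>, where 'a = real] .
  then have "real (b ^ d) \<le> real (d ^ d * (b choose d))"
    using False by (simp add: power_divide divide_simps mult.commute)
  then show ?thesis by (simp only: of_nat_le_iff)
qed simp

context simple_graph_instance
begin

lemma m_powers:
  "1 \<le> (m + 1) ^ 2" "m \<le> (m + 1) ^ 2" "m * m \<le> (m + 1) ^ 2" "m * n \<le> 2 * (m + 1) ^ 2"
proof -
  have "m * n \<le> m * (2 * m)" by (rule mult_le_mono2[OF n_le])
  also have "\<dots> \<le> 2 * (m + 1) ^ 2" by (simp add: power2_eq_square)
  finally show "m * n \<le> 2 * (m + 1) ^ 2" .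
qed (simp_all add: power2_eq_square)

lemma preprocess_complete_time: "preprocess_time \<le> 300 * (m + 1) ^ 2" "complete_time \<le> 500 * (m + 1) ^ 2"
proof -
  have "preprocess_time = 50 * (m * n) + 30 * n + 20 * m + 40"
    by (simp add: preprocess_time_def algebra_simps)
  also have "\<dots> \<le> 300 * (m + 1) ^ 2" using m_powers n_le by linarith
  finally show "preprocess_time \<le> 300 * (m + 1) ^ 2" .
  have "complete_time = 80 * (m * n) + 210 * (m * m) + 90 * m + 10"
    by (simp add: complete_time_def algebra_simps)
  also have "\<dots> \<le> 500 * (m + 1) ^ 2" using m_powers by linarith
  finally show "complete_time \<le> 500 * (m + 1) ^ 2" .
qed

text \<open>The added ones absorb terms of lower order and keep the bound positive for the graph
  without edges.\<close>

definition size_bound :: nat where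
  "size_bound = (m + 1) ^ 3 * (n + 1) ^ (k - 1)"

lemma square_le_size_bound: "(m + 1) ^ 2 \<le> size_bound"
proof -
  have "0 < (m + 1) * (n + 1) ^ (k - 1)" by simp
  then have "(m + 1) ^ 2 * 1 \<le> (m + 1) ^ 2 * ((m + 1) * (n + 1) ^ (k - 1))"
    by (intro mult_le_mono2) (simp only: One_nat_def Suc_le_eq)
  then show ?thesis by (simp add: size_bound_def power_numeral_reduce algebra_simps)
qed

text \<open>One factor \<open>m\<close> comes from the choice of \<open>e\<close>, the square from
  one greedy completion, the power of \<open>n + 1\<close> from the guesses. The hypothesis allows
  \<open>post\<close> to cost about as much as a completion, which covers both of its uses.\<close>

lemma expand_time_le:
  assumes "T \<le> 100 * (m + 1) ^ 2"
  shows "expand_time T \<le> (100 * k + 2000) * size_bound"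
proof -
  let ?M = "(m + 1) ^ 2" and ?P = "(n + 1) ^ (k - 1)"
  have "visit_time T + 20 * k = k * 30 * m + 150 * m + (80 * (m * n) + 210 * (m * m) + 90 * m) + T + 20 + 20 * k"
    by (simp add: visit_time_def algebra_simps)
  also have "\<dots> \<le> k * 30 * ?M + 900 * ?M + 20 * k * ?M"
  proof -
    have "k * 30 * m \<le> k * 30 * ?M" "20 * k * 1 \<le> 20 * k * ?M"
      using m_powers by (intro mult_le_mono2; simp)+
    then show ?thesis using m_powers assms by linarith
  qed
  also have "\<dots> = (50 * k + 900) * ?M" by (simp add: algebra_simps)
  finally have visit: "visit_time T + 20 * k \<le> (50 * k + 900) * ?M" .
  have "expand_time T = m * (2 * (?P * (visit_time T + 20 * k))) + 60 * m + 10"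
    by (simp add: expand_time_def algebra_simps)
  also have "m * (2 * (?P * (visit_time T + 20 * k))) \<le> (m + 1) * (2 * (?P * ((50 * k + 900) * ?M)))"
    using visit by (intro mult_le_mono) auto
  also have "\<dots> = (100 * k + 1800) * size_bound"
    by (simp add: size_bound_def power_numeral_reduce algebra_simps)
  finally have "expand_time T \<le> (100 * k + 1800) * size_bound + 60 * m + 10" by simp
  moreover have "60 * m + 10 \<le> 70 * size_bound" using m_powers square_le_size_bound by linarith
  ultimately show ?thesis by (simp add: algebra_simps)
qed

lemma find_solution_time: "preprocess_time + complete_time + m * 20 + 6 \<le> 1000 * (m + 1) ^ 2"
  using preprocess_complete_time m_powers by linarith

lemma list_neighbours_time:
  "preprocess_time + m * 20 + 20 + expand_time (m * 20 + 6) \<le>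
    (100 * k + 3000) * (m + 1) ^ 3 * (2 * m + 1) ^ (k - 1)"
proof -
  have "m * 20 + 6 \<le> 100 * (m + 1) ^ 2" using m_powers by linarith
  note expand_time_le[OF this]
  moreover have "preprocess_time + m * 20 + 20 \<le> 1000 * size_bound"
    using preprocess_complete_time m_powers square_le_size_bound by linarith
  ultimately have "preprocess_time + m * 20 + 20 + expand_time (m * 20 + 6) \<le> (100 * k + 3000) * size_bound"
    by (simp add: algebra_simps)
  also have "\<dots> \<le> (100 * k + 3000) * ((m + 1) ^ 3 * (2 * m + 1) ^ (k - 1))"
    unfolding size_bound_def using n_le by (intro mult_le_mono order.refl power_mono) auto
  finally show ?thesis by (simp add: mult.assoc)
qed

lemma enumeration_delay_le: "enumeration_delay \<le> (100 * k + 4000) * size_bound"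
proof -
  have "m * 30 + 50 \<le> 100 * (m + 1) ^ 2" using m_powers by linarith
  note expand_time_le[OF this]
  moreover have "preprocess_time + complete_time + (m * 50 + 30) + m * 50 + 70 \<le> 2000 * size_bound"
    using preprocess_complete_time m_powers square_le_size_bound by linarith
  ultimately show ?thesis
    unfolding enumeration_delay_def process_time_def by (simp add: algebra_simps)
qed

text \<open>If \<open>n < k - 1\<close>, the binomial coefficient vanishes, but then \<open>G\<close> has bounded size.\<close>

lemma size_bound_le:
  "size_bound \<le> (1 + 8 * 2 ^ (k - 1) * (k - 1) ^ (k - 1) + (2 ^ (k - 1) + 1) ^ 3 * (k - 1) ^ (k - 1)) *
    max 1 ((n choose (k - 1)) * card (edges G) ^ 3)" (is "_ \<le> (1 + ?C + ?D) * ?b")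
proof -
  define d where "d = k - 1"
  \<comment> \<open>Each case accounts for one summand of the constant: 1 for the empty graph,
    \<open>?D\<close> for \<open>n < d\<close> by \<open>m \<le> 2 ^ n\<close>, and
    \<open>?C\<close> otherwise. In \<open>?C\<close>, the factor \<open>8 * 2 ^ d\<close> comes
    from \<open>m + 1 \<le> 2 * m\<close> and \<open>n + 1 \<le> 2 * n\<close>.\<close>
  consider "m = 0" | "0 < m" "n < d" | "0 < m" "d \<le> n" by linarith
  then have "size_bound \<le> 1 \<or> size_bound \<le> ?D \<or> size_bound \<le> ?C * ((n choose d) * m ^ 3)"
  proof cases
    case 1
    then have "n = 0" using n_le by simp
    have "size_bound = (0 + 1) ^ 3 * (0 + 1) ^ (k - 1)" unfolding size_bound_def 1 \<open>n = 0\<close> ..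
    then show ?thesis by simp
  next
    case 2
    have "m + 1 \<le> 2 ^ d + 1"
      using m_le 2 power_increasing[of n d "2::nat"] by linarith
    then have "size_bound \<le> (2 ^ d + 1) ^ 3 * d ^ d"
      unfolding size_bound_def d_def[symmetric] using 2 by (intro mult_le_mono power_mono) auto
    then show ?thesis by (simp add: d_def)
  next
    case 3
    have "0 < n" using 3 ed_less[of 0 "fst (G ! 0)"] ed_eq[of 0] by auto
    with 3 have "m + 1 \<le> 2 * m" "n + 1 \<le> 2 * n" by linarith+
    then have "size_bound \<le> (2 * m) ^ 3 * (2 * n) ^ d"
      unfolding size_bound_def d_def[symmetric] by (intro mult_le_mono power_mono) simp_all
    also have "\<dots> = 8 * 2 ^ d * (n ^ d * m ^ 3)" by (simp add: power_mult_distrib)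
    also have "\<dots> \<le> 8 * 2 ^ d * (d ^ d * (n choose d) * m ^ 3)"
      using power_le_binomial[OF 3(2)] by (intro mult_le_mono) auto
    finally show ?thesis by (simp add: d_def mult.assoc)
  qed
  moreover have "1 \<le> ?b" "(n choose d) * m ^ 3 \<le> ?b" by (simp_all add: d_def card_edges)
  then have "1 \<le> 1 * ?b" "?D * 1 \<le> ?D * ?b" "?C * ((n choose d) * m ^ 3) \<le> ?C * ?b"
    by (simp, intro mult_le_mono2, simp, intro mult_le_mono2, simp)
  ultimately show ?thesis unfolding distrib_right by linarith
qed

section \<open>The listing problem\<close>

lemma solutions_eq: "solutions (degenerate_subgraph_listing k) G = {ed ` A | A. sol A}"
proof -
  have "solutions (degenerate_subgraph_listing k) G = {F. \<exists>A. sol A \<and> F = ed ` A}"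
    by (auto simp: degenerate_subgraph_listing_def maximal_degenerate_iff)
  also have "\<dots> = {ed ` A | A. sol A}" by blast
  finally show ?thesis .
qed

definition neighbour_sets :: "nat set set \<Rightarrow> nat set set set" where
  "neighbour_sets F = (`) ed ` neighbours {j. j < m \<and> ed j \<in> F}"

lemma neighbour_sets_image: "sol A \<Longrightarrow> neighbour_sets (ed ` A) = (`) ed ` neighbours A"
proof -
  assume "sol A"
  then have "{j. j < m \<and> ed j \<in> ed ` A} = A"
    using sol_subset[of A] by (auto simp: ed_inject subset_iff)
  then show ?thesis by (simp add: neighbour_sets_def)
qed

lemma list_all2_represents:
  "\<forall>A \<in> set As. sol A \<Longrightarrow>
    list_all2 (represents (edge_list G)) (map listing As) (map ((`) ed) As)"
  by (induction As) (auto intro: represents_listing dest: sol_subset)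

end

lemma simple_graph_instance: "G \<in> instances (degenerate_subgraph_listing k) \<Longrightarrow> simple_graph_instance G"
  by (simp add: simple_graph_instance_def degenerate_subgraph_listing_def)

lemma universe_eq: "universe (degenerate_subgraph_listing k) G = edge_list G"
  by (simp add: degenerate_subgraph_listing_def)

lemma proximity_searchable_pos:
  assumes "0 < k"
  shows "proximity_searchable (degenerate_subgraph_listing k)" (is "proximity_searchable ?P")
  unfolding proximity_searchable_def
proof (rule exI[of _ "\<lambda>_. proximity k"],
    rule exI[of _ "\<lambda>G. simple_graph_instance.neighbour_sets G k"], intro conjI ballI impI)
  let ?prox = "\<lambda>_. proximity k" and ?nb = "\<lambda>G. simple_graph_instance.neighbour_sets G k"
  fix G assume "G \<in> instances ?P"
  then interpret simple_graph_instance G k by (rule simple_graph_instance)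
  fix S assume "S \<in> solutions ?P G"
  then obtain A where A: "sol A" "S = ed ` A" by (auto simp: solutions_eq)
  have nb: "?nb G S = (`) ed ` neighbours A" using neighbour_sets_image[OF A(1)] A(2) by simp
  show "?nb G S \<subseteq> solutions ?P G"
    unfolding nb solutions_eq using sol_neighbours[OF A(1) assms] by blast
  fix T assume "T \<in> solutions ?P G"
  then obtain B where B: "sol B" "T = ed ` B" by (auto simp: solutions_eq)
  have "finite T" "{} \<notin> T"
    using B finite_subset[of B "{..<m}"] sol_subset[OF B(1)] ed_nonempty by auto
  then have "proximity k S T \<subseteq> T"
    using sol_deg_ok[OF B(1)] B(2) by (intro proximity_subset) auto
  also have "T \<subseteq> set (universe ?P G)"
    using B sol_subset[OF B(1)] by (auto simp: universe_eq edges_eq[unfolded edges_def])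
  finally show "?prox G S T \<subseteq> set (universe ?P G)" .
  assume "S \<noteq> T"
  then have "A \<noteq> B" using A B by blast
  then obtain A' where A': "A' \<in> neighbours A"
      "card (proximity k (ed ` A) (ed ` B)) < card (proximity k (ed ` A') (ed ` B))"
    using neighbour_closer[OF A(1) B(1) _ assms] by auto
  then show "\<exists>S' \<in> ?nb G S. card (?prox G S T) < card (?prox G S' T)"
    unfolding nb unfolding A(2) B(2) by (intro bexI[of _ "ed ` A'"]) auto
next
  show "finds_solution_in_poly_time ?P"
    unfolding finds_solution_in_poly_time_def
  proof (rule exI[of _ "find_solution k"], rule exI[of _ "[:1000:] * [:1, 1:] ^ 2"], intro ballI)
    fix G assume "G \<in> instances ?P"
    then interpret simple_graph_instance G k by (rule simple_graph_instance)
    obtain t s' A where t: "exec (find_solution k) (initial (encode ?P G) []) t s'"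
        "length t \<le> preprocess_time + complete_time + m * 20 + 6" "outputs t = [listing A]" "sol A"
      using find_solution_spec[OF assms] by blast
    have "length t \<le> poly ([:1000:] * [:1, 1:] ^ 2) (length (universe ?P G))"
      using t(2) find_solution_time by (simp add: universe_eq)
    moreover have "represents (universe ?P G) (listing A) (ed ` A)" "ed ` A \<in> solutions ?P G"
      using represents_listing[OF sol_subset[OF t(4)]] t(4) by (auto simp: universe_eq solutions_eq)
    ultimately show "\<exists>t s' xs S. exec (find_solution k) (initial (encode ?P G) []) t s' \<and>
      length t \<le> poly ([:1000:] * [:1, 1:] ^ 2) (length (universe ?P G)) \<and>
      outputs t = [xs] \<and> represents (universe ?P G) xs S \<and> S \<in> solutions ?P G"
      using t(1,3) by blast
  qed
next
  let ?p = "[:100 * k + 3000:] * [:1, 1:] ^ 3 * [:1, 2:] ^ (k - 1)"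
  show "computable_in_poly_time ?P (\<lambda>G. simple_graph_instance.neighbour_sets G k)"
    unfolding computable_in_poly_time_def
  proof (rule exI[of _ "list_neighbours k"], rule exI[of _ ?p], intro ballI allI impI)
    fix G S xs
    assume "G \<in> instances ?P" and S: "S \<in> solutions ?P G" and xs: "represents (universe ?P G) xs S"
    then interpret simple_graph_instance G k by (intro simple_graph_instance)
    obtain A where A: "sol A" "S = ed ` A" using S by (auto simp: solutions_eq)
    have "set xs = A"
    proof -
      have "set xs \<subseteq> {..<m}" "ed ` set xs = ed ` A" "distinct xs"
        using xs A(2) by (auto simp: represents_def universe_eq)
      then show ?thesis using inj_on_image_eq_iff[OF inj_ed _ sol_subset[OF A(1)]] by blast
    qed
    moreover have "distinct xs" using xs by (simp add: represents_def)
    ultimately obtain t s' As where t: "exec (list_neighbours k) (initial (encode ?P G) xs) t s'"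
        "length t \<le> preprocess_time + m * 20 + 20 + expand_time (m * 20 + 6)"
        "outputs t = map listing As" "set As = neighbours A"
      using list_neighbours_spec[OF assms A(1)] by blast
    have "length t \<le> poly ?p (length (universe ?P G))"
      using order.trans[OF t(2) list_neighbours_time] by (simp add: universe_eq ac_simps mult_2_right)
    moreover have "list_all2 (represents (universe ?P G)) (outputs t) (map ((`) ed) As)"
      unfolding t(3) universe_eq
      by (intro list_all2_represents) (use t(4) sol_neighbours[OF A(1) assms] in auto)
    moreover have "set (map ((`) ed) As) = neighbour_sets S"
      using t(4) neighbour_sets_image[OF A(1)] A(2) by simp
    ultimately show "\<exists>t s' Ss. exec (list_neighbours k) (initial (encode ?P G) xs) t s' \<and>
      length t \<le> poly ?p (length (universe ?P G)) \<and>
      list_all2 (represents (universe ?P G)) (outputs t) Ss \<and> set Ss = neighbour_sets S"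
      using t(1) by blast
  qed
qed

lemma enumerable_pos:
  assumes "0 < k"
  shows "enumerable_with_delay (degenerate_subgraph_listing k)
    (\<lambda>G. (card (vertices G) choose (k - 1)) * card (edges G) ^ 3)" (is "enumerable_with_delay ?P ?f")
  unfolding enumerable_with_delay_def
proof -
  let ?C = "1 + 8 * 2 ^ (k - 1) * (k - 1) ^ (k - 1) + (2 ^ (k - 1) + 1) ^ 3 * (k - 1) ^ (k - 1)"
  show "\<exists>c C. \<forall>G \<in> instances ?P. \<exists>t s' Ss. exec c (initial (encode ?P G) []) t s' \<and>
    list_all2 (represents (universe ?P G)) (outputs t) Ss \<and>
    distinct Ss \<and> set Ss = solutions ?P G \<and> delay t \<le> C * max 1 (?f G)"
  proof (rule exI[of _ "enumerate k"], rule exI[of _ "(100 * k + 4000) * ?C"], intro ballI)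
  fix G assume "G \<in> instances ?P"
  then interpret simple_graph_instance G k by (rule simple_graph_instance)
  obtain t s' qs where t: "exec (enumerate k) (initial (encode ?P G) []) t s'"
      "outputs t = map listing qs" "distinct qs" "set qs = {A. sol A}" "delay t \<le> enumeration_delay"
    using enumerate_spec[OF assms] by blast
  have "delay t \<le> (100 * k + 4000) * size_bound"
    using t(5) enumeration_delay_le by (rule order.trans)
  also have "\<dots> \<le> (100 * k + 4000) * (?C * max 1 (?f G))"
    by (intro mult_le_mono2 size_bound_le)
  finally have "delay t \<le> (100 * k + 4000) * ?C * max 1 (?f G)" by (simp only: mult.assoc)
  moreover have "list_all2 (represents (universe ?P G)) (outputs t) (map ((`) ed) qs)"
    unfolding t(2) universe_eq by (intro list_all2_represents) (simp add: t(4))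
  moreover have "distinct (map ((`) ed) qs)"
  proof -
    have "inj_on ((`) ed) (set qs)"
      using t(4) sol_subset by (intro inj_onI) (auto simp: inj_on_image_eq_iff[OF inj_ed])
    then show ?thesis using t(3) by (simp add: distinct_map)
  qed
  moreover have "set (map ((`) ed) qs) = solutions ?P G"
    using t(4) by (auto simp: solutions_eq)
  ultimately show "\<exists>t s' Ss. exec (enumerate k) (initial (encode ?P G) []) t s' \<and>
    list_all2 (represents (universe ?P G)) (outputs t) Ss \<and>
    distinct Ss \<and> set Ss = solutions ?P G \<and> delay t \<le> (100 * k + 4000) * ?C * max 1 (?f G)"
    using t(1) by blast
  qed
qed

section \<open>The case \<open>k = 0\<close>\<close>

lemma solutions_0:
  assumes "G \<in> instances (degenerate_subgraph_listing 0)"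
  shows "solutions (degenerate_subgraph_listing 0) G = {{}}"
proof -
  interpret simple_graph_instance G 0 using assms by (rule simple_graph_instance)
  have "degenerate 0 F \<longleftrightarrow> F = {}" if "F \<subseteq> edges G" for F
    using that ed_nonempty[of "{..<m}"] finite_subset[OF that]
    by (intro degenerate_0_iff) (auto simp: edges_eq)
  then have "maximal_degenerate 0 (edges G) F \<longleftrightarrow> F = {}" for F
    unfolding maximal_degenerate_def by blast
  then show ?thesis by (auto simp: degenerate_subgraph_listing_def)
qed

lemma short_trace_simps: "outputs [End] = [[]]" "outputs [Tick] = []" "delay [End] = 1"
  by (simp_all add: outputs_def delay_def)

text \<open>With a single solution there are no two distinct ones to compare, so the empty neighbour
  function will do.\<close>

lemma proximity_searchable_0: "proximity_searchable (degenerate_subgraph_listing 0)"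
  (is "proximity_searchable ?P")
  unfolding proximity_searchable_def
proof (intro exI[of _ "\<lambda>_ _ _. {}"] exI[of _ "\<lambda>_ _. {}"] conjI ballI impI)
  show "finds_solution_in_poly_time ?P"
    unfolding finds_solution_in_poly_time_def
  proof (intro exI ballI)
    fix G assume "G \<in> instances ?P"
    then show "exec Finish (initial (encode ?P G) []) [End] (initial (encode ?P G) []) \<and>
      length [End] \<le> poly [:1:] (length (universe ?P G)) \<and>
      outputs [End] = [[]] \<and> represents (universe ?P G) [] {} \<and> {} \<in> solutions ?P G"
      by (simp add: exec.Finish short_trace_simps represents_def solutions_0)
  qed
  show "computable_in_poly_time ?P (\<lambda>_ _. {})"
    unfolding computable_in_poly_time_def
  proof (intro exI ballI allI impI)
    fix G S xs
    show "exec SKIP (initial (encode ?P G) xs) [Tick] (initial (encode ?P G) xs) \<and>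
      length [Tick] \<le> poly [:1:] (length (universe ?P G)) \<and>
      list_all2 (represents (universe ?P G)) (outputs [Tick]) [] \<and> set [] = {}"
      by (simp add: exec.Skip short_trace_simps)
  qed
qed (auto simp: solutions_0)

text \<open>\<open>Finish\<close> alone outputs the empty object, which is the only solution, in one
  step; hence the bound holds for any \<open>f\<close>.\<close>

lemma enumerable_0: "enumerable_with_delay (degenerate_subgraph_listing 0) f"
  (is "enumerable_with_delay ?P f")
  unfolding enumerable_with_delay_def
proof (intro exI ballI)
  fix G assume "G \<in> instances ?P"
  then show "exec Finish (initial (encode ?P G) []) [End] (initial (encode ?P G) []) \<and>
    list_all2 (represents (universe ?P G)) (outputs [End]) [{}] \<and>
    distinct [{}] \<and> set [{}] = solutions ?P G \<and> delay [End] \<le> 1 * max 1 (f G)"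
    by (simp add: exec.Finish short_trace_simps represents_def solutions_0)
qed

theorem theorem6p4:
  fixes k :: nat
  shows "proximity_searchable (degenerate_subgraph_listing k) \<and>
    enumerable_with_delay (degenerate_subgraph_listing k)
      (\<lambda>G. (card (vertices G) choose (k - 1)) * card (edges G) ^ 3)"
proof (cases "k = 0")
  case True
  then show ?thesis using proximity_searchable_0 enumerable_0 by simp
next
  case False
  then show ?thesis using proximity_searchable_pos enumerable_pos by simp
qed

end
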